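(* Let $G$ be a totally disconnected locally compact abelian group that is neither discrete nor periodic. Then the following statements are equivalent: (a) $G$ is topologically modular. (b) Both of the following hold: (b.1) $T=\mathrm{tor}(G)=\mathrm{comp}(G)$ is open in $G$, and $G/T$ is discrete and torsion-free of finite $\mathbb{Z}$-rank. (b.2) The torsion subgroup $T=\mathrm{tor}(G)$ is strongly topologically quasihamiltonian. (c) $G$ is strongly topologically quasihamiltonian. Moreover, when (b) holds and $N$ is any closed subgroup of $G$ contained in $T$, then $\mathrm{tor}(G/N)=T/N$ and (b) (that is, (b.1) and (b.2)) holds for $G/N$ with $T$ replaced by $T/N$.
   Context: All topological groups are Hausdorff; abelian groups are written additively. A locally compact abelian (LCA) group is periodic if it is totally disconnected and the union of its compact subgroups. $\mathrm{tor}(G)$ is the subgroup of elements of finite order; $\mathrm{comp}(G)$ is the union of all compact subgroups of $G$ (a subgroup). The $\mathbb{Z}$-rank of a discrete abelian group $A$ is $\dim_{\mathbb{Q}}(A\otimes_{\mathbb{Z}}\mathbb{Q})$. For closed subgroups $A,B$ of an LCA group $G$ put $A\vee B=\overline{A+B}$ and $A\wedge B=A\cap B$. $G$ is topologically modular if $A\vee(B\wedge C)=(A\vee B)\wedge C$ for all closed subgroups $A,B,C$ of $G$ with $A\subseteq C$. $G$ is strongly topologically quasihamiltonian if $X+Y$ is closed in $G$ for all closed subgroups $X,Y$ of $G$. *)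

theory Defs
  imports
    "HOL-Analysis.Abstract_Topological_Spaces"
    "HOL-Algebra.Free_Abelian_Groups"
    "Jordan_Normal_Form.VS_Connect"
begin

text \<open>
  Topological groups are pairs of a HOL-Algebra group \<open>G\<close> and a topology \<open>\<tau>\<close> with
  \<open>topspace \<tau> = carrier G\<close>, so that subgroups (\<open>G\<lparr>carrier := H\<rparr>\<close> with the subspace topology)
  and quotients (\<open>G Mod N\<close> with the quotient topology) are again of this form.
  HOL-Algebra writes groups multiplicatively: \<open>A + B\<close> is \<open>A <#>\<^bsub>G\<^esub> B\<close>, and \<open>n x\<close> is \<open>x [^]\<^bsub>G\<^esub> n\<close>.
\<close>

definition topological_abelian_group :: "('a, 'm) monoid_scheme \<Rightarrow> 'a topology \<Rightarrow> bool" where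
  "topological_abelian_group G \<tau> \<longleftrightarrow>
     comm_group G \<and> topspace \<tau> = carrier G \<and> Hausdorff_space \<tau> \<and>
     continuous_map (prod_topology \<tau> \<tau>) \<tau> (\<lambda>(x, y). x \<otimes>\<^bsub>G\<^esub> y) \<and>
     continuous_map \<tau> \<tau> (\<lambda>x. inv\<^bsub>G\<^esub> x)"

definition lca_group :: "('a, 'm) monoid_scheme \<Rightarrow> 'a topology \<Rightarrow> bool" where
  "lca_group G \<tau> \<longleftrightarrow> topological_abelian_group G \<tau> \<and> locally_compact_space \<tau>"

definition totally_disconnected_space :: "'a topology \<Rightarrow> bool" where
  "totally_disconnected_space \<tau> \<longleftrightarrow> (\<forall>S. connectedin \<tau> S \<longrightarrow> (\<exists>x. S \<subseteq> {x}))"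

definition discrete_space :: "'a topology \<Rightarrow> bool" where
  "discrete_space \<tau> \<longleftrightarrow> \<tau> = discrete_topology (topspace \<tau>)"

definition tor :: "('a, 'm) monoid_scheme \<Rightarrow> 'a set" where
  "tor G = {x \<in> carrier G. \<exists>n::nat. n > 0 \<and> x [^]\<^bsub>G\<^esub> n = \<one>\<^bsub>G\<^esub>}"

definition compact_part :: "('a, 'm) monoid_scheme \<Rightarrow> 'a topology \<Rightarrow> 'a set" where
  "compact_part G \<tau> = \<Union>{K. subgroup K G \<and> compactin \<tau> K}"

definition periodic :: "('a, 'm) monoid_scheme \<Rightarrow> 'a topology \<Rightarrow> bool" where
  "periodic G \<tau> \<longleftrightarrow> totally_disconnected_space \<tau> \<and> compact_part G \<tau> = carrier G"

definition torsion_free :: "('a, 'm) monoid_scheme \<Rightarrow> bool" where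
  "torsion_free G \<longleftrightarrow> tor G = {\<one>\<^bsub>G\<^esub>}"

definition closed_subgroup :: "'a set \<Rightarrow> ('a, 'm) monoid_scheme \<Rightarrow> 'a topology \<Rightarrow> bool" where
  "closed_subgroup H G \<tau> \<longleftrightarrow> subgroup H G \<and> closedin \<tau> H"

definition closed_join ::
  "('a, 'm) monoid_scheme \<Rightarrow> 'a topology \<Rightarrow> 'a set \<Rightarrow> 'a set \<Rightarrow> 'a set" where
  "closed_join G \<tau> A B = \<tau> closure_of (A <#>\<^bsub>G\<^esub> B)"

definition topologically_modular :: "('a, 'm) monoid_scheme \<Rightarrow> 'a topology \<Rightarrow> bool" where
  "topologically_modular G \<tau> \<longleftrightarrow>
     (\<forall>A B C. closed_subgroup A G \<tau> \<longrightarrow> closed_subgroup B G \<tau> \<longrightarrow> closed_subgroup C G \<tau> \<longrightarrow>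
        A \<subseteq> C \<longrightarrow> closed_join G \<tau> A (B \<inter> C) = closed_join G \<tau> A B \<inter> C)"

definition strongly_topologically_quasihamiltonian ::
  "('a, 'm) monoid_scheme \<Rightarrow> 'a topology \<Rightarrow> bool" where
  "strongly_topologically_quasihamiltonian G \<tau> \<longleftrightarrow>
     (\<forall>X Y. closed_subgroup X G \<tau> \<longrightarrow> closed_subgroup Y G \<tau> \<longrightarrow> closedin \<tau> (X <#>\<^bsub>G\<^esub> Y))"

definition quotient_group_topology ::
  "('a, 'm) monoid_scheme \<Rightarrow> 'a topology \<Rightarrow> 'a set \<Rightarrow> 'a set topology" where
  "quotient_group_topology G \<tau> N =
     topology (\<lambda>U. U \<subseteq> carrier (G Mod N) \<and> openin \<tau> {x \<in> topspace \<tau>. N #>\<^bsub>G\<^esub> x \<in> U})"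

lemma openin_quotient_group_topology:
  "openin (quotient_group_topology G \<tau> N) U \<longleftrightarrow>
     U \<subseteq> carrier (G Mod N) \<and> openin \<tau> {x \<in> topspace \<tau>. N #>\<^bsub>G\<^esub> x \<in> U}"
proof -
  let ?P = "\<lambda>U. {x \<in> topspace \<tau>. N #>\<^bsub>G\<^esub> x \<in> U}"
  have 1: "?P (S \<inter> T) = ?P S \<inter> ?P T" for S T by auto
  have 2: "?P (\<Union>K) = \<Union>(?P ` K)" for K by auto
  have "istopology (\<lambda>U. U \<subseteq> carrier (G Mod N) \<and> openin \<tau> (?P U))"
    unfolding istopology_def 1 2 by (auto intro!: openin_Union)
  then show ?thesis
    by (simp add: quotient_group_topology_def topology_inverse')
qed

lemma quotient_map_quotient_group_topology:
  assumes "topspace \<tau> = carrier G"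
  shows "quotient_map \<tau> (quotient_group_topology G \<tau> N) (\<lambda>x. N #>\<^bsub>G\<^esub> x)"
proof -
  have img: "(\<lambda>x. N #>\<^bsub>G\<^esub> x) ` topspace \<tau> = carrier (G Mod N)"
    using assms by (auto simp: FactGroup_def RCOSETS_def)
  then have "openin (quotient_group_topology G \<tau> N) (carrier (G Mod N))"
    unfolding openin_quotient_group_topology
    by (auto simp: image_subset_iff intro: back_subst[of "openin \<tau>", OF openin_topspace])
  then have "topspace (quotient_group_topology G \<tau> N) = carrier (G Mod N)"
    by (meson openin_quotient_group_topology openin_subset openin_topspace subset_antisym)
  with img show ?thesis
    by (simp add: quotient_map_def openin_quotient_group_topology)
qed


text \<open>
  \<open>A \<otimes>\<^sub>\<int> \<rat>\<close> is the free abelian group on \<open>A \<times> \<rat>\<close> modulo the bilinearity relations; the rational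
  scalar \<open>q\<close> acts by \<open>q (a \<otimes> r) = a \<otimes> (q r)\<close>.
\<close>

definition tensor_rat_relators :: "('a, 'm) monoid_scheme \<Rightarrow> ('a \<times> rat \<Rightarrow>\<^sub>0 int) set" where
  "tensor_rat_relators A =
     {frag_of (a \<otimes>\<^bsub>A\<^esub> b, r) - frag_of (a, r) - frag_of (b, r) | a b r.
        a \<in> carrier A \<and> b \<in> carrier A} \<union>
     {frag_of (a, r + s) - frag_of (a, r) - frag_of (a, s) | a r s. a \<in> carrier A}"

definition tensor_rat_relations :: "('a, 'm) monoid_scheme \<Rightarrow> ('a \<times> rat \<Rightarrow>\<^sub>0 int) set" where
  "tensor_rat_relations A =
     generate (free_Abelian_group (carrier A \<times> UNIV)) (tensor_rat_relators A)"

definition tensor_rat_group :: "('a, 'm) monoid_scheme \<Rightarrow> ('a \<times> rat \<Rightarrow>\<^sub>0 int) set monoid" where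
  "tensor_rat_group A = free_Abelian_group (carrier A \<times> UNIV) Mod tensor_rat_relations A"

definition frag_scale :: "rat \<Rightarrow> ('a \<times> rat \<Rightarrow>\<^sub>0 int) \<Rightarrow> ('a \<times> rat \<Rightarrow>\<^sub>0 int)" where
  "frag_scale q = frag_extend (\<lambda>(a, r). frag_of (a, q * r))"

text \<open>
  The image of a coset under \<open>frag_scale q\<close> is a coset only if \<open>q \<noteq> 0\<close>; adding the relation
  subgroup again makes it one in every case. The \<open>mult\<close> and \<open>one\<close> fields of a \<open>module\<close> record
  play no role.
\<close>

definition tensor_rat ::
  "('a, 'm) monoid_scheme \<Rightarrow> (rat, ('a \<times> rat \<Rightarrow>\<^sub>0 int) set) module" where
  "tensor_rat A =
     \<lparr>carrier = carrier (tensor_rat_group A), mult = undefined, one = undefined,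
      zero = \<one>\<^bsub>tensor_rat_group A\<^esub>, add = mult (tensor_rat_group A),
      smult = (\<lambda>q X. tensor_rat_relations A
                 <#>\<^bsub>free_Abelian_group (carrier A \<times> UNIV)\<^esub> frag_scale q ` X)\<rparr>"

lemma frag_scale_0: "frag_scale q 0 = 0"
  by (simp add: frag_scale_def)

lemma frag_scale_add: "frag_scale q (x + y) = frag_scale q x + frag_scale q y"
  by (simp add: frag_scale_def frag_extend_add)

lemma frag_scale_diff: "frag_scale q (x - y) = frag_scale q x - frag_scale q y"
  by (simp add: frag_scale_def frag_extend_diff)

lemma frag_scale_of: "frag_scale q (frag_of (a, r)) = frag_of (a, q * r)"
  by (simp add: frag_scale_def)

lemma frag_scale_closed:
  assumes "Poly_Mapping.keys x \<subseteq> S \<times> UNIV"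
  shows "Poly_Mapping.keys (frag_scale q x) \<subseteq> S \<times> UNIV"
  using assms keys_frag_extend[of "\<lambda>(a, r). frag_of (a, q * r)" x]
  by (fastforce simp: frag_scale_def)

lemma frag_scale_scale: "frag_scale p (frag_scale q x) = frag_scale (p * q) x"
  by (rule frag_induction[OF subset_UNIV])
    (auto simp: frag_scale_diff frag_scale_of mult.assoc frag_scale_0)

lemma frag_scale_1: "frag_scale 1 x = x"
  by (rule frag_induction[OF subset_UNIV])
    (auto simp: frag_scale_diff frag_scale_of frag_scale_0)

lemma vectorspace_tensor_rat:
  assumes "comm_group A"
  shows "vectorspace (class_ring :: rat ring) (tensor_rat A)"
proof -
  interpret A: comm_group A by fact
  define F where "F = free_Abelian_group (carrier A \<times> (UNIV :: rat set))"
  define R where "R = tensor_rat_relations A"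
  interpret F: comm_group F unfolding F_def by (rule abelian_free_Abelian_group)
  have Fs [simp]: "x \<in> carrier F \<longleftrightarrow> Poly_Mapping.keys x \<subseteq> carrier A \<times> UNIV"
    "x \<otimes>\<^bsub>F\<^esub> y = x + y" "\<one>\<^bsub>F\<^esub> = 0" for x y
    by (auto simp: F_def)
  have Finv: "x \<in> carrier F \<Longrightarrow> inv\<^bsub>F\<^esub> x = - x" for x
    by (simp add: F_def)
  have keysd: "x \<in> carrier F \<Longrightarrow> y \<in> carrier F \<Longrightarrow> x - y \<in> carrier F" for x y
    using keys_diff[of x y] by auto
  have relF: "tensor_rat_relators A \<subseteq> carrier F"
  proof -
    have of: "frag_of (a, r) \<in> carrier F" if "a \<in> carrier A" for a r
      using that by simp
    show ?thesis
      unfolding tensor_rat_relators_def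
      using of keysd A.m_closed by (auto simp del: Fs)
  qed
  have Rgen: "R = generate F (tensor_rat_relators A)"
    by (simp add: R_def F_def tensor_rat_relations_def)
  have subR: "subgroup R F"
    unfolding Rgen by (rule F.generate_is_subgroup[OF relF])
  then interpret R: normal R F by (simp add: F.subgroup_imp_normal)
  interpret Q: comm_group "F Mod R"
    by (rule F.abelian_FactGroup[OF subR])
  have Rdiff: "x - y \<in> R" if "x \<in> R" "y \<in> R" for x y
  proof -
    have "x \<otimes>\<^bsub>F\<^esub> inv\<^bsub>F\<^esub> y \<in> R" using that subR by (meson subgroup_def)
    moreover have "y \<in> carrier F" using that R.subset by blast
    ultimately show ?thesis using Finv[of y] by simp
  qed
  have Radd: "x + y \<in> R" if "x \<in> R" "y \<in> R" for x y
    using R.m_closed[OF that] by simp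
  have R0: "0 \<in> R" using R.one_closed by simp
  have rel_in: "x \<in> tensor_rat_relators A \<Longrightarrow> x \<in> R" for x
    unfolding Rgen by (rule generate.incl)
  have coset: "R #>\<^bsub>F\<^esub> x = (\<lambda>r. r + x) ` R" for x
    by (auto simp: r_coset_def)
  have coset_eq: "R #>\<^bsub>F\<^esub> x = R #>\<^bsub>F\<^esub> y" if "x - y \<in> R" for x y
  proof -
    have "r + x \<in> (\<lambda>r. r + y) ` R" if "r \<in> R" for r
      using Radd[OF that \<open>x - y \<in> R\<close>] by (rule rev_image_eqI) simp
    moreover have "r + y \<in> (\<lambda>r. r + x) ` R" if "r \<in> R" for r
      using Rdiff[OF that \<open>x - y \<in> R\<close>] by (rule rev_image_eqI) simp
    ultimately show ?thesis unfolding coset by blast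
  qed
  have scR: "frag_scale q x \<in> R" if "x \<in> R" for q x
  proof -
    have rel: "frag_scale q x \<in> R" if "x \<in> tensor_rat_relators A" for x
    proof (rule rel_in)
      show "frag_scale q x \<in> tensor_rat_relators A"
        using that unfolding tensor_rat_relators_def
        by (fastforce simp: frag_scale_diff frag_scale_of distrib_left)
    qed
    have "x \<in> generate F (tensor_rat_relators A)" using that by (simp add: Rgen)
    then show ?thesis
    proof induction
      case one
      then show ?case by (simp add: frag_scale_def R0)
    next
      case (incl h)
      then show ?case by (rule rel)
    next
      case (inv h)
      then have "h \<in> carrier F" using relF by blast
      then have "frag_scale q (inv\<^bsub>F\<^esub> h) = 0 - frag_scale q h"
        using frag_scale_diff[of q 0 h] Finv by (simp add: frag_scale_0)
      then show ?case using Rdiff[OF R0 rel[OF inv]] by metis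
    next
      case (eng h1 h2)
      then show ?case using Radd by (simp add: frag_scale_add)
    qed
  qed
  have car: "carrier (tensor_rat A) = {R #>\<^bsub>F\<^esub> x | x. x \<in> carrier F}"
    by (auto simp: tensor_rat_def tensor_rat_group_def FactGroup_def RCOSETS_def F_def R_def
        simp del: carrier_free_Abelian_group_iff)
  have sm: "q \<odot>\<^bsub>tensor_rat A\<^esub> (R #>\<^bsub>F\<^esub> x) = R #>\<^bsub>F\<^esub> frag_scale q x" for q x
  proof -
    have "q \<odot>\<^bsub>tensor_rat A\<^esub> (R #>\<^bsub>F\<^esub> x) = {r + frag_scale q (s + x) | r s. r \<in> R \<and> s \<in> R}"
      unfolding coset by (auto simp: tensor_rat_def set_mult_def R_def[symmetric])
    also have "\<dots> = (\<lambda>r. r + frag_scale q x) ` R"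
    proof (safe)
      fix r s assume "r \<in> R" "s \<in> R"
      then have "r + frag_scale q s \<in> R" using scR Radd by blast
      then show "r + frag_scale q (s + x) \<in> (\<lambda>r. r + frag_scale q x) ` R"
        by (rule rev_image_eqI) (simp add: frag_scale_add)
    next
      fix r assume "r \<in> R"
      then show "\<exists>ra s. r + frag_scale q x = ra + frag_scale q (s + x) \<and> ra \<in> R \<and> s \<in> R"
        using R0 by (intro exI[of _ r] exI[of _ 0]) simp
    qed
    finally show ?thesis by (simp add: coset)
  qed
  have ad: "(R #>\<^bsub>F\<^esub> x) \<oplus>\<^bsub>tensor_rat A\<^esub> (R #>\<^bsub>F\<^esub> y) = R #>\<^bsub>F\<^esub> (x + y)"
    if "x \<in> carrier F" "y \<in> carrier F" for x y
    using R.rcos_sum[OF that]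
    by (simp add: tensor_rat_def tensor_rat_group_def FactGroup_def F_def R_def)
  have sum_scale: "frag_scale (p + q) x - (frag_scale p x + frag_scale q x) \<in> R"
    if "x \<in> carrier F" for p q x
  proof -
    have "Poly_Mapping.keys x \<subseteq> carrier A \<times> UNIV" using that by simp
    then show ?thesis
    proof (induction rule: frag_induction)
      case zero
      then show ?case by (simp add: frag_scale_def R0)
    next
      case (one z)
      obtain a r where z: "z = (a, r)" "a \<in> carrier A" using one by auto
      have "frag_of (a, p * r + q * r) - frag_of (a, p * r) - frag_of (a, q * r) \<in> R"
        by (rule rel_in) (use z in \<open>unfold tensor_rat_relators_def; blast\<close>)
      then show ?case by (simp add: z frag_scale_of distrib_right diff_diff_eq)
    next
      case (diff a b)
      show ?case
        using Rdiff[OF diff] by (simp add: frag_scale_diff algebra_simps)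
    qed
  qed
  have mon: "carrier (F Mod R) = carrier (tensor_rat A)"
    "\<one>\<^bsub>F Mod R\<^esub> = \<zero>\<^bsub>tensor_rat A\<^esub>" "mult (F Mod R) = add (tensor_rat A)"
    by (auto simp: tensor_rat_def tensor_rat_group_def F_def R_def)
  have scF: "frag_scale q x \<in> carrier F" if "x \<in> carrier F" for q x
    using frag_scale_closed that by auto
  have ag: "abelian_group (tensor_rat A)"
  proof (rule abelian_groupI)
    show "\<exists>y\<in>carrier (tensor_rat A). y \<oplus>\<^bsub>tensor_rat A\<^esub> x = \<zero>\<^bsub>tensor_rat A\<^esub>"
      if "x \<in> carrier (tensor_rat A)" for x
      using Q.l_inv_ex that unfolding mon by blast
  qed (fact Q.m_closed[unfolded mon] Q.one_closed[unfolded mon] Q.m_assoc[unfolded mon]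
      Q.m_comm[unfolded mon] Q.l_one[unfolded mon])+
  have "module (class_ring :: rat ring) (tensor_rat A)"
  proof (rule module.intro)
    show "cring (class_ring :: rat ring)" by (rule class_cring.cring_axioms)
    show "abelian_group (tensor_rat A)" by (rule ag)
    show "module_axioms (class_ring :: rat ring) (tensor_rat A)"
    proof
      fix p q x y
      assume "x \<in> carrier (tensor_rat A)" "y \<in> carrier (tensor_rat A)"
      then obtain u v where u: "x = R #>\<^bsub>F\<^esub> u" "u \<in> carrier F"
        and v: "y = R #>\<^bsub>F\<^esub> v" "v \<in> carrier F"
        unfolding car by blast
      show "q \<odot>\<^bsub>tensor_rat A\<^esub> (x \<oplus>\<^bsub>tensor_rat A\<^esub> y) =
        q \<odot>\<^bsub>tensor_rat A\<^esub> x \<oplus>\<^bsub>tensor_rat A\<^esub> q \<odot>\<^bsub>tensor_rat A\<^esub> y"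
        unfolding u(1) v(1) sm ad[OF u(2) v(2)] ad[OF scF[OF u(2)] scF[OF v(2)]]
        by (simp add: frag_scale_add)
    next
      fix p q x
      assume "x \<in> carrier (tensor_rat A)"
      then obtain u where u: "x = R #>\<^bsub>F\<^esub> u" "u \<in> carrier F"
        unfolding car by blast
      show "q \<odot>\<^bsub>tensor_rat A\<^esub> x \<in> carrier (tensor_rat A)"
        unfolding u(1) sm car using scF[OF u(2)] by blast
      show "(p \<oplus>\<^bsub>class_ring\<^esub> q) \<odot>\<^bsub>tensor_rat A\<^esub> x =
        p \<odot>\<^bsub>tensor_rat A\<^esub> x \<oplus>\<^bsub>tensor_rat A\<^esub> q \<odot>\<^bsub>tensor_rat A\<^esub> x"
        unfolding u(1) sm ad[OF scF[OF u(2)] scF[OF u(2)]]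
        using coset_eq[OF sum_scale[OF u(2)]] by simp
      show "(p \<otimes>\<^bsub>class_ring\<^esub> q) \<odot>\<^bsub>tensor_rat A\<^esub> x =
        p \<odot>\<^bsub>tensor_rat A\<^esub> (q \<odot>\<^bsub>tensor_rat A\<^esub> x)"
        unfolding u(1) sm by (simp add: frag_scale_scale)
      show "\<one>\<^bsub>class_ring\<^esub> \<odot>\<^bsub>tensor_rat A\<^esub> x = x"
        unfolding u(1) sm by (simp add: frag_scale_1)
    qed
  qed
  moreover have "Ring.field (class_ring :: rat ring)" by (rule class_field.field_axioms)
  ultimately show ?thesis by (rule vectorspace.intro)
qed

definition finite_Z_rank :: "('a, 'm) monoid_scheme \<Rightarrow> bool" where
  "finite_Z_rank A \<longleftrightarrow> vectorspace.fin_dim (class_ring :: rat ring) (tensor_rat A)"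

definition cond_b1 :: "('a, 'm) monoid_scheme \<Rightarrow> 'a topology \<Rightarrow> 'a set \<Rightarrow> bool" where
  "cond_b1 G \<tau> T \<longleftrightarrow>
     T = tor G \<and> tor G = compact_part G \<tau> \<and> openin \<tau> T \<and>
     discrete_space (quotient_group_topology G \<tau> T) \<and>
     torsion_free (G Mod T) \<and> finite_Z_rank (G Mod T)"

definition cond_b2 :: "('a, 'm) monoid_scheme \<Rightarrow> 'a topology \<Rightarrow> 'a set \<Rightarrow> bool" where
  "cond_b2 G \<tau> T \<longleftrightarrow>
     T = tor G \<and> strongly_topologically_quasihamiltonian (G\<lparr>carrier := T\<rparr>) (subtopology \<tau> T)"

end

theory Submission
  imports Defs "HOL-Analysis.Urysohn"
begin

no_notation eq_closure_of ("closure'_of\<index>")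

text \<open>
  Let \<open>U\<close> be a compact open subgroup. If \<open>G\<close> is topologically modular and \<open>x\<close> lies in no compact
  subgroup, then the discrete subgroup \<open>\<langle>x\<rangle>\<close> and its twists \<open>\<langle>x + y\<rangle>\<close> by a compact element \<open>y\<close> of infinite
  order violate the modular law, so \<open>comp(G) = tor(G) = T\<close>. If \<open>G/T\<close> had infinite rank, an infinite
  independent family could be twisted in the same way by a countable subgroup of \<open>U\<close>, which is not closed
  by Baire's theorem. Inside \<open>T\<close> all cyclic subgroups are finite, and the modular law makes \<open>X + Y\<close> closed.

  Conversely, let \<open>X\<close>, \<open>Y\<close> be closed subgroups of \<open>G\<close> and \<open>P = (X \<inter> T) + (Y \<inter> T)\<close>, which is closed. The group
  \<open>U\<close> has an open subgroup \<open>W\<close> of bounded exponent \<open>m\<close>, and as \<open>G/T\<close> has finite rank, \<open>A/mA\<close> is finite for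
  each subgroup \<open>A\<close> of \<open>G/T\<close>. Hence \<open>P\<close> has finite index in \<open>(X + Y) \<inter> (W + P)\<close>, so that \<open>X + Y\<close> is closed near
  the identity and therefore closed.

  Finite rank of \<open>G/T\<close> is used only as the absence of an infinite independent sequence, a property that
  passes between \<open>G\<close> and its quotients by torsion subgroups.
\<close>

section \<open>Topological abelian groups\<close>

text \<open>That \<open>G\<close> is not periodic supplies the element x outside every compact
  subgroup; that \<open>G\<close> is not discrete makes \<open>U\<close> infinite, so that
  \<open>U\<close> has an infinite countable subgroup. A subgroup is closed as soon as its trace on
  one open subgroup is closed. Elements independent of an open subgroup may be twisted by elements
  inside it while this trace stays under control, so the twisted and the untwisted subgroup are both
  closed. Their sum contains all the twists, however, and its closure also contains the limits of
  twists. Each failure of the modular law is produced in this way. In the converse direction the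
  obstacle is that x + y can be small while neither x nor y is. Multiplication by the exponent m of
  \<open>W\<close> replaces smallness by an exact equation modulo torsion, and finite rank bounds
  the ways in which it can be solved. The rank is the dimension of a tensor product, whereas the
  group arguments use integral relations; independent sequences are the common language of
  both.\<close>

locale topological_comm_group = comm_group G for G (structure) +
  fixes \<tau> :: "'a topology"
  assumes topspace_eq [simp]: "topspace \<tau> = carrier G"
    and Hausdorff: "Hausdorff_space \<tau>"
    and continuous_mult: "continuous_map (prod_topology \<tau> \<tau>) \<tau> (\<lambda>(x, y). x \<otimes> y)"
    and continuous_inv: "continuous_map \<tau> \<tau> (\<lambda>x. inv x)"
begin

lemma continuous_map_mult:
  assumes "continuous_map X \<tau> f" "continuous_map X \<tau> g"
  shows "continuous_map X \<tau> (\<lambda>x. f x \<otimes> g x)"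
proof -
  have "continuous_map X (prod_topology \<tau> \<tau>) (\<lambda>x. (f x, g x))"
    using assms by (simp add: continuous_map_paired)
  from continuous_map_compose[OF this continuous_mult] show ?thesis
    by (simp add: o_def)
qed

lemma continuous_map_nat_pow: "continuous_map \<tau> \<tau> (\<lambda>x. x [^] (n::nat))"
  by (induction n) (auto intro: continuous_map_mult)

lemma continuous_translation: "a \<in> carrier G \<Longrightarrow> continuous_map \<tau> \<tau> (\<lambda>x. a \<otimes> x)"
  by (intro continuous_map_mult) auto

lemma openin_translation:
  "\<lbrakk>a \<in> carrier G; openin \<tau> U\<rbrakk> \<Longrightarrow> openin \<tau> {x \<in> carrier G. a \<otimes> x \<in> U}"
  using openin_continuous_map_preimage[OF continuous_translation, of a U] by simp

lemma closedin_translation: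
  assumes "a \<in> carrier G" "closedin \<tau> C"
  shows "closedin \<tau> ((\<lambda>x. a \<otimes> x) ` C)"
proof -
  have "C \<subseteq> carrier G" using closedin_subset[OF assms(2)] by simp
  then have "(\<lambda>x. a \<otimes> x) ` C = {x \<in> carrier G. inv a \<otimes> x \<in> C}"
    using assms(1) by (auto simp: m_assoc[symmetric] subset_iff intro!: image_eqI[of _ _ "inv a \<otimes> _"])
  then show ?thesis
    using closedin_continuous_map_preimage[OF continuous_translation, of "inv a" C] assms by simp
qed

lemma closedin_finite_set_mult:
  assumes "finite F" "F \<subseteq> carrier G" "closedin \<tau> C"
  shows "closedin \<tau> (F <#> C)"
proof -
  have "F <#> C = (\<Union>a\<in>F. (\<lambda>x. a \<otimes> x) ` C)"
    by (auto simp: set_mult_def)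
  then show ?thesis
    using assms by (auto intro!: closedin_Union closedin_translation)
qed

lemma compactin_set_mult:
  assumes "compactin \<tau> K" "compactin \<tau> L"
  shows "compactin \<tau> (K <#> L)"
proof -
  have "K <#> L = (\<lambda>(x, y). x \<otimes> y) ` (K \<times> L)"
    by (auto simp: set_mult_def)
  then show ?thesis
    using image_compactin[OF _ continuous_mult] assms by (simp add: compactin_Times)
qed

lemma compactin_closedin: "compactin \<tau> K \<Longrightarrow> closedin \<tau> K"
  using compactin_imp_closedin Hausdorff by blast

lemma openin_subgroupI:
  assumes H: "subgroup H G" and V: "openin \<tau> V" "\<one> \<in> V" "V \<subseteq> H"
  shows "openin \<tau> H"
proof (subst openin_subopen, intro ballI)
  interpret H: subgroup H G by fact
  fix h assume h: "h \<in> H"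
  let ?W = "{x \<in> carrier G. inv h \<otimes> x \<in> V}"
  have "?W \<subseteq> H"
  proof
    fix x assume "x \<in> ?W"
    then have x: "x \<in> carrier G" "inv h \<otimes> x \<in> H" using V by auto
    have "x = h \<otimes> (inv h \<otimes> x)" using h x by (simp add: m_assoc[symmetric])
    then show "x \<in> H" using h x H.m_closed by metis
  qed
  moreover have "openin \<tau> ?W" "h \<in> ?W"
    using h V openin_translation[of "inv h" V] by auto
  ultimately show "\<exists>T. openin \<tau> T \<and> h \<in> T \<and> T \<subseteq> H" by blast
qed

lemma closedin_open_subgroup:
  assumes H: "subgroup H G" and "openin \<tau> H"
  shows "closedin \<tau> H"
proof -
  interpret H: subgroup H G by fact
  have "openin \<tau> (carrier G - H)"
  proof (subst openin_subopen, intro ballI)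
    fix z assume z: "z \<in> carrier G - H"
    let ?W = "{x \<in> carrier G. inv z \<otimes> x \<in> H}"
    have "?W \<subseteq> carrier G - H"
    proof safe
      fix x assume x: "x \<in> carrier G" "inv z \<otimes> x \<in> H" "x \<in> H"
      have "z = x \<otimes> inv (inv z \<otimes> x)" using x z by (simp add: inv_mult_group m_assoc[symmetric])
      then show False using z x by (metis DiffD2 H.m_closed H.m_inv_closed)
    qed
    moreover have "openin \<tau> ?W" "z \<in> ?W"
      using z assms openin_translation[of "inv z" H] by auto
    ultimately show "\<exists>T. openin \<tau> T \<and> z \<in> T \<and> T \<subseteq> carrier G - H" by blast
  qed
  then show ?thesis by (simp add: closedin_def H.subset)
qed

lemma subgroup_closure_of:
  assumes H: "subgroup H G"
  shows "subgroup (\<tau> closure_of H) G"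
proof -
  interpret H: subgroup H G by fact
  have sub: "H \<subseteq> \<tau> closure_of H" by (metis closure_of_subset H.subset topspace_eq)
  show ?thesis
  proof (rule subgroupI)
    show "\<tau> closure_of H \<subseteq> carrier G" by (metis closure_of_subset_topspace topspace_eq)
    show "\<tau> closure_of H \<noteq> {}" by (metis H.one_closed empty_iff subsetD sub)
    fix a b assume a: "a \<in> \<tau> closure_of H" and b: "b \<in> \<tau> closure_of H"
    have "(\<lambda>x. inv x) ` (\<tau> closure_of H) \<subseteq> \<tau> closure_of ((\<lambda>x. inv x) ` H)"
      by (rule continuous_map_image_closure_subset[OF continuous_inv])
    also have "\<dots> \<subseteq> \<tau> closure_of H" by (rule closure_of_mono) auto
    finally show "inv a \<in> \<tau> closure_of H" using a by blast
    have "(\<lambda>(x, y). x \<otimes> y) ` (prod_topology \<tau> \<tau> closure_of (H \<times> H))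
        \<subseteq> \<tau> closure_of ((\<lambda>(x, y). x \<otimes> y) ` (H \<times> H))"
      by (rule continuous_map_image_closure_subset[OF continuous_mult])
    also have "\<dots> \<subseteq> \<tau> closure_of H" by (rule closure_of_mono) auto
    finally show "a \<otimes> b \<in> \<tau> closure_of H"
      using a b by (force simp: closure_of_Times)
  qed
qed

text \<open>A point z of the closure differs from some h in \<open>H\<close> by an element of
  \<open>M\<close>, since z + \<open>M\<close> is a neighbourhood of z. Then z - h lies in the
  closure of \<open>H\<close> and in the open set \<open>M\<close>, hence in the closure of
  \<open>H \<inter> M\<close>, which is \<open>H \<inter> M\<close> itself.\<close>

lemma closedin_subgroupI:
  assumes M: "subgroup M G" "openin \<tau> M" and H: "subgroup H G" and HM: "closedin \<tau> (H \<inter> M)"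
  shows "closedin \<tau> H"
proof -
  interpret H: subgroup H G by fact
  interpret C: subgroup "\<tau> closure_of H" G by (rule subgroup_closure_of[OF H])
  interpret M: subgroup M G by fact
  have "z \<in> H" if z: "z \<in> \<tau> closure_of H" for z
  proof -
    have zc: "z \<in> carrier G" using z C.subset by blast
    have "openin \<tau> {x \<in> carrier G. inv z \<otimes> x \<in> M}"
      by (rule openin_translation[OF inv_closed[OF zc] M(2)])
    moreover have "z \<in> {x \<in> carrier G. inv z \<otimes> x \<in> M}" using zc by simp
    ultimately have "\<exists>h. h \<in> H \<and> h \<in> {x \<in> carrier G. inv z \<otimes> x \<in> M}"
      using z by (metis (no_types, lifting) in_closure_of)
    then obtain h where h: "h \<in> H" "inv z \<otimes> h \<in> M" by auto
    have hc: "h \<in> carrier G" using h by simp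
    have "h \<in> \<tau> closure_of H" using h closure_of_subset[of H \<tau>] H.subset by auto
    then have 1: "z \<otimes> inv h \<in> \<tau> closure_of H" using z by simp
    have "z \<otimes> inv h = inv (inv z \<otimes> h)" using zc hc by (simp add: inv_mult_group m_comm)
    then have 2: "z \<otimes> inv h \<in> M" using h by simp
    have "z \<otimes> inv h \<in> \<tau> closure_of (H \<inter> M)"
      using openin_Int_closure_of_subset[OF M(2), of H] 1 2 by (auto simp: Int_commute)
    then have "z \<otimes> inv h \<in> H" using HM by (simp add: closure_of_closedin)
    then have "z \<otimes> inv h \<otimes> h \<in> H" using h by blast
    then show "z \<in> H" using zc hc by (simp add: m_assoc)
  qed
  then have "\<tau> closure_of H \<subseteq> H" by blast
  then show ?thesis
    by (simp add: closure_of_subset_eq[symmetric] H.subset)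
qed

text \<open>Van Dantzig's theorem; the subgroup is the stabiliser of a compact open set.\<close>

theorem compact_open_subgroup_exists:
  assumes lc: "locally_compact_space \<tau>" and td: "totally_disconnected_space \<tau>"
  obtains U where "subgroup U G" "openin \<tau> U" "compactin \<tau> U"
proof -
  obtain V K where V: "openin \<tau> V" "compactin \<tau> K" "\<one> \<in> V" "V \<subseteq> K"
    using lc unfolding locally_compact_space_def by (metis one_closed topspace_eq)
  define Y where "Y = subtopology \<tau> K"
  have Kc: "K \<subseteq> carrier G" using compactin_subset_topspace[OF V(2)] by simp
  then have topY: "topspace Y = K" by (simp add: Y_def inf_absorb2)
  have cY: "compact_space Y" using V(2) by (simp add: Y_def compact_space_subtopology)
  have hY: "Hausdorff_space Y" using Hausdorff by (simp add: Y_def Hausdorff_space_subtopology)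
  \<comment> \<open>Clopen sets separate quasi-components; in the compact Hausdorff space
    \<open>K\<close> these coincide with the components, which are trivial.\<close>
  have quasi: "quasi_component_of_set Y \<one> = {\<one>}"
  proof -
    have "quasi_component_of_set Y \<one> \<in> quasi_components_of Y"
      using V by (auto simp: quasi_component_in_quasi_components_of topY)
    then have "connectedin Y (quasi_component_of_set Y \<one>)"
      using quasi_eq_connected_components_of[of Y] cY hY
      by (metis compact_imp_locally_compact_space connectedin_connected_components_of)
    then have "connectedin \<tau> (quasi_component_of_set Y \<one>)"
      by (simp add: Y_def connectedin_subtopology)
    then obtain x where "quasi_component_of_set Y \<one> \<subseteq> {x}"
      using td unfolding totally_disconnected_space_def by blast
    moreover have "\<one> \<in> quasi_component_of_set Y \<one>"
      using V by (auto simp: topY)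
    ultimately show ?thesis by blast
  qed
  define \<C> where "\<C> = {W. closedin Y W \<and> openin Y W \<and> \<one> \<in> W}"
  obtain W where W: "closedin Y W" "openin Y W" "\<one> \<in> W" "W \<subseteq> V"
  proof -
    have VY: "openin Y V" using V by (auto simp: Y_def openin_subtopology)
    have "separated_between Y {\<one>} (K - V)"
    proof (subst separated_between_quasi_component_compact[of "{\<one>}" Y, THEN iffD2])
      show "{\<one>} \<in> quasi_components_of Y"
        using quasi V by (metis quasi_component_in_quasi_components_of subset_iff topY)
      show "compactin Y (K - V)"
        using cY VY topY by (metis closedin_compact_space closedin_diff closedin_topspace)
      show "disjnt {\<one>} (K - V)" using V by simp
    qed simp
    then obtain W where W: "closedin Y W" "openin Y W" "{\<one>} \<subseteq> W" "K - V \<subseteq> topspace Y - W"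
      unfolding separated_between by blast
    have "W \<subseteq> K" using openin_subset[OF W(2)] topY by simp
    then have "W \<subseteq> V" using W(4) by blast
    then show ?thesis using that W by blast
  qed
  \<comment> \<open>Being relatively open in \<open>K\<close> suffices because \<open>W\<close> lies
    in \<open>V\<close>, which is open in the group and contained in \<open>K\<close>.\<close>
  have Wo: "openin \<tau> W"
  proof -
    obtain O' where "openin \<tau> O'" "W = O' \<inter> K" using W(2) by (auto simp: Y_def openin_subtopology)
    then have "W = O' \<inter> V" using W V by blast
    then show ?thesis using \<open>openin \<tau> O'\<close> V by blast
  qed
  have Wk: "compactin \<tau> W"
    using closedin_compact_space[OF cY W(1)] by (simp add: Y_def compactin_subtopology)
  have Wc: "W \<subseteq> carrier G" using compactin_subset_topspace[OF Wk] by simp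
  define P where "P = {g \<in> carrier G. \<forall>w\<in>W. g \<otimes> w \<in> W}"
  define H where "H = {g \<in> P. inv g \<in> P}"
  \<comment> \<open>The complement of \<open>P\<close> is the projection of the closed set of pairs
    (g, w) with g + w outside \<open>W\<close>, and projecting along the compact factor
    \<open>W\<close> is a closed map.\<close>
  have Po: "openin \<tau> P"
  proof -
    let ?Z = "subtopology \<tau> W"
    have "continuous_map (prod_topology \<tau> ?Z) \<tau> (\<lambda>(x, y). x \<otimes> y)"
      using continuous_map_from_subtopology[OF continuous_mult, of "carrier G \<times> W"]
      by (simp add: prod_topology_subtopology(2))
    then have "closedin (prod_topology \<tau> ?Z) {p \<in> topspace (prod_topology \<tau> ?Z). (case p of (x, y) \<Rightarrow> x \<otimes> y) \<in> carrier G - W}"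
      using Wo closedin_topspace[of \<tau>] by (intro closedin_continuous_map_preimage) auto
    then have "closedin \<tau> (fst ` {p \<in> topspace (prod_topology \<tau> ?Z). (case p of (x, y) \<Rightarrow> x \<otimes> y) \<in> carrier G - W})"
      using closed_map_fst[of ?Z \<tau>] Wk by (simp add: closed_map_def compact_space_subtopology)
    also have "(fst ` {p \<in> topspace (prod_topology \<tau> ?Z). (case p of (x, y) \<Rightarrow> x \<otimes> y) \<in> carrier G - W}) = carrier G - P"
      using Wc by (force simp: P_def image_iff)
    finally have "openin \<tau> (carrier G - (carrier G - P))"
      by (simp add: closedin_def)
    moreover have "carrier G - (carrier G - P) = P" by (auto simp: P_def)
    ultimately show ?thesis by simp
  qed
  have H: "subgroup H G"
  proof (rule subgroupI)
    show "H \<subseteq> carrier G" by (auto simp: H_def P_def)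
    have "\<one> \<in> H" using Wc by (auto simp: H_def P_def)
    then show "H \<noteq> {}" by blast
    show "inv a \<in> H" if "a \<in> H" for a using that by (auto simp: H_def P_def)
    have P: "a \<otimes> b \<in> P" if "a \<in> P" "b \<in> P" for a b
      using that Wc by (auto simp: P_def m_assoc subset_iff)
    show "a \<otimes> b \<in> H" if "a \<in> H" "b \<in> H" for a b
      using that P by (simp add: H_def inv_mult) (simp add: P_def inv_mult)
  qed
  have Ho: "openin \<tau> H"
  proof -
    have "H = P \<inter> {x \<in> topspace \<tau>. inv x \<in> P}" by (auto simp: H_def P_def)
    then show ?thesis
      using Po openin_continuous_map_preimage[OF continuous_inv Po] by auto
  qed
  have "H \<subseteq> W"
  proof
    fix g assume "g \<in> H"
    then have "g \<in> carrier G" "g \<otimes> \<one> \<in> W" using W(3) by (auto simp: H_def P_def)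
    then show "g \<in> W" by simp
  qed
  then have "compactin \<tau> H"
    using closed_compactin[OF Wk _ closedin_open_subgroup[OF H Ho]] by blast
  then show ?thesis using that H Ho by blast
qed

end

lemma topological_comm_groupI:
  "topological_abelian_group G \<tau> \<Longrightarrow> topological_comm_group G \<tau>"
  by (simp add: topological_abelian_group_def topological_comm_group_def topological_comm_group_axioms_def)

section \<open>Rank and independent sequences\<close>

text \<open>The condition sees only the set of earlier terms. The recursion therefore builds these
  finite sets, and the sequence is read off afterwards.\<close>

lemma greedy_sequence:
  assumes "\<And>S. finite S \<Longrightarrow> S \<subseteq> X \<Longrightarrow> \<exists>a\<in>X. P S a"
  obtains f :: "nat \<Rightarrow> 'a" where "range f \<subseteq> X" "\<And>k. P (f ` {..<k}) (f k)"
proof -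
  obtain g where g: "\<And>S. finite S \<Longrightarrow> S \<subseteq> X \<Longrightarrow> g S \<in> X \<and> P S (g S)"
    using assms by metis
  define F where "F = rec_nat {} (\<lambda>_ S. insert (g S) S)"
  have F: "F 0 = {}" "F (Suc n) = insert (g (F n)) (F n)" for n
    by (simp_all add: F_def)
  have fin: "finite (F n) \<and> F n \<subseteq> X" for n
    by (induction n) (use g in \<open>auto simp: F\<close>)
  define f where "f k = g (F k)" for k
  have Ff: "F n = f ` {..<n}" for n
    by (induction n) (auto simp: F f_def lessThan_Suc)
  have "range f \<subseteq> X" using g fin by (auto simp: f_def)
  moreover have "P (f ` {..<k}) (f k)" for k
    using g[of "F k"] fin[of k] by (simp add: f_def[of k] Ff[symmetric])
  ultimately show ?thesis using that by blast
qed

text \<open>Linear independence over the integers in the form that a greedy choice delivers: the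
  last nonzero coefficient of a relation puts a multiple of one term into the span of the earlier
  ones. Terms of finite order are excluded as well.\<close>

definition independent_sequence :: "('a, 'm) monoid_scheme \<Rightarrow> (nat \<Rightarrow> 'a) \<Rightarrow> bool" where
  "independent_sequence A f \<longleftrightarrow> range f \<subseteq> carrier A \<and>
     (\<forall>k. \<forall>n::nat. n > 0 \<longrightarrow> f k [^]\<^bsub>A\<^esub> n \<notin> generate A (f ` {..<k}))"

lemma (in comm_group) generate_insert:
  assumes "a \<in> carrier G" "S \<subseteq> carrier G"
  shows "generate G (insert a S) = {z \<otimes> a [^] (n::int) | z n. z \<in> generate G S}"
proof -
  have a: "{a} \<subseteq> carrier G" using assms by simp
  have "generate G (insert a S) = generate G S <#> generate G {a}"
  proof
    have 1: "subgroup (generate G S <#> generate G {a}) G"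
      using assms by (intro mult_subgroups generate_is_subgroup) auto
    have mem: "x \<in> generate G S <#> generate G {a}"
      if "y \<in> generate G S" "z \<in> generate G {a}" "x = y \<otimes> z" for x y z
      using that unfolding set_mult_def by blast
    have "a \<in> generate G S <#> generate G {a}"
      using mem[OF generate.one generate.incl] assms by simp
    moreover have "s \<in> generate G S <#> generate G {a}" if "s \<in> S" for s
      using mem[OF generate.incl[OF that] generate.one] assms that by (simp add: subset_iff)
    ultimately show "generate G (insert a S) \<subseteq> generate G S <#> generate G {a}"
      using generate_subgroup_incl[OF _ 1, of "insert a S"] by blast
    show "generate G S <#> generate G {a} \<subseteq> generate G (insert a S)"
      unfolding set_mult_def
      using mono_generate[of S "insert a S"] mono_generate[of "{a}" "insert a S"]
      by (auto intro!: generate.eng)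
  qed
  then show ?thesis
    unfolding generate_pow[OF assms(1)] set_mult_def by auto
qed

section \<open>Tensoring with the rational numbers\<close>

definition tensor_class ::
  "('a, 'm) monoid_scheme \<Rightarrow> ('a \<times> rat \<Rightarrow>\<^sub>0 int) \<Rightarrow> ('a \<times> rat \<Rightarrow>\<^sub>0 int) set" where
  "tensor_class A x = tensor_rat_relations A #>\<^bsub>free_Abelian_group (carrier A \<times> UNIV)\<^esub> x"

locale rational_tensor = comm_group A for A (structure) +
  fixes F R V
  defines "F \<equiv> free_Abelian_group (carrier A \<times> (UNIV :: rat set))"
    and "R \<equiv> tensor_rat_relations A"
    and "V \<equiv> tensor_rat A"
begin

sublocale F: comm_group F
  unfolding F_def by (rule abelian_free_Abelian_group)

sublocale V: vectorspace "class_ring :: rat ring" V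
  unfolding V_def by (rule vectorspace_tensor_rat) (rule comm_group_axioms)

lemma F_simps [simp]:
  "x \<in> carrier F \<longleftrightarrow> Poly_Mapping.keys x \<subseteq> carrier A \<times> UNIV"
  "x \<otimes>\<^bsub>F\<^esub> y = x + y" "\<one>\<^bsub>F\<^esub> = 0"
  by (auto simp: F_def)

lemma F_inv: "x \<in> carrier F \<Longrightarrow> inv\<^bsub>F\<^esub> x = - x"
  by (simp add: F_def)

lemma frag_of_in_F: "a \<in> carrier A \<Longrightarrow> frag_of (a, r) \<in> carrier F"
  by simp

lemma diff_in_F: "x \<in> carrier F \<Longrightarrow> y \<in> carrier F \<Longrightarrow> x - y \<in> carrier F"
  using keys_diff[of x y] by auto

lemma relators_subset: "tensor_rat_relators A \<subseteq> carrier F"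
  unfolding tensor_rat_relators_def
  using frag_of_in_F diff_in_F m_closed by (auto simp del: F_simps)

lemma R_eq: "R = generate F (tensor_rat_relators A)"
  by (simp add: R_def F_def tensor_rat_relations_def)

sublocale R: normal R F
  unfolding R_eq by (rule F.subgroup_imp_normal[OF F.generate_is_subgroup[OF relators_subset]])

lemma relators_in_R: "x \<in> tensor_rat_relators A \<Longrightarrow> x \<in> R"
  unfolding R_eq by (rule generate.incl)

lemma tensor_class_def': "tensor_class A x = R #>\<^bsub>F\<^esub> x"
  by (simp add: tensor_class_def F_def R_def)

lemma carrier_V: "carrier V = tensor_class A ` carrier F"
  by (auto simp: V_def tensor_rat_def tensor_rat_group_def FactGroup_def RCOSETS_def
      tensor_class_def F_def simp del: carrier_free_Abelian_group_iff)

lemma add_V: "\<lbrakk>x \<in> carrier F; y \<in> carrier F\<rbrakk> \<Longrightarrow>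
    tensor_class A x \<oplus>\<^bsub>V\<^esub> tensor_class A y = tensor_class A (x + y)"
  unfolding tensor_class_def' using R.rcos_sum[of x y]
  by (simp add: V_def tensor_rat_def tensor_rat_group_def FactGroup_def F_def R_def)

lemma tensor_class_hom: "tensor_class A \<in> hom F (add_monoid V)"
  unfolding hom_def using carrier_V add_V by auto

sublocale V_add: comm_group "add_monoid V"
  by (rule V.a_comm_group)

sublocale cls: group_hom F "add_monoid V" "tensor_class A"
  by unfold_locales (rule tensor_class_hom)

lemma zero_V: "\<zero>\<^bsub>V\<^esub> = R"
  by (simp add: V_def R_def tensor_rat_def tensor_rat_group_def FactGroup_def)

lemma tensor_class_eq_zero: "x \<in> carrier F \<Longrightarrow> tensor_class A x = \<zero>\<^bsub>V\<^esub> \<longleftrightarrow> x \<in> R"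
  unfolding zero_V tensor_class_def'
  by (metis F.coset_join1 F.coset_join2 R.is_subgroup R.subset)

lemma frag_scale_in_R: "x \<in> R \<Longrightarrow> frag_scale q x \<in> R"
proof -
  have rel: "frag_scale q x \<in> R" if "x \<in> tensor_rat_relators A" for x
  proof (rule relators_in_R)
    show "frag_scale q x \<in> tensor_rat_relators A"
      using that unfolding tensor_rat_relators_def
      by (fastforce simp: frag_scale_diff frag_scale_of distrib_left)
  qed
  assume "x \<in> R"
  then have "x \<in> generate F (tensor_rat_relators A)" by (simp add: R_eq)
  then show ?thesis
  proof induction
    case one
    then show ?case using R.one_closed by (simp add: frag_scale_0)
  next
    case (incl h)
    then show ?case by (rule rel)
  next
    case (inv h)
    then have h: "h \<in> carrier F" "frag_scale q h \<in> carrier F"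
      using relators_subset rel R.subset by blast+
    have "frag_scale q (inv\<^bsub>F\<^esub> h) = inv\<^bsub>F\<^esub> (frag_scale q h)"
      using frag_scale_diff[of q 0 h] by (simp add: F_inv[OF h(1)] F_inv[OF h(2)] frag_scale_0)
    then show ?case using rel[OF inv] by simp
  next
    case (eng h1 h2)
    then show ?case using R.m_closed by (simp add: frag_scale_add)
  qed
qed

text \<open>The scalar multiplication of \<open>tensor_rat\<close> adds the relations again after
  scaling a coset. Since scaling maps \<open>R\<close> into itself, this just restores a full coset,
  and representatives may be scaled.\<close>

lemma smult_V:
  assumes "x \<in> carrier F"
  shows "q \<odot>\<^bsub>V\<^esub> tensor_class A x = tensor_class A (frag_scale q x)"
proof -
  have add: "r + s \<in> R" if "r \<in> R" "s \<in> R" for r s using R.m_closed[OF that] by simp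
  have 0: "0 \<in> R" using R.one_closed by simp
  have "q \<odot>\<^bsub>V\<^esub> tensor_class A x = {r + frag_scale q (s + x) | r s. r \<in> R \<and> s \<in> R}"
    unfolding tensor_class_def' r_coset_def
    by (auto simp: V_def tensor_rat_def set_mult_def R_def[symmetric])
  also have "\<dots> = {r + frag_scale q x | r. r \<in> R}"
  proof safe
    fix r s assume "r \<in> R" "s \<in> R"
    then have "r + frag_scale q s \<in> R" using frag_scale_in_R add by blast
    then show "\<exists>t. r + frag_scale q (s + x) = t + frag_scale q x \<and> t \<in> R"
      by (intro exI[of _ "r + frag_scale q s"]) (simp add: frag_scale_add add.assoc)
  next
    fix r assume "r \<in> R"
    then show "\<exists>ra s. r + frag_scale q x = ra + frag_scale q (s + x) \<and> ra \<in> R \<and> s \<in> R"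
      using 0 by (intro exI[of _ r] exI[of _ 0]) simp
  qed
  finally show ?thesis by (auto simp: tensor_class_def' r_coset_def)
qed

definition pure :: "'a \<Rightarrow> rat \<Rightarrow> ('a \<times> rat \<Rightarrow>\<^sub>0 int) set" where
  "pure a r = tensor_class A (frag_of (a, r))"

lemma pure_closed: "a \<in> carrier A \<Longrightarrow> pure a r \<in> carrier V"
  using frag_of_in_F by (simp add: pure_def carrier_V del: F_simps)

lemma smult_pure: "a \<in> carrier A \<Longrightarrow> q \<odot>\<^bsub>V\<^esub> pure a r = pure a (q * r)"
  unfolding pure_def by (subst smult_V) (use frag_of_in_F in \<open>auto simp: frag_scale_of\<close>)

lemma tensor_class_eqI:
  assumes "x \<in> carrier F" "y \<in> carrier F" "x - y \<in> R"
  shows "tensor_class A x = tensor_class A y"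
proof -
  have "tensor_class A x = tensor_class A (x - y) \<oplus>\<^bsub>V\<^esub> tensor_class A y"
    using assms diff_in_F by (subst add_V) (auto simp del: F_simps)
  moreover have "tensor_class A (x - y) = \<zero>\<^bsub>V\<^esub>"
    using assms diff_in_F tensor_class_eq_zero by (auto simp del: F_simps)
  moreover have "tensor_class A y \<in> carrier V" using assms(2) carrier_V by blast
  ultimately show ?thesis by simp
qed

lemma pure_mult:
  assumes "a \<in> carrier A" "b \<in> carrier A"
  shows "pure (a \<otimes> b) r = pure a r \<oplus>\<^bsub>V\<^esub> pure b r"
proof -
  have "frag_of (a \<otimes> b, r) - (frag_of (a, r) + frag_of (b, r)) \<in> R"
    by (rule relators_in_R) (use assms in \<open>auto simp: tensor_rat_relators_def diff_diff_eq[symmetric]\<close>)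
  then have "tensor_class A (frag_of (a \<otimes> b, r)) = tensor_class A (frag_of (a, r) + frag_of (b, r))"
    using assms F.m_closed[OF frag_of_in_F[of a r] frag_of_in_F[of b r]]
    by (intro tensor_class_eqI frag_of_in_F) (auto simp del: F_simps(1))
  then show ?thesis
    unfolding pure_def using assms frag_of_in_F by (subst add_V) (auto simp del: F_simps)
qed

lemma pure_add:
  assumes "a \<in> carrier A"
  shows "pure a (r + s) = pure a r \<oplus>\<^bsub>V\<^esub> pure a s"
proof -
  have "frag_of (a, r + s) - (frag_of (a, r) + frag_of (a, s)) \<in> R"
    by (rule relators_in_R, unfold tensor_rat_relators_def diff_diff_eq[symmetric]) (use assms in blast)
  then have "tensor_class A (frag_of (a, r + s)) = tensor_class A (frag_of (a, r) + frag_of (a, s))"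
    using assms F.m_closed[OF frag_of_in_F[of a r] frag_of_in_F[of a s]]
    by (intro tensor_class_eqI frag_of_in_F) (auto simp del: F_simps(1))
  then show ?thesis
    unfolding pure_def using assms frag_of_in_F by (subst add_V) (auto simp del: F_simps)
qed

sublocale pure: group_hom A "add_monoid V" "\<lambda>a. pure a r" for r
  by unfold_locales (auto simp: hom_def pure_mult pure_closed)

lemma pure_nat_pow: 
  assumes "a \<in> carrier A"
  shows "pure (a [^] n) r = pure a (of_nat n * r)"
proof (induction n)
  case 0
  have "0 \<odot>\<^bsub>V\<^esub> pure a r = \<zero>\<^bsub>V\<^esub>" using V.lmult_0[OF pure_closed[OF assms]] by simp
  then show ?case using assms pure.hom_one by (simp add: smult_pure)
next
  case (Suc n)
  then show ?case using assms by (simp add: pure_mult pure_add distrib_right V.a_comm pure_closed)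
qed

text \<open>If n a lies in the span of \<open>S\<close>, then the tensor of a and r is that of n a
  and r/n, hence a rational combination of the tensors of s and 1 with s in
  \<open>S\<close>.\<close>

lemma fin_dimI:
  assumes S: "finite S" "S \<subseteq> carrier A"
    and gen: "\<And>a. a \<in> carrier A \<Longrightarrow> \<exists>n::nat. n > 0 \<and> a [^] n \<in> generate A S"
  shows "V.fin_dim"
proof -
  let ?B = "(\<lambda>s. pure s 1) ` S"
  let ?Sp = "LinearCombinations.module.span (class_ring :: rat ring) V ?B"
  have B: "?B \<subseteq> carrier V" using S pure_closed by blast
  have sub: "submodule class_ring ?Sp V" by (rule V.span_is_submodule[OF B])
  have Spc: "?Sp \<subseteq> carrier V" and Sps: "\<And>q v. v \<in> ?Sp \<Longrightarrow> q \<odot>\<^bsub>V\<^esub> v \<in> ?Sp"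
    and Spa: "\<And>v w. v \<in> ?Sp \<Longrightarrow> w \<in> ?Sp \<Longrightarrow> v \<oplus>\<^bsub>V\<^esub> w \<in> ?Sp" and Sp0: "\<zero>\<^bsub>V\<^esub> \<in> ?Sp"
    using sub unfolding submodule_def by auto
  have gV: "group (add_monoid V)" using V.a_comm_group by (rule comm_group.axioms)
  have "inv\<^bsub>add_monoid V\<^esub> v \<in> ?Sp" if "v \<in> ?Sp" for v
  proof -
    have v: "v \<in> carrier V" using that Spc by blast
    have "(- 1) \<odot>\<^bsub>V\<^esub> v \<oplus>\<^bsub>V\<^esub> v = \<zero>\<^bsub>V\<^esub>"
      using V.smult_l_distr[of "-1" 1 v] V.smult_one[OF v] V.lmult_0[OF v] v by simp
    then have "inv\<^bsub>add_monoid V\<^esub> v = (- 1) \<odot>\<^bsub>V\<^esub> v"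
      using v Sps[OF that] Spc by (intro group.inv_equality[OF gV]) auto
    then show ?thesis using Sps[OF that] by simp
  qed
  then have Spg: "subgroup ?Sp (add_monoid V)"
    using Spc Spa Sp0 by (intro group.subgroupI[OF gV]) auto
  interpret Sp: subgroup ?Sp "add_monoid V" by (rule Spg)
  have own: "?B \<subseteq> ?Sp" by (rule V.in_own_span[OF B])
  have gen1: "pure a r \<in> ?Sp" if "a \<in> generate A S" for a r
    using that
  proof induction
    case one
    then show ?case using Sp.one_closed pure.hom_one[of r] by simp
  next
    case (incl h)
    then have "r \<odot>\<^bsub>V\<^esub> pure h 1 \<in> ?Sp" using own Sps by blast
    then show ?case using incl S by (simp add: smult_pure subset_iff)
  next
    case (inv h)
    then have "r \<odot>\<^bsub>V\<^esub> pure h 1 \<in> ?Sp" using own Sps by blast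
    then have "pure h r \<in> ?Sp" using inv S by (simp add: smult_pure subset_iff)
    moreover have "h \<in> carrier A" using inv S by blast
    ultimately show ?case using Sp.m_inv_closed[of "pure h r"] pure.hom_inv[of h r] by simp
  next
    case (eng h1 h2)
    then have "h1 \<in> carrier A" "h2 \<in> carrier A"
      using generate_in_carrier[OF S(2)] by auto
    then show ?case using eng.IH Sp.m_closed[of "pure h1 r" "pure h2 r"] by (simp add: pure_mult)
  qed
  have all: "pure a r \<in> ?Sp" if "a \<in> carrier A" for a r
  proof -
    obtain n :: nat where n: "n > 0" "a [^] n \<in> generate A S" using gen[OF \<open>a \<in> carrier A\<close>] by blast
    have "pure a r = pure (a [^] n) (r / of_nat n)"
      using n that by (simp add: pure_nat_pow)
    then show ?thesis using gen1 n by simp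
  qed
  have "tensor_class A x \<in> ?Sp" if "x \<in> carrier F" for x
  proof -
    have "Poly_Mapping.keys x \<subseteq> carrier A \<times> UNIV" using that by simp
    then have "x \<in> carrier F \<and> tensor_class A x \<in> ?Sp"
    proof (induction rule: frag_induction)
      case zero
      then show ?case using Sp.one_closed cls.hom_one by simp
    next
      case (one z)
      then show ?case using all by (auto simp: pure_def)
    next
      case (diff a b)
      have "a - b = a \<otimes>\<^bsub>F\<^esub> inv\<^bsub>F\<^esub> b" using diff F_inv[of b] by simp
      moreover have ab: "a \<in> carrier F" "b \<in> carrier F" using diff by blast+
      ultimately have eq: "tensor_class A (a - b)
          = tensor_class A a \<otimes>\<^bsub>add_monoid V\<^esub> inv\<^bsub>add_monoid V\<^esub> tensor_class A b"
        using cls.hom_mult[OF ab(1) F.inv_closed[OF ab(2)]] cls.hom_inv[OF ab(2)] by metis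
      have "tensor_class A a \<in> ?Sp" "tensor_class A b \<in> ?Sp" using diff by blast+
      then have "tensor_class A (a - b) \<in> ?Sp"
        unfolding eq by (intro Sp.m_closed Sp.m_inv_closed)
      then show ?case using diff_in_F[OF ab] by blast
    qed
    then show ?thesis by simp
  qed
  then have "tensor_class A ` carrier F \<subseteq> ?Sp" by (rule image_subsetI)
  then have "?Sp = carrier V" using Spc by (simp only: carrier_V[symmetric] subset_antisym)
  moreover have "finite ?B" using S(1) by (rule finite_imageI)
  ultimately show ?thesis
    unfolding V.fin_dim_def using B by (intro exI[of _ ?B] conjI)
qed

end

context rational_tensor
begin

text \<open>
  The map \<open>a \<otimes> r \<mapsto> \<lfloor>N r\<rfloor> a\<close> on the free group kills a given relation once \<open>N\<close> is sufficiently
  divisible; this replaces the localisation of \<open>A\<close> at the nonzero integers.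
\<close>

lemma floor_evaluations:
  obtains v :: "nat \<Rightarrow> ('a \<times> rat \<Rightarrow>\<^sub>0 int) \<Rightarrow> 'a"
  where "\<And>N. v N \<in> hom F A"
    and "\<And>N a r. a \<in> carrier A \<Longrightarrow> v N (frag_of (a, r)) = a [^] \<lfloor>of_nat N * r\<rfloor>"
proof -
  have "\<exists>h. h \<in> hom F A \<and> (\<forall>a r. a \<in> carrier A \<longrightarrow> h (frag_of (a, r)) = a [^] \<lfloor>of_nat N * r\<rfloor>)"
    for N :: nat
  proof -
    have "(\<lambda>(a, r). a [^] \<lfloor>of_nat N * r\<rfloor>) ` (carrier A \<times> UNIV) \<subseteq> carrier A" by auto
    then obtain h where "h \<in> hom F A"
      "\<And>x. x \<in> carrier A \<times> UNIV \<Longrightarrow> h (frag_of x) = (\<lambda>(a, r). a [^] \<lfloor>of_nat N * r\<rfloor>) x"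
      unfolding F_def by (rule free_Abelian_group_universal) blast
    then show ?thesis by auto
  qed
  then show ?thesis using that by metis
qed

end

lemma rat_common_denominator:
  fixes q :: "'i \<Rightarrow> rat"
  assumes "finite I"
  obtains N :: nat where "N > 0" "\<And>M i. N dvd M \<Longrightarrow> i \<in> I \<Longrightarrow> of_nat M * q i \<in> \<int>"
proof -
  have one: "\<exists>d::nat. d > 0 \<and> of_nat d * r \<in> \<int>" for r :: rat
  proof -
    obtain a b where ab: "quotient_of r = (a, b)" by force
    then have "b > 0" "r = of_int a / of_int b"
      using quotient_of_denom_pos quotient_of_div by auto
    then have "of_nat (nat b) * r = of_int a" by simp
    then show ?thesis using \<open>b > 0\<close> by (intro exI[of _ "nat b"]) auto
  qed
  then obtain d where d: "\<And>r::rat. d r > (0::nat)" "\<And>r. of_nat (d r) * r \<in> \<int>" by metis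
  show ?thesis
  proof (rule that[of "\<Prod>i\<in>I. d (q i)"])
    show "(\<Prod>i\<in>I. d (q i)) > 0" using d by (simp add: prod_pos)
    fix M i assume "(\<Prod>i\<in>I. d (q i)) dvd M" "i \<in> I"
    then have "d (q i) dvd M" using assms by (meson dvd_prod_eqI dvd_trans)
    then obtain k where "M = d (q i) * k" by blast
    then have "of_nat M * q i = of_nat k * (of_nat (d (q i)) * q i)" by simp
    then show "of_nat M * q i \<in> \<int>" using d(2) by (metis Ints_mult Ints_of_nat)
  qed
qed

context rational_tensor
begin

text \<open>Relators additive in the group element vanish under every evaluation. Those additive in
  the rational vanish once N r and N s are integers, where the floor is additive. Asking for all
  multiples of \<open>N\<close> lets the property survive products: \<open>N1 * N2\<close> serves
  both factors.\<close>

lemma floor_evaluation_relation: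
  assumes hom: "\<And>N. v N \<in> hom F A"
    and v: "\<And>N a r. a \<in> carrier A \<Longrightarrow> v N (frag_of (a, r)) = a [^] \<lfloor>of_nat N * r\<rfloor>"
    and "x \<in> R"
  shows "\<exists>N::nat. N > 0 \<and> (\<forall>M. N dvd M \<longrightarrow> v M x = \<one>)"
proof -
  interpret v: group_hom F A "v N" for N
    using hom by unfold_locales
  have diff: "v N (x - y) = v N x \<otimes> inv (v N y)" if "x \<in> carrier F" "y \<in> carrier F" for N x y
  proof -
    have "x - y = x \<otimes>\<^bsub>F\<^esub> inv\<^bsub>F\<^esub> y" using that F_inv[of y] by simp
    then show ?thesis using that v.hom_mult v.hom_inv by (metis F.inv_closed)
  qed
  have cancel: "a \<otimes> b \<otimes> inv a \<otimes> inv b = \<one>" if "a \<in> carrier A" "b \<in> carrier A" for a b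
  proof -
    have "a \<otimes> b \<otimes> inv a \<otimes> inv b = (a \<otimes> b) \<otimes> inv (a \<otimes> b)"
      using that by (simp add: inv_mult m_assoc)
    then show ?thesis using that by simp
  qed
  have rel: "\<exists>N::nat. N > 0 \<and> (\<forall>M. N dvd M \<longrightarrow> v M x = \<one>)" if "x \<in> tensor_rat_relators A" for x
    using that unfolding tensor_rat_relators_def
  proof (elim UnE)
    assume "x \<in> {frag_of (a \<otimes> b, r) - frag_of (a, r) - frag_of (b, r) | a b r.
        a \<in> carrier A \<and> b \<in> carrier A}"
    then obtain a b r where x: "x = frag_of (a \<otimes> b, r) - frag_of (a, r) - frag_of (b, r)"
      and ab: "a \<in> carrier A" "b \<in> carrier A" by blast
    have "v M x = \<one>" for M
      unfolding x using ab
      by (simp add: diff diff_in_F frag_of_in_F v int_pow_distrib cancel del: F_simps)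
    then show ?thesis by blast
  next
    assume "x \<in> {frag_of (a, r + s) - frag_of (a, r) - frag_of (a, s) | a r s. a \<in> carrier A}"
    then obtain a r s where x: "x = frag_of (a, r + s) - frag_of (a, r) - frag_of (a, s)"
      and a: "a \<in> carrier A" by blast
    obtain N where N: "N > 0" "\<And>M t. N dvd M \<Longrightarrow> t \<in> {r, s} \<Longrightarrow> of_nat M * t \<in> \<int>"
      using rat_common_denominator[of "{r, s}" id] by auto
    have "v M x = \<one>" if NM: "N dvd M" for M
    proof -
      have "of_nat M * r \<in> \<int>" "of_nat M * s \<in> \<int>" using N(2)[OF NM] by auto
      then obtain z w where zw: "of_nat M * r = of_int z" "of_nat M * s = of_int w"
        by (auto elim!: Ints_cases)
      have "\<lfloor>of_nat M * (r + s)\<rfloor> = z + w" using zw by (simp add: distrib_left flip: of_int_add)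
      then have "v M x = (a [^] (z + w)) \<otimes> inv (a [^] z) \<otimes> inv (a [^] w)"
        unfolding x using a zw by (simp add: diff diff_in_F frag_of_in_F v del: F_simps)
      also have "\<dots> = \<one>"
        using a by (simp add: int_pow_mult cancel)
      finally show ?thesis .
    qed
    then show ?thesis using N by blast
  qed
  have "x \<in> generate F (tensor_rat_relators A)" using assms(3) by (simp add: R_eq)
  then show ?thesis
  proof induction
    case one
    then show ?case using v.hom_one by (intro exI[of _ 1]) simp
  next
    case (incl h)
    then show ?case by (rule rel)
  next
    case (inv h)
    then show ?case using rel[OF inv] relators_subset
      by (metis inv_one subsetD v.hom_inv)
  next
    case (eng h1 h2)
    then obtain N1 N2 where N: "N1 > 0" "\<forall>M. N1 dvd M \<longrightarrow> v M h1 = \<one>"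
      "N2 > 0" "\<forall>M. N2 dvd M \<longrightarrow> v M h2 = \<one>" by blast
    have h: "h1 \<in> carrier F" "h2 \<in> carrier F"
      using eng F.generate_in_carrier[OF relators_subset] by blast+
    have "v M (h1 \<otimes>\<^bsub>F\<^esub> h2) = \<one>" if "N1 * N2 dvd M" for M
      using N h that v.hom_mult by (metis dvd_mult_left dvd_mult_right l_one one_closed)
    then show ?case using N by (metis nat_0_less_mult_iff)
  qed
qed

text \<open>Denominators are cleared by evaluating at \<open>M = N1 * N2\<close>, where
  \<open>N1\<close> makes the relation vanish and \<open>N2\<close> makes every M q_i an integer.
  This gives an integral relation among the f_i with z_j nonzero, and its last nonzero coefficient
  contradicts independence.\<close>

lemma independent_sequence_coefficients:
  assumes f: "independent_sequence A f" and I: "finite I"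
    and rel: "(\<Sum>i\<in>I. frag_of (f i, q i)) \<in> R" and j: "j \<in> I"
  shows "q j = 0"
proof (rule ccontr)
  assume qj: "q j \<noteq> 0"
  have fc: "f i \<in> carrier A" for i using f by (auto simp: independent_sequence_def)
  obtain v :: "nat \<Rightarrow> ('a \<times> rat \<Rightarrow>\<^sub>0 int) \<Rightarrow> 'a" where hom: "\<And>N. v N \<in> hom F A"
    and v: "\<And>N a r. a \<in> carrier A \<Longrightarrow> v N (frag_of (a, r)) = a [^] \<lfloor>of_nat N * r\<rfloor>"
    using floor_evaluations by blast
  interpret v: group_hom F A "v N" for N
    using hom by unfold_locales
  obtain N1 where N1: "N1 > 0" "\<And>M. N1 dvd M \<Longrightarrow> v M (\<Sum>i\<in>I. frag_of (f i, q i)) = \<one>"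
    using floor_evaluation_relation[OF hom v rel] by blast
  obtain N2 where N2: "N2 > 0" "\<And>M i. N2 dvd M \<Longrightarrow> i \<in> I \<Longrightarrow> of_nat M * q i \<in> \<int>"
    using rat_common_denominator[OF I] by blast
  define M where "M = N1 * N2"
  define z where "z i = \<lfloor>of_nat M * q i\<rfloor>" for i
  have vs: "(\<Sum>i\<in>J. frag_of (f i, q i)) \<in> carrier F \<and>
      v M (\<Sum>i\<in>J. frag_of (f i, q i)) = finprod A (\<lambda>i. f i [^] z i) J" if "finite J" for J
    using that
  proof induction
    case empty
    then show ?case using v.hom_one by simp
  next
    case (insert i J)
    have "v M (frag_of (f i, q i) \<otimes>\<^bsub>F\<^esub> (\<Sum>i\<in>J. frag_of (f i, q i)))
        = v M (frag_of (f i, q i)) \<otimes> v M (\<Sum>i\<in>J. frag_of (f i, q i))"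
      using insert.IH fc by (intro v.hom_mult) (auto simp del: F_simps intro: frag_of_in_F)
    moreover have "frag_of (f i, q i) \<otimes>\<^bsub>F\<^esub> (\<Sum>i\<in>J. frag_of (f i, q i)) \<in> carrier F"
      using insert.IH fc by (intro F.m_closed) (auto simp del: F_simps intro: frag_of_in_F)
    ultimately show ?case
      using insert fc by (simp add: v z_def Pi_iff del: F_simps(1))
  qed
  have prod: "finprod A (\<lambda>i. f i [^] z i) I = \<one>"
    using vs[OF I] N1(2)[of M] by (simp add: M_def)
  have "z j \<noteq> 0"
  proof -
    have "of_nat M * q j \<in> \<int>" using N2(2)[of M j] j by (simp add: M_def)
    then obtain w where "of_nat M * q j = of_int w" by (auto elim: Ints_cases)
    then show ?thesis using qj N1(1) N2(1) by (auto simp: z_def M_def)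
  qed
  define J where "J = {i \<in> I. z i \<noteq> 0}"
  have J: "finite J" "J \<noteq> {}" using I j \<open>z j \<noteq> 0\<close> by (auto simp: J_def)
  define k where "k = Max J"
  have k: "k \<in> I" "z k \<noteq> 0" using Max_in[OF J] by (auto simp: k_def J_def)
  have kmax: "i < k" if "i \<in> J - {k}" for i
    using Max_ge[OF J(1), of i] that by (auto simp: k_def)
  have "finprod A (\<lambda>i. f i [^] z i) I = finprod A (\<lambda>i. f i [^] z i) J"
    by (rule finprod_mono_neutral_cong_right) (use I fc in \<open>auto simp: J_def\<close>)
  also have "\<dots> = f k [^] z k \<otimes> finprod A (\<lambda>i. f i [^] z i) (J - {k})"
    using J k fc finprod_insert[of "J - {k}" k "\<lambda>i. f i [^] z i"]
    by (simp add: J_def insert_absorb Pi_iff)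
  finally have eq: "f k [^] z k \<otimes> finprod A (\<lambda>i. f i [^] z i) (J - {k}) = \<one>"
    using prod by simp
  let ?g = "generate A (f ` {..<k})"
  have sub: "subgroup ?g A" using fc by (intro generate_is_subgroup) auto
  interpret g: subgroup ?g A by (rule sub)
  have gprod: "finprod A (\<lambda>i. f i [^] z i) L \<in> ?g" if "finite L" "L \<subseteq> J - {k}" for L
    using that
  proof induction
    case empty
    then show ?case using g.one_closed by simp
  next
    case (insert i L)
    have "f i \<in> ?g" using kmax insert by (intro generate.incl) auto
    then have "f i [^] z i \<in> ?g" using sub by (rule subgroup_int_pow_closed[rotated])
    then show ?case using insert fc g.m_closed by (simp add: Pi_iff)
  qed
  have p: "finprod A (\<lambda>i. f i [^] z i) (J - {k}) \<in> ?g" by (rule gprod) (simp_all add: J(1))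
  have pc: "finprod A (\<lambda>i. f i [^] z i) (J - {k}) \<in> carrier A" using p g.mem_carrier by simp
  have fz: "f k [^] z k = inv (finprod A (\<lambda>i. f i [^] z i) (J - {k}))"
    by (rule inv_equality[symmetric, OF eq pc]) (simp add: fc)
  have zg: "f k [^] z k \<in> ?g" unfolding fz by (rule g.m_inv_closed[OF p])
  have zg': "inv (f k [^] z k) \<in> ?g" by (rule g.m_inv_closed[OF zg])
  have "f k [^] (nat \<bar>z k\<bar>) \<in> ?g"
  proof (cases "z k \<ge> 0")
    case True
    then show ?thesis using zg unfolding int_pow_def2 by simp
  next
    case False
    then have "inv (f k [^] z k) = f k [^] nat \<bar>z k\<bar>"
      unfolding int_pow_def2 using fc by simp
    then show ?thesis using zg' by metis
  qed
  moreover have "nat \<bar>z k\<bar> > 0" using k by simp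
  ultimately show False using f unfolding independent_sequence_def by metis
qed

lemma not_fin_dimI:
  assumes f: "independent_sequence A f"
  shows "\<not> V.fin_dim"
proof
  assume fd: "V.fin_dim"
  have fc: "f i \<in> carrier A" for i using f by (auto simp: independent_sequence_def)
  define w where "w i = pure (f i) 1" for i
  have wc: "w i \<in> carrier V" for i using fc pure_closed by (simp add: w_def)
  have sum: "(\<Sum>i\<in>J. frag_of (f i, q i)) \<in> carrier F \<and>
      finsum V (\<lambda>i. q i \<odot>\<^bsub>V\<^esub> w i) J = tensor_class A (\<Sum>i\<in>J. frag_of (f i, q i))"
    if "finite J" for J q
    using that
  proof induction
    case empty
    then show ?case using cls.hom_one by simp
  next
    case (insert i J)
    have 1: "frag_of (f i, q i) \<in> carrier F" by (rule frag_of_in_F[OF fc])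
    have "frag_of (f i, q i) \<otimes>\<^bsub>F\<^esub> (\<Sum>i\<in>J. frag_of (f i, q i)) \<in> carrier F"
      using insert.IH 1 by (intro F.m_closed) auto
    moreover have "finsum V (\<lambda>i. q i \<odot>\<^bsub>V\<^esub> w i) (insert i J)
        = q i \<odot>\<^bsub>V\<^esub> w i \<oplus>\<^bsub>V\<^esub> finsum V (\<lambda>i. q i \<odot>\<^bsub>V\<^esub> w i) J"
      using insert wc V.smult_closed by (intro V.finsum_insert) auto
    moreover have "q i \<odot>\<^bsub>V\<^esub> w i = tensor_class A (frag_of (f i, q i))"
      using smult_pure[OF fc] by (simp add: w_def) (simp add: pure_def)
    ultimately show ?case
      using insert 1 by (simp add: add_V del: F_simps(1))
  qed
  have coeff: "q j = 0" if "finite I" "finsum V (\<lambda>i. q i \<odot>\<^bsub>V\<^esub> w i) I = \<zero>\<^bsub>V\<^esub>" "j \<in> I" for I q j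
  proof (rule independent_sequence_coefficients[OF f \<open>finite I\<close> _ \<open>j \<in> I\<close>])
    have "tensor_class A (\<Sum>i\<in>I. frag_of (f i, q i)) = \<zero>\<^bsub>V\<^esub>"
      using conjunct2[OF sum[OF \<open>finite I\<close>, of q]] that(2) by simp
    then show "(\<Sum>i\<in>I. frag_of (f i, q i)) \<in> R"
      using tensor_class_eq_zero[OF conjunct1[OF sum[OF \<open>finite I\<close>, of q]]] by simp
  qed
  \<comment> \<open>\<open>lin_dep\<close> speaks of sets of vectors, so the family must first be
    injective; w_i = w_j would be a relation with coefficients 1 and -1.\<close>
  have inj: "inj w"
  proof (rule injI, rule ccontr)
    fix i j assume ij: "w i = w j" "i \<noteq> j"
    let ?q = "\<lambda>l. if l = i then 1 else (- 1 :: rat)"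
    have two: "finsum V g {i, j} = g i \<oplus>\<^bsub>V\<^esub> g j" if "\<And>l. g l \<in> carrier V" for g
      using that ij(2) by simp
    have "finsum V (\<lambda>l. ?q l \<odot>\<^bsub>V\<^esub> w l) {i, j} = ?q i \<odot>\<^bsub>V\<^esub> w i \<oplus>\<^bsub>V\<^esub> ?q j \<odot>\<^bsub>V\<^esub> w j"
      by (rule two, rule V.smult_closed) (use wc in simp_all)
    also have "\<dots> = 1 \<odot>\<^bsub>V\<^esub> w j \<oplus>\<^bsub>V\<^esub> (- 1) \<odot>\<^bsub>V\<^esub> w j"
      using ij by simp
    also have "\<dots> = \<zero>\<^bsub>V\<^esub>"
      using V.smult_l_distr[of 1 "-1" "w j"] V.lmult_0[OF wc, of j] wc[of j] by simp
    finally have s0: "finsum V (\<lambda>l. ?q l \<odot>\<^bsub>V\<^esub> w l) {i, j} = \<zero>\<^bsub>V\<^esub>" .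
    have "?q i = 0" by (rule coeff[OF _ s0]) simp_all
    then show False by simp
  qed
  have "\<not> V.lin_dep (range w)"
  proof
    assume "V.lin_dep (range w)"
    then obtain B a b where B: "finite B" "B \<subseteq> range w" "V.lincomb a B = \<zero>\<^bsub>V\<^esub>" "b \<in> B" "a b \<noteq> 0"
      unfolding V.lin_dep_def by (elim exE conjE) simp
    obtain I where I: "B = w ` I" "finite I" 
      using B by (metis finite_subset_image)
    have inI: "inj_on w I" using inj by (rule inj_on_subset) simp
    have "V.lincomb a B = finsum V (\<lambda>i. a (w i) \<odot>\<^bsub>V\<^esub> w i) I"
      unfolding V.lincomb_def I(1)
      by (rule V.finsum_reindex[OF _ inI]) (use wc V.smult_closed in \<open>simp add: Pi_iff\<close>)
    then have s0: "finsum V (\<lambda>i. a (w i) \<odot>\<^bsub>V\<^esub> w i) I = \<zero>\<^bsub>V\<^esub>" using B(3) by simp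
    obtain i where "i \<in> I" "b = w i" using B(4) I(1) by blast
    then show False using coeff[OF I(2) s0] B(5) by simp
  qed
  then have "finite (range w)"
    by (rule V.li_le_dim(1)[OF fd image_subsetI[OF wc]])
  then show False using finite_imageD[OF _ inj] by simp
qed

end

lemma independent_sequence_existsI:
  assumes "\<And>S. finite S \<Longrightarrow> S \<subseteq> carrier A \<Longrightarrow>
    \<exists>a\<in>carrier A. \<forall>n::nat. n > 0 \<longrightarrow> a [^]\<^bsub>A\<^esub> n \<notin> generate A S"
  shows "\<exists>f. independent_sequence A f"
  by (rule greedy_sequence[of "carrier A" "\<lambda>S a. \<forall>n::nat. n > 0 \<longrightarrow> a [^]\<^bsub>A\<^esub> n \<notin> generate A S"])
    (use assms in \<open>auto simp: independent_sequence_def\<close>)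

text \<open>Without an independent sequence the greedy choice stops at a finite set \<open>S\<close>
  such that every element has a positive multiple in the span of \<open>S\<close>; then
  \<open>fin_dimI\<close> applies.\<close>

lemma finite_Z_rank_iff:
  assumes "comm_group A"
  shows "finite_Z_rank A \<longleftrightarrow> \<not> (\<exists>f. independent_sequence A f)"
proof -
  interpret T: rational_tensor A "free_Abelian_group (carrier A \<times> UNIV)"
    "tensor_rat_relations A" "tensor_rat A"
    by (intro rational_tensor.intro assms)
  show ?thesis
  proof
    assume "finite_Z_rank A"
    then show "\<not> (\<exists>f. independent_sequence A f)"
      unfolding finite_Z_rank_def using T.not_fin_dimI by metis
  next
    assume "\<not> (\<exists>f. independent_sequence A f)"
    then obtain S where "finite S" "S \<subseteq> carrier A"
      "\<And>a. a \<in> carrier A \<Longrightarrow> \<exists>n::nat. n > 0 \<and> a [^]\<^bsub>A\<^esub> n \<in> generate A S"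
      using independent_sequence_existsI[of A] by metis
    then show "finite_Z_rank A"
      unfolding finite_Z_rank_def by (rule T.fin_dimI)
  qed
qed

section \<open>Torsion and finite rank\<close>

context comm_group
begin

lemma torI: "\<lbrakk>x \<in> carrier G; (n::nat) > 0; x [^] n = \<one>\<rbrakk> \<Longrightarrow> x \<in> tor G"
  by (auto simp: tor_def)

lemma subgroup_tor: "subgroup (tor G) G"
proof (rule subgroupI)
  show "tor G \<subseteq> carrier G" by (auto simp: tor_def)
  have "\<one> \<in> tor G" by (rule torI[of _ 1]) auto
  then show "tor G \<noteq> {}" by blast
  fix a assume "a \<in> tor G"
  then obtain n :: nat where a: "a \<in> carrier G" "n > 0" "a [^] n = \<one>" by (auto simp: tor_def)
  then show "inv a \<in> tor G" by (intro torI[of _ n]) (auto simp: nat_pow_inv)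
  fix b assume "b \<in> tor G"
  then obtain m :: nat where b: "b \<in> carrier G" "m > 0" "b [^] m = \<one>" by (auto simp: tor_def)
  have "a [^] (n * m) = \<one>" using a by (simp add: nat_pow_pow[symmetric])
  moreover have "b [^] (n * m) = \<one>" using b by (simp add: mult.commute[of n] nat_pow_pow[symmetric])
  ultimately show "a \<otimes> b \<in> tor G"
    using a b by (intro torI[of _ "n * m"]) (auto simp: nat_pow_distrib)
qed

lemma tor_of_pow_mem_tor: "\<lbrakk>x \<in> carrier G; (n::nat) > 0; x [^] n \<in> tor G\<rbrakk> \<Longrightarrow> x \<in> tor G"
  by (auto simp: tor_def nat_pow_pow) (metis nat_0_less_mult_iff)

lemma nat_pow_mem: "subgroup H G \<Longrightarrow> x \<in> H \<Longrightarrow> x [^] (n::nat) \<in> H"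
  using subgroup_int_pow_closed[of H x "int n"] by (simp add: int_pow_int)

lemma mem_subgroup_of_coprime_pows:
  assumes H: "subgroup H G" and x: "x \<in> carrier G"
    and "x [^] (n::int) \<in> H" "x [^] (p::int) \<in> H" and "coprime n p"
  shows "x \<in> H"
proof -
  obtain a b where ab: "a * n + b * p = 1"
    using bezout_int[of n p] \<open>coprime n p\<close> by (auto simp: coprime_iff_gcd_eq_1)
  have "x = x [^] (n * a + p * b)" using ab x by (simp add: mult.commute)
  also have "\<dots> = (x [^] n) [^] a \<otimes> (x [^] p) [^] b"
    using x by (simp add: int_pow_mult int_pow_pow)
  also have "\<dots> \<in> H"
    by (rule subgroup.m_closed[OF H subgroup_int_pow_closed[OF H assms(3)]
          subgroup_int_pow_closed[OF H assms(4)]])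
  finally show ?thesis .
qed

lemma set_mult_mem: "\<lbrakk>a \<in> A; b \<in> B\<rbrakk> \<Longrightarrow> a \<otimes> b \<in> A <#> B"
  by (auto simp: set_mult_def)

text \<open>
  If \<open>f\<^sub>k \<notin> \<langle>f\<^sub>i | i < k\<rangle> + p R + tor G\<close> for all \<open>k\<close>, then the \<open>f\<^sub>i\<close> are independent: dividing a relation by
  \<open>p\<close> modulo torsion until some coefficient is prime to \<open>p\<close> would contradict this for the last
  such index.
\<close>

lemma independent_sequence_mod_prime:
  fixes p :: nat
  assumes p: "prime p" and R: "subgroup R G" and fR: "range f \<subseteq> R"
    and f: "\<And>k. f k \<notin> generate G (f ` {..<k}) <#> {s [^] p \<otimes> t | s t. s \<in> R \<and> t \<in> tor G}"
  shows "independent_sequence G f"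
proof -
  interpret T: subgroup "tor G" G by (rule subgroup_tor)
  interpret R: subgroup R G by (rule R)
  define Q where "Q = {s [^] p \<otimes> t | s t. s \<in> R \<and> t \<in> tor G}"
  define L where "L k = generate G (f ` {..<k})" for k
  have fc: "f k \<in> carrier G" for k using fR R.subset by blast
  have L: "subgroup (L k) G" for k
    unfolding L_def using fc by (intro generate_is_subgroup) auto
  have "Q = ((\<lambda>s. s [^] p) ` R) <#> tor G" by (auto simp: Q_def set_mult_def)
  moreover have "subgroup ((\<lambda>s. s [^] p) ` R) G"
  proof (rule subgroupI)
    show "(\<lambda>s. s [^] p) ` R \<subseteq> carrier G" using R.subset by auto
    show "(\<lambda>s. s [^] p) ` R \<noteq> {}" using R.one_closed by blast
    show "inv a \<in> (\<lambda>s. s [^] p) ` R" if "a \<in> (\<lambda>s. s [^] p) ` R" for a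
      using that by (auto simp: nat_pow_inv[symmetric])
    show "a \<otimes> b \<in> (\<lambda>s. s [^] p) ` R" if "a \<in> (\<lambda>s. s [^] p) ` R" "b \<in> (\<lambda>s. s [^] p) ` R" for a b
      using that by (auto simp: nat_pow_distrib[symmetric])
  qed
  ultimately have Q: "subgroup Q G" using subgroup_tor by (simp add: mult_subgroups)
  interpret Q: subgroup Q G by (rule Q)
  have QI: "x \<in> Q" if "s \<in> R" "t \<in> tor G" "x = s [^] p \<otimes> t" for s t x
    using that by (auto simp: Q_def)
  have powQ: "s [^] p \<in> Q" if "s \<in> R" for s
    by (rule QI[OF that T.one_closed]) (use that R.mem_carrier in simp)
  have TQ: "t \<in> Q" if "t \<in> tor G" for t
    by (rule QI[OF R.one_closed that]) (use that T.mem_carrier in simp)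
  have LQ: "subgroup (L k <#> Q) G" for k by (rule mult_subgroups[OF L Q])
  have Q_LQ: "x \<in> L k <#> Q" if "x \<in> Q" for x k
    using set_mult_mem[OF subgroup.one_closed[OF L] that] that by simp
  \<comment> \<open>The multiple p f_k lies in \<open>Q\<close>. By Bezout, a multiple n f_k in L_k
    + Q with n prime to p would put f_k itself there, against its choice.\<close>
  have dvd: "int p dvd n" if n: "f k [^] (n::int) \<in> L k <#> Q" for k n
  proof (rule ccontr)
    assume "\<not> int p dvd n"
    moreover have "prime (int p)" using p by simp
    ultimately have "coprime n (int p)"
      using prime_imp_coprime[of "int p" n] by (simp add: coprime_commute)
    moreover have "f k [^] int p \<in> L k <#> Q"
      unfolding int_pow_int using fR by (intro Q_LQ powQ) blast
    ultimately have "f k \<in> L k <#> Q"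
      using mem_subgroup_of_coprime_pows[OF LQ fc n] by blast
    then show False using f[of k] by (simp add: L_def Q_def)
  qed
  \<comment> \<open>An element of L_k that is p times an element of \<open>R\<close> up to torsion
    is already p times an element of L_k up to torsion: starting from the last one, each coefficient
    is seen to be a multiple of p.\<close>
  have divide: "\<exists>w\<in>L k. \<exists>t\<in>tor G. z = w [^] p \<otimes> t" if "z \<in> L k" "z \<in> Q" for k z
    using that
  proof (induction k arbitrary: z)
    case 0
    then have "z = \<one>" by (simp add: L_def generate_empty)
    then show ?case using T.one_closed subgroup.one_closed[OF L, of 0]
      by (intro bexI[of _ \<one>]) auto
  next
    case (Suc k)
    have "L (Suc k) = {z \<otimes> f k [^] (n::int) | z n. z \<in> L k}"
      unfolding L_def lessThan_Suc image_insert using fc by (intro generate_insert) auto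
    then obtain y n where y: "y \<in> L k" "z = y \<otimes> f k [^] (n::int)" using Suc.prems by auto
    have yc: "y \<in> carrier G" using y L subgroup.subset by blast
    have zc: "z \<in> carrier G" using y yc fc by simp
    have "f k [^] n = inv y \<otimes> z" using y yc fc by (simp add: m_assoc[symmetric])
    then have "f k [^] n \<in> L k <#> Q"
      using set_mult_mem[of "inv y" "L k" z Q] Suc.prems y subgroup.m_inv_closed[OF L] by simp
    then obtain n' where n': "n = int p * n'" using dvd by blast
    define u where "u = f k [^] n'"
    have u: "u \<in> R" "u \<in> L (Suc k)" "u \<in> carrier G"
    proof -
      have "f k \<in> L (Suc k)" unfolding L_def by (rule generate.incl) auto
      moreover have "f k \<in> R" using fR by blast
      ultimately show "u \<in> R" "u \<in> L (Suc k)" "u \<in> carrier G"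
        using fc unfolding u_def by (auto intro: subgroup_int_pow_closed[OF R] subgroup_int_pow_closed[OF L])
    qed
    have fn: "f k [^] n = u [^] p"
      using fc by (simp add: n' u_def int_pow_pow mult.commute flip: int_pow_int)
    have "y = z \<otimes> inv (u [^] p)" using y yc u fn by (simp add: m_assoc)
    then have "y \<in> Q" using Suc.prems powQ[OF u(1)] by simp
    then obtain w t where w: "w \<in> L k" "t \<in> tor G" "y = w [^] p \<otimes> t" using Suc.IH y(1) by blast
    have wc: "w \<in> carrier G" using w L subgroup.subset by blast
    have "L k \<subseteq> L (Suc k)" unfolding L_def by (rule mono_generate) auto
    then have "w \<otimes> u \<in> L (Suc k)" using w u subgroup.m_closed[OF L] by blast
    moreover have "z = (w \<otimes> u) [^] p \<otimes> t"
      using w wc u y fn T.mem_carrier by (simp add: nat_pow_distrib m_ac)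
    ultimately show ?case using w by blast
  qed
  have "f k [^] n \<notin> L k <#> tor G" if "n > 0" for k and n :: nat
    using that
  proof (induction n rule: less_induct)
    case (less n)
    show ?case
    proof
      assume "f k [^] n \<in> L k <#> tor G"
      then obtain z t where z: "z \<in> L k" "t \<in> tor G" "f k [^] n = z \<otimes> t"
        by (auto simp: set_mult_def)
      have zc: "z \<in> carrier G" using z L subgroup.subset by blast
      have "f k [^] int n \<in> L k <#> Q" using z set_mult_mem TQ by (simp add: int_pow_int)
      then have "p dvd n" using dvd by fastforce
      then obtain n' where n': "n = n' * p" by (metis dvd_def mult.commute)
      have "n' > 0" "n' < n" using n' less.prems prime_gt_1_nat[OF p] by auto
      have pw: "f k [^] n = (f k [^] n') [^] p" using fc by (simp add: n' nat_pow_pow)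
      have "z = (f k [^] n') [^] p \<otimes> inv t"
        using z zc pw T.mem_carrier by (simp add: m_assoc)
      also have "\<dots> \<in> Q"
        using fR TQ[OF z(2)] by (intro Q.m_closed Q.m_inv_closed powQ nat_pow_mem[OF R]) auto
      finally obtain w t' where w: "w \<in> L k" "t' \<in> tor G" "z = w [^] p \<otimes> t'"
        using divide z(1) by blast
      have wc: "w \<in> carrier G" using w L subgroup.subset by blast
      have "(f k [^] n' \<otimes> inv w) [^] p = (w [^] p \<otimes> t' \<otimes> t) \<otimes> inv (w [^] p)"
        using fc wc z(3) w(3) pw by (simp add: nat_pow_distrib nat_pow_inv)
      also have "\<dots> = t' \<otimes> t"
        using wc w(2) z(2) T.mem_carrier by (simp add: m_ac)
      finally have pt: "(f k [^] n' \<otimes> inv w) [^] p \<in> tor G" using w z by simp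
      have t: "f k [^] n' \<otimes> inv w \<in> tor G"
        by (rule tor_of_pow_mem_tor[OF _ prime_gt_0_nat[OF p] pt]) (use fc wc in simp)
      have "f k [^] n' = f k [^] n' \<otimes> inv w \<otimes> w"
        using fc wc by (simp add: m_assoc)
      also have "\<dots> = w \<otimes> (f k [^] n' \<otimes> inv w)"
        using fc wc by (intro m_comm) auto
      finally have "f k [^] n' = w \<otimes> (f k [^] n' \<otimes> inv w)" .
      then have "f k [^] n' \<in> L k <#> tor G" using set_mult_mem[OF w(1) t] by simp
      then show False using less.IH[OF \<open>n' < n\<close> \<open>n' > 0\<close>] by blast
    qed
  qed
  moreover have "x \<in> L k <#> tor G" if "x \<in> L k" for x k
    using set_mult_mem[OF that T.one_closed] subgroup.mem_carrier[OF L that] by simp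
  ultimately have "f k [^] n \<notin> L k" if "n > 0" for k and n :: nat
    using that by meson
  then show ?thesis
    unfolding independent_sequence_def L_def using fc by (intro conjI allI impI image_subsetI)
qed

lemma generate_finite_mod_pow:
  assumes m: "(m::nat) > 0" and R: "subgroup R G" and S: "finite S" "S \<subseteq> R"
  shows "\<exists>F. finite F \<and> F \<subseteq> R \<and> (\<forall>z\<in>generate G S. \<exists>f\<in>F. \<exists>s\<in>R. z = f \<otimes> s [^] m)"
  using S
proof (induction S)
  case empty
  show ?case
    using subgroup.one_closed[OF R] by (intro exI[of _ "{\<one>}"]) (auto simp: generate_empty intro!: bexI[of _ \<one>])
next
  case (insert a S)
  then obtain F where F: "finite F" "F \<subseteq> R" "\<And>z. z \<in> generate G S \<Longrightarrow> \<exists>f\<in>F. \<exists>s\<in>R. z = f \<otimes> s [^] m"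
    by auto
  have Rc: "R \<subseteq> carrier G" by (rule subgroup.subset[OF R])
  have a: "a \<in> R" "a \<in> carrier G" using insert Rc by auto
  define F' where "F' = (\<lambda>(f, r). f \<otimes> a [^] (r::nat)) ` (F \<times> {..<m})"
  have "finite F'" using F by (simp add: F'_def)
  moreover have "F' \<subseteq> R"
    using F a nat_pow_mem[OF R] subgroup.m_closed[OF R] by (auto simp: F'_def)
  moreover have "\<exists>f\<in>F'. \<exists>s\<in>R. z = f \<otimes> s [^] m" if "z \<in> generate G (insert a S)" for z
  proof -
    have "S \<subseteq> carrier G" using insert.prems Rc by blast
    then have "z \<in> {y \<otimes> a [^] (n::int) | y n. y \<in> generate G S}"
      using that generate_insert[OF a(2)] by blast
    then obtain y n where y: "y \<in> generate G S" "z = y \<otimes> a [^] (n::int)" by blast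
    obtain f s where fs: "f \<in> F" "s \<in> R" "y = f \<otimes> s [^] m" using F(3)[OF y(1)] by blast
    define q r where "q = n div int m" and "r = nat (n mod int m)"
    have r: "r < m" using m by (simp add: r_def nat_less_iff)
    have nq: "n = int r + q * int m" using m by (simp add: r_def q_def)
    have c: "f \<in> carrier G" "s \<in> carrier G" using fs F Rc by auto
    have "a [^] n = a [^] r \<otimes> (a [^] q) [^] m"
      unfolding nq using a by (simp add: int_pow_mult int_pow_pow flip: int_pow_int)
    then have "z = (f \<otimes> a [^] r) \<otimes> (s \<otimes> a [^] q) [^] m"
      using y fs c a by (simp add: nat_pow_distrib m_ac)
    moreover have "f \<otimes> a [^] r \<in> F'" using fs r by (force simp: F'_def)
    moreover have "s \<otimes> a [^] q \<in> R"
      using fs a by (intro subgroup.m_closed[OF R] subgroup_int_pow_closed[OF R])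
    ultimately show ?thesis by blast
  qed
  ultimately show ?case by blast
qed

text \<open>For a prime p, finitely many elements generate \<open>R\<close> modulo p
  \<open>R\<close> and torsion: otherwise a greedy sequence that avoids the earlier spans is
  independent by \<open>independent_sequence_mod_prime\<close>. Finitely many generators leave
  finitely many classes modulo p. For m = p n, the element s in r = e + p s + t is decomposed once
  more modulo n.\<close>

lemma finite_mod_pow:
  assumes no: "\<not> (\<exists>f. independent_sequence G f)" and R: "subgroup R G" and "(m::nat) > 0"
  shows "\<exists>F. finite F \<and> F \<subseteq> R \<and> (\<forall>r\<in>R. \<exists>f\<in>F. \<exists>s\<in>R. \<exists>t\<in>tor G. r = f \<otimes> s [^] m \<otimes> t)"
  using \<open>m > 0\<close>
proof (induction m rule: less_induct)
  case (less m)
  interpret T: subgroup "tor G" G by (rule subgroup_tor)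
  interpret R: subgroup R G by (rule R)
  show ?case
  proof (cases "m = 1")
    case True
    have "\<exists>f\<in>{\<one>}. \<exists>s\<in>R. \<exists>t\<in>tor G. r = f \<otimes> s [^] m \<otimes> t" if "r \<in> R" for r
      by (rule bexI[of _ \<one>], rule bexI[of _ r], rule bexI[of _ \<one>])
        (use that True T.one_closed R.mem_carrier in simp_all)
    then show ?thesis using R.one_closed by (intro exI[of _ "{\<one>}"]) simp
  next
    case False
    then obtain p where p: "prime p" "p dvd m" using prime_factor_nat by blast
    then obtain n where n: "m = p * n" by blast
    have n0: "n > 0" "n < m" using n less.prems prime_gt_1_nat[OF p(1)] by auto
    obtain F where F: "finite F" "F \<subseteq> R"
      "\<And>r. r \<in> R \<Longrightarrow> \<exists>f\<in>F. \<exists>s\<in>R. \<exists>t\<in>tor G. r = f \<otimes> s [^] n \<otimes> t"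
      using less.IH[OF n0(2) n0(1)] by auto
    have "\<exists>S. finite S \<and> S \<subseteq> R \<and>
      (\<forall>r\<in>R. r \<in> generate G S <#> {s [^] p \<otimes> t | s t. s \<in> R \<and> t \<in> tor G})"
    proof (rule ccontr)
      assume *: "\<nexists>S. finite S \<and> S \<subseteq> R \<and>
        (\<forall>r\<in>R. r \<in> generate G S <#> {s [^] p \<otimes> t | s t. s \<in> R \<and> t \<in> tor G})"
      have "\<exists>f. range f \<subseteq> R \<and> (\<forall>k::nat. f k \<notin>
          generate G (f ` {..<k}) <#> {s [^] p \<otimes> t | s t. s \<in> R \<and> t \<in> tor G})"
      proof (rule greedy_sequence[of R "\<lambda>S a. a \<notin> generate G S <#> {s [^] p \<otimes> t | s t. s \<in> R \<and> t \<in> tor G}"])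
        fix S assume "finite S" "S \<subseteq> R"
        then show "\<exists>a\<in>R. a \<notin> generate G S <#> {s [^] p \<otimes> t | s t. s \<in> R \<and> t \<in> tor G}"
          using * by meson
      qed (intro exI conjI allI)
      then obtain f :: "nat \<Rightarrow> 'a" where f: "range f \<subseteq> R"
        "\<And>k. f k \<notin> generate G (f ` {..<k}) <#> {s [^] p \<otimes> t | s t. s \<in> R \<and> t \<in> tor G}"
        by meson
      show False using independent_sequence_mod_prime[OF p(1) R f] no by metis
    qed
    then obtain S where S: "finite S" "S \<subseteq> R"
      "\<And>r. r \<in> R \<Longrightarrow> r \<in> generate G S <#> {s [^] p \<otimes> t | s t. s \<in> R \<and> t \<in> tor G}" by meson
    obtain E where E: "finite E" "E \<subseteq> R" "\<And>z. z \<in> generate G S \<Longrightarrow> \<exists>f\<in>E. \<exists>s\<in>R. z = f \<otimes> s [^] p"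
      using generate_finite_mod_pow[OF prime_gt_0_nat[OF p(1)] R S(1,2)] by auto
    define D where "D = (\<lambda>(e, f). e \<otimes> f [^] p) ` (E \<times> F)"
    have "finite D" using E F by (simp add: D_def)
    moreover have "D \<subseteq> R"
      using E(2) F(2) by (auto simp: D_def intro!: R.m_closed nat_pow_mem[OF R])
    moreover have "\<exists>d\<in>D. \<exists>s\<in>R. \<exists>t\<in>tor G. r = d \<otimes> s [^] m \<otimes> t" if rR: "r \<in> R" for r
    proof -
      obtain z s t where z: "z \<in> generate G S" "s \<in> R" "t \<in> tor G" "r = z \<otimes> (s [^] p \<otimes> t)"
        using S(3)[OF rR] unfolding set_mult_def by auto
      obtain e s' where e: "e \<in> E" "s' \<in> R" "z = e \<otimes> s' [^] p" using E(3)[OF z(1)] by auto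
      obtain f u t' where f: "f \<in> F" "u \<in> R" "t' \<in> tor G" "s' \<otimes> s = f \<otimes> u [^] n \<otimes> t'"
        using F(3)[OF R.m_closed[OF e(2) z(2)]] by auto
      have c: "e \<in> carrier G" "f \<in> carrier G" "s \<in> carrier G" "s' \<in> carrier G" "u \<in> carrier G"
        "t \<in> carrier G" "t' \<in> carrier G"
        using e f z E(2) F(2) R.subset T.subset by auto
      have "r = e \<otimes> (s' \<otimes> s) [^] p \<otimes> t" using z e c by (simp add: nat_pow_distrib m_ac)
      also have "\<dots> = (e \<otimes> f [^] p) \<otimes> u [^] m \<otimes> (t' [^] p \<otimes> t)"
        using c by (simp add: f(4) n nat_pow_distrib nat_pow_pow m_ac mult.commute)
      finally have "r = (e \<otimes> f [^] p) \<otimes> u [^] m \<otimes> (t' [^] p \<otimes> t)" .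
      moreover have "e \<otimes> f [^] p \<in> D" using e f by (force simp: D_def)
      moreover have "t' [^] p \<otimes> t \<in> tor G"
        by (rule T.m_closed[OF nat_pow_mem[OF subgroup_tor f(3)] z(3)])
      ultimately show ?thesis using f(2) by (intro bexI)
    qed
    ultimately show ?thesis by (intro exI[of _ D] conjI ballI)
  qed
qed

end

lemma (in comm_group) r_coset_eq_iff:
  assumes "subgroup N G" "x \<in> carrier G" "y \<in> carrier G"
  shows "N #> x = N #> y \<longleftrightarrow> x \<otimes> inv y \<in> N"
proof
  assume "N #> x = N #> y"
  then have "x \<in> N #> y" using rcos_self[OF assms(2,1)] by simp
  then obtain n where "n \<in> N" "x = n \<otimes> y" by (auto simp: r_coset_def)
  then show "x \<otimes> inv y \<in> N" using subgroup.mem_carrier[OF assms(1)] assms(3) by (simp add: m_assoc)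
next
  assume n: "x \<otimes> inv y \<in> N"
  have "x = (x \<otimes> inv y) \<otimes> y" using assms(2,3) by (simp add: m_assoc)
  then have "x \<in> N #> y" using n unfolding r_coset_def by blast
  then show "N #> x = N #> y" using repr_independence[OF _ assms(3,1)] by simp
qed

section \<open>Quotients by torsion subgroups\<close>

locale torsion_quotient = comm_group G + normal N G for G (structure) and N +
  assumes torsion: "N \<subseteq> tor G"
begin

sublocale Q: comm_group "G Mod N"
  by (rule abelian_FactGroup) (rule subgroup_axioms)

sublocale proj: group_hom G "G Mod N" "\<lambda>x. N #> x"
  by unfold_locales (rule r_coset_hom_Mod)

lemma carrier_Mod: "carrier (G Mod N) = (\<lambda>x. N #> x) ` carrier G"
  by (auto simp: FactGroup_def RCOSETS_def)

lemma tor_Mod: "tor (G Mod N) = (\<lambda>x. N #> x) ` tor G"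
proof
  show "(\<lambda>x. N #> x) ` tor G \<subseteq> tor (G Mod N)"
  proof
    fix X assume "X \<in> (\<lambda>x. N #> x) ` tor G"
    then obtain x and n :: nat where x: "X = N #> x" "x \<in> carrier G" "n > 0" "x [^] n = \<one>"
      by (auto simp: tor_def)
    then have "X [^]\<^bsub>G Mod N\<^esub> n = \<one>\<^bsub>G Mod N\<^esub>"
      using proj.hom_nat_pow[of x n] proj.hom_one by metis
    then show "X \<in> tor (G Mod N)" using x by (intro Q.torI[of _ n]) (auto simp: carrier_Mod)
  qed
  show "tor (G Mod N) \<subseteq> (\<lambda>x. N #> x) ` tor G"
  proof
    fix X assume "X \<in> tor (G Mod N)"
    then obtain x and n :: nat where x: "X = N #> x" "x \<in> carrier G" "n > 0"
      "X [^]\<^bsub>G Mod N\<^esub> n = \<one>\<^bsub>G Mod N\<^esub>"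
      by (auto simp: tor_def carrier_Mod)
    then have "N #> (x [^] n) = N"
      using proj.hom_nat_pow[of x n] by simp
    then have "x [^] n \<in> N" using x(2) by (metis nat_pow_closed rcos_self subgroup_axioms)
    then have "x \<in> tor G" using tor_of_pow_mem_tor[OF x(2,3)] torsion by blast
    then show "X \<in> (\<lambda>x. N #> x) ` tor G" using x by blast
  qed
qed

text \<open>Arbitrary lifts of an independent sequence are independent, because relations project.
  Conversely, a relation modulo \<open>N\<close> with multiple n of g_k fails in \<open>G\<close>
  only by a torsion element; multiplying by its order m gives a relation in \<open>G\<close> with
  multiple n m.\<close>

lemma independent_sequence_Mod_iff:
  "(\<exists>f. independent_sequence (G Mod N) f) \<longleftrightarrow> (\<exists>f. independent_sequence G f)"
proof
  assume "\<exists>f. independent_sequence (G Mod N) f"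
  then obtain f where f: "independent_sequence (G Mod N) f" by blast
  then have "\<forall>i. \<exists>x\<in>carrier G. f i = N #> x"
    by (fastforce simp: independent_sequence_def carrier_Mod)
  then obtain g where g: "\<And>i. g i \<in> carrier G" "\<And>i. f i = N #> g i" by metis
  have "g k [^] n \<notin> generate G (g ` {..<k})" if "n > 0" for k and n :: nat
  proof
    assume "g k [^] n \<in> generate G (g ` {..<k})"
    then have "N #> (g k [^] n) \<in> generate (G Mod N) ((\<lambda>x. N #> x) ` g ` {..<k})"
      using proj.generate_img[of "g ` {..<k}"] g(1) by blast
    moreover have "(\<lambda>x. N #> x) ` g ` {..<k} = f ` {..<k}" using g by auto
    moreover have "N #> (g k [^] n) = f k [^]\<^bsub>G Mod N\<^esub> n"
      using proj.hom_nat_pow[OF g(1), of k n] g(2) by simp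
    ultimately show False using f that by (auto simp: independent_sequence_def)
  qed
  then show "\<exists>f. independent_sequence G f"
    using g by (intro exI[of _ g]) (auto simp: independent_sequence_def)
next
  assume "\<exists>f. independent_sequence G f"
  then obtain g where g: "independent_sequence G g" by blast
  then have gc: "g i \<in> carrier G" for i by (auto simp: independent_sequence_def)
  have "(N #> g k) [^]\<^bsub>G Mod N\<^esub> n \<notin> generate (G Mod N) ((\<lambda>i. N #> g i) ` {..<k})"
    if "n > 0" for k and n :: nat
  proof
    assume "(N #> g k) [^]\<^bsub>G Mod N\<^esub> n \<in> generate (G Mod N) ((\<lambda>i. N #> g i) ` {..<k})"
    moreover have "(\<lambda>i. N #> g i) ` {..<k} = (\<lambda>x. N #> x) ` g ` {..<k}" by auto
    moreover have "generate (G Mod N) ((\<lambda>x. N #> x) ` g ` {..<k}) = (\<lambda>x. N #> x) ` generate G (g ` {..<k})"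
      using gc by (intro proj.generate_img) auto
    moreover have "(N #> g k) [^]\<^bsub>G Mod N\<^esub> n = N #> (g k [^] n)"
      using proj.hom_nat_pow[OF gc, of k n] by simp
    ultimately obtain z where z: "z \<in> generate G (g ` {..<k})" "N #> (g k [^] n) = N #> z"
      by auto
    have sub: "subgroup (generate G (g ` {..<k})) G" using gc by (intro generate_is_subgroup) auto
    have zc: "z \<in> carrier G" using subgroup.mem_carrier[OF sub z(1)] .
    have "g k [^] n \<otimes> inv z \<in> tor G"
      using r_coset_eq_iff[OF subgroup_axioms, of "g k [^] n" z] z(2) zc gc torsion by auto
    then obtain m :: nat where m: "m > 0" "(g k [^] n \<otimes> inv z) [^] m = \<one>" by (auto simp: tor_def)
    then have "g k [^] (n * m) \<otimes> inv (z [^] m) = \<one>"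
      using gc zc by (simp add: nat_pow_distrib nat_pow_inv nat_pow_pow)
    then have "g k [^] (n * m) = z [^] m"
      using gc zc by (metis inv_equality inv_inv inv_closed nat_pow_closed)
    then have "g k [^] (n * m) \<in> generate G (g ` {..<k})" using nat_pow_mem[OF sub z(1)] by metis
    moreover have "n * m > 0" using m that by simp
    ultimately show False using g unfolding independent_sequence_def by metis
  qed
  then show "\<exists>f. independent_sequence (G Mod N) f"
    using gc by (intro exI[of _ "\<lambda>i. N #> g i"]) (auto simp: independent_sequence_def carrier_Mod)
qed

lemma finite_Z_rank_Mod_iff: "finite_Z_rank (G Mod N) \<longleftrightarrow> \<not> (\<exists>f. independent_sequence G f)"
  using finite_Z_rank_iff[OF Q.comm_group_axioms] independent_sequence_Mod_iff by simp

end

lemma (in comm_group) torsion_free_Mod_tor: "torsion_free (G Mod tor G)"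
proof -
  interpret torsion_quotient G "tor G"
    by (intro torsion_quotient.intro torsion_quotient_axioms.intro comm_group_axioms
        subgroup_imp_normal subgroup_tor subset_refl)
  have "(\<lambda>x. tor G #> x) ` tor G = (\<lambda>x. tor G) ` tor G"
    by (rule image_cong) (simp_all add: rcos_const)
  also have "\<dots> = {tor G}" using subgroup.one_closed[OF subgroup_tor] by blast
  finally show ?thesis by (simp add: torsion_free_def tor_Mod)
qed

section \<open>Consequences of modularity\<close>

context topological_comm_group
begin

lemma m_conj_cancel: "\<lbrakk>a \<in> carrier G; b \<in> carrier G\<rbrakk> \<Longrightarrow> a \<otimes> (b \<otimes> inv a) = b"
  by (simp add: m_comm[of b] m_assoc[symmetric])

lemma closedin_finite: "\<lbrakk>finite F; F \<subseteq> carrier G\<rbrakk> \<Longrightarrow> closedin \<tau> F"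
  using closedin_Hausdorff_finite[OF Hausdorff] by simp

lemma mem_generate_singleton: "a \<in> carrier G \<Longrightarrow> x \<in> generate G {a} \<longleftrightarrow> (\<exists>k::int. x = a [^] k)"
  by (simp add: generate_pow)

lemma generate_singleton_subgroup: "a \<in> carrier G \<Longrightarrow> subgroup (generate G {a}) G"
  by (intro generate_is_subgroup) simp

text \<open>
  The three closed subgroups \<open>\<langle>m(x + y)\<rangle> + L \<subseteq> \<langle>x + y\<rangle> + L\<close> and \<open>\<langle>x\<rangle>\<close> violate the modular law: the last
  two meet trivially, but \<open>x + y\<close> lies in the closed join of the first and the last.
\<close>

lemma not_modular_if_cyclic:
  fixes m :: int
  assumes M: "subgroup M G" "openin \<tau> M"
    and x: "x \<in> carrier G" "\<And>n::int. x [^] n \<in> M \<Longrightarrow> n = 0"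
    and y: "y \<in> M" "\<And>n::int. y [^] n \<in> L \<Longrightarrow> n = 0"
    and L: "subgroup L G" "closedin \<tau> L" "L \<subseteq> M"
    and m: "m \<ge> 2" and l: "l \<in> L" "y \<otimes> inv l \<in> \<tau> closure_of generate G {y [^] m}"
  shows "\<not> topologically_modular G \<tau>"
proof
  assume mod: "topologically_modular G \<tau>"
  interpret M: subgroup M G by (rule M)
  interpret L: subgroup L G by (rule L)
  define g where "g = x \<otimes> y"
  define A where "A = generate G {g [^] m} <#> L"
  define B where "B = generate G {x}"
  define C where "C = generate G {g} <#> L"
  have yc: "y \<in> carrier G" using y M.subset by auto
  have lc: "l \<in> carrier G" using l L.subset by auto
  have gc: "g \<in> carrier G" using x yc by (simp add: g_def)
  have gk: "g [^] k = x [^] k \<otimes> y [^] k" for k :: int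
    using x yc by (simp add: g_def int_pow_distrib)
  have gen: "generate G {a} = range (\<lambda>k::int. a [^] k)" if "a \<in> carrier G" for a
    using generate_pow[OF that] by auto
  have A: "A = {g [^] (m * k) \<otimes> l | k l. l \<in> L}"
    unfolding A_def gen[OF int_pow_closed[OF gc]] set_mult_def using gc by (auto simp: int_pow_pow)
  have C: "C = {g [^] k \<otimes> l | (k::int) l. l \<in> L}"
    unfolding C_def gen[OF gc] set_mult_def by auto
  \<comment> \<open>Since \<open>y\<close> and \<open>L\<close> lie in \<open>M\<close>, only k x is
    left modulo \<open>M\<close>, and x has infinite order there. This reads off coefficients of
    x.\<close>
  have key: "k = 0" if "x [^] k \<otimes> y [^] j \<otimes> u \<in> M" "u \<in> L" for k j :: int and u
  proof (rule x(2))
    have u: "u \<in> M" "u \<in> carrier G" using that L(3) L.subset by auto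
    have yj: "y [^] j \<in> M" by (rule subgroup_int_pow_closed[OF M(1) y(1)])
    have "x [^] k \<otimes> y [^] j \<otimes> u \<otimes> inv (y [^] j \<otimes> u) \<in> M"
      by (rule M.m_closed[OF that(1) M.m_inv_closed[OF M.m_closed[OF yj u(1)]]])
    moreover have "x [^] k \<otimes> y [^] j \<otimes> u \<otimes> inv (y [^] j \<otimes> u) = x [^] k"
      using x yc u by (simp add: m_assoc)
    ultimately show "x [^] k \<in> M" by simp
  qed
  have sA: "subgroup A G" unfolding A_def
    using gc L(1) by (intro mult_subgroups generate_singleton_subgroup) auto
  have sC: "subgroup C G" unfolding C_def
    using gc L(1) by (intro mult_subgroups generate_singleton_subgroup) auto
  have sB: "subgroup B G" unfolding B_def using x by (intro generate_singleton_subgroup)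
  interpret A: subgroup A G by (rule sA)
  have LC: "L \<subseteq> C"
  proof
    fix u assume u: "u \<in> L"
    then have "u = g [^] (0::int) \<otimes> u" using L.mem_carrier by simp
    then show "u \<in> C" unfolding C using u by blast
  qed
  have LA: "L \<subseteq> A"
  proof
    fix u assume u: "u \<in> L"
    then have "u = g [^] (m * 0) \<otimes> u" using L.mem_carrier by simp
    then show "u \<in> A" unfolding A using u by blast
  qed
  have AC: "A \<subseteq> C" unfolding A C by blast
  have CM: "C \<inter> M \<subseteq> L"
  proof
    fix c assume "c \<in> C \<inter> M"
    then obtain k u where c: "c = g [^] (k::int) \<otimes> u" "u \<in> L" "c \<in> M" unfolding C by blast
    then have "k = 0" using key[of k k u] by (simp add: gk)
    then show "c \<in> L" using c L.mem_carrier by simp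
  qed
  have "C \<inter> M = L" using CM LC L(3) by blast
  moreover have "A \<inter> M = L" using CM LA L(3) AC by blast
  moreover have "B \<inter> M = {\<one>}"
  proof -
    have "b = \<one>" if "b \<in> B" "b \<in> M" for b
    proof -
      obtain k :: int where "b = x [^] k" using \<open>b \<in> B\<close> unfolding B_def gen[OF x(1)] by blast
      then show ?thesis using x(2)[of k] that by simp
    qed
    then show ?thesis using M.one_closed subgroup.one_closed[OF sB] by blast
  qed
  \<comment> \<open>The traces of \<open>A\<close>, \<open>C\<close> and \<open>B\<close> on the
    open subgroup \<open>M\<close> are \<open>L\<close>, \<open>L\<close> and the trivial
    group.\<close>
  ultimately have cA: "closedin \<tau> A" and cC: "closedin \<tau> C" and cB: "closedin \<tau> B"
    using closedin_subgroupI[OF M sA] closedin_subgroupI[OF M sC] closedin_subgroupI[OF M sB] L(2)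
      closedin_finite[of "{\<one>}"] by simp_all
  \<comment> \<open>An equation n x = k (x + y) + u forces n = k modulo \<open>M\<close>; then k y
    lies in \<open>L\<close>, and so k = 0.\<close>
  have BC: "B \<inter> C = {\<one>}"
  proof -
    have "b = \<one>" if b: "b \<in> B" "b \<in> C" for b
    proof -
      obtain n :: int where n: "b = x [^] n" using b(1) unfolding B_def gen[OF x(1)] by blast
      obtain k :: int and u where k: "b = g [^] k \<otimes> u" "u \<in> L" using b(2) unfolding C by blast
      have uc: "u \<in> carrier G" using k by simp
      have "x [^] (k - n) \<otimes> y [^] k \<otimes> u = inv (x [^] n) \<otimes> (g [^] k \<otimes> u)"
        using x yc uc by (simp add: gk int_pow_diff m_ac)
      also have "g [^] k \<otimes> u = x [^] n" using k(1) n by simp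
      also have "inv (x [^] n) \<otimes> x [^] n = \<one>" using x(1) by simp
      finally have 1: "x [^] (k - n) \<otimes> y [^] k \<otimes> u = \<one>" .
      then have "k - n = 0" using key[of "k - n" k u] k(2) M.one_closed by simp
      then have "y [^] k \<otimes> u = \<one>" using 1 yc uc by simp
      then have "y [^] k = inv u" using yc uc by (intro inv_equality[symmetric]) auto
      then have "y [^] k \<in> L" using k(2) by simp
      then have "k = 0" by (rule y(2))
      then show "b = \<one>" using n \<open>k - n = 0\<close> by simp
    qed
    then show ?thesis using subgroup.one_closed[OF sB] subgroup.one_closed[OF sC] by blast
  qed
  have "A <#> {\<one>} = A" using A.subset by (force simp: set_mult_def)
  then have "closed_join G \<tau> A (B \<inter> C) = A"
    by (simp add: closed_join_def BC closure_of_closedin[OF cA])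
  moreover have "closed_join G \<tau> A (B \<inter> C) = closed_join G \<tau> A B \<inter> C"
    using mod sA sB sC cA cB cC AC by (simp add: topologically_modular_def closed_subgroup_def)
  moreover have "g \<in> C"
  proof -
    have "g = g [^] (1::int) \<otimes> \<one>" using gc by simp
    then show ?thesis unfolding C using L.one_closed by blast
  qed
  \<comment> \<open>Since x + l + m j y = (m j (x + y) + l) + (1 - m j) x, the sum of
    \<open>A\<close> and \<open>B\<close> contains x + l + <m y>. Its closure therefore contains x +
    l + (y - l) = g.\<close>
  moreover have "g \<in> closed_join G \<tau> A B"
  proof -
    let ?\<phi> = "\<lambda>u. (x \<otimes> l) \<otimes> u"
    have "?\<phi> ` generate G {y [^] m} \<subseteq> A <#> B"
    proof
      fix v assume "v \<in> ?\<phi> ` generate G {y [^] m}"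
      then obtain j :: int where v: "v = x \<otimes> l \<otimes> y [^] (m * j)"
        using yc by (auto simp: gen int_pow_pow)
      have "v = (g [^] (m * j) \<otimes> l) \<otimes> x [^] (1 - m * j)"
        unfolding v gk using x yc lc by (simp add: int_pow_diff m_ac m_conj_cancel)
      moreover have "g [^] (m * j) \<otimes> l \<in> A" unfolding A using l by blast
      moreover have "x [^] (1 - m * j) \<in> B" unfolding B_def gen[OF x(1)] by blast
      ultimately show "v \<in> A <#> B" using set_mult_mem by simp
    qed
    then have "\<tau> closure_of (?\<phi> ` generate G {y [^] m}) \<subseteq> closed_join G \<tau> A B"
      unfolding closed_join_def by (rule closure_of_mono)
    moreover have "?\<phi> ` (\<tau> closure_of generate G {y [^] m}) \<subseteq> \<tau> closure_of (?\<phi> ` generate G {y [^] m})"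
      using x lc by (intro continuous_map_image_closure_subset continuous_translation) auto
    ultimately have "?\<phi> (y \<otimes> inv l) \<in> closed_join G \<tau> A B" using l(2) by blast
    moreover have "?\<phi> (y \<otimes> inv l) = g" using x yc lc by (simp add: g_def m_assoc m_conj_cancel)
    ultimately show ?thesis by simp
  qed
  \<comment> \<open>Comparing coefficients of x modulo \<open>M\<close> would give 1 = m j, which is
    impossible for m \<ge> 2.\<close>
  moreover have "g \<notin> A"
  proof
    assume "g \<in> A"
    then obtain j u where u: "g = g [^] (m * j) \<otimes> u" "u \<in> L" unfolding A by blast
    have uc: "u \<in> carrier G" using u by simp
    have "g [^] (1 - m * j) = u"
    proof -
      have "g [^] (1 - m * j) = inv (g [^] (m * j)) \<otimes> g" using gc by (simp add: int_pow_diff m_comm)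
      also have "\<dots> = inv (g [^] (m * j)) \<otimes> (g [^] (m * j) \<otimes> u)" using u(1) by simp
      also have "\<dots> = u" using gc uc by (simp add: m_assoc[symmetric])
      finally show ?thesis .
    qed
    then have "x [^] (1 - m * j) \<otimes> y [^] (1 - m * j) \<otimes> \<one> \<in> M"
      using u(2) L(3) x yc by (simp add: gk[symmetric]) blast
    then have "1 - m * j = 0" using key[of "1 - m * j" _ \<one>] L.one_closed by blast
    then have "m dvd 1" by (intro dvdI[of _ _ j]) simp
    then show False using m by simp
  qed
  ultimately show False by blast
qed

text \<open>The subgroup <x> + \<open>M\<close> is the union of the translates of \<open>M\<close>
  by i x with 0 \<le> i < |n|, hence compact. Contrapositively, an element outside comp(G) has
  infinite order modulo every compact subgroup.\<close>

lemma mem_compact_part_of_pow: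
  assumes M: "subgroup M G" "compactin \<tau> M" and x: "x \<in> carrier G"
    and n: "n \<noteq> (0::int)" "x [^] n \<in> M"
  shows "x \<in> compact_part G \<tau>"
proof -
  interpret M: subgroup M G by (rule M)
  define F where "F = (\<lambda>i. x [^] (i::int)) ` {0..<\<bar>n\<bar>}"
  define H where "H = generate G {x} <#> M"
  have absn: "x [^] \<bar>n\<bar> \<in> M"
    using n x subgroup_int_pow_closed[OF M(1) n(2), of "sgn n"] by (simp add: int_pow_pow abs_sgn)
  have Fc: "F \<subseteq> carrier G" using x by (auto simp: F_def)
  have H: "subgroup H G" unfolding H_def
    using x M(1) by (intro mult_subgroups generate_singleton_subgroup)
  have "H = F <#> M"
  proof
    show "F <#> M \<subseteq> H"
      unfolding H_def using x by (intro mono_set_mult) (auto simp: F_def mem_generate_singleton)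
    show "H \<subseteq> F <#> M"
    proof
      fix h assume "h \<in> H"
      then obtain k :: int and u where h: "h = x [^] k \<otimes> u" "u \<in> M"
        using x by (auto simp: H_def set_mult_def mem_generate_singleton)
      define r q where "r = k mod \<bar>n\<bar>" and "q = k div \<bar>n\<bar>"
      have "k = r + \<bar>n\<bar> * q" by (simp add: r_def q_def)
      then have "h = x [^] r \<otimes> ((x [^] \<bar>n\<bar>) [^] q \<otimes> u)"
        using h x M.mem_carrier[OF h(2)] by (simp add: int_pow_mult int_pow_pow m_assoc)
      moreover have "x [^] r \<in> F" using n by (auto simp: F_def r_def)
      moreover have "(x [^] \<bar>n\<bar>) [^] q \<otimes> u \<in> M"
        by (rule M.m_closed[OF subgroup_int_pow_closed[OF M(1) absn] h(2)])
      ultimately show "h \<in> F <#> M" using set_mult_mem by simp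
    qed
  qed
  moreover have "compactin \<tau> F" using Fc by (intro finite_imp_compactin) (auto simp: F_def)
  ultimately have "compactin \<tau> H" using compactin_set_mult M(2) by simp
  moreover have "x \<in> H"
  proof -
    have "x \<in> generate G {x}" by (rule generate.incl) simp
    from set_mult_mem[OF this M.one_closed] show ?thesis using x by (simp add: H_def)
  qed
  ultimately show ?thesis using H by (auto simp: compact_part_def)
qed

lemma tor_subset_compact_part: "tor G \<subseteq> compact_part G \<tau>"
proof
  fix x assume "x \<in> tor G"
  then obtain n :: nat where x: "x \<in> carrier G" "n > 0" "x [^] n = \<one>" by (auto simp: tor_def)
  have "compactin \<tau> {\<one>}" by (intro finite_imp_compactin) auto
  then show "x \<in> compact_part G \<tau>"
    using x by (intro mem_compact_part_of_pow[OF triv_subgroup, of x "int n"]) (auto simp: int_pow_int)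
qed

text \<open>
  For \<open>y\<close> of infinite order in a compact subgroup, either \<open>2\<^sup>a y \<in> cl \<langle>2\<^bsup>a+1\<^esup> y\<rangle>\<close> for some \<open>a\<close>, or no
  nonzero multiple of \<open>y\<close> lies in \<open>L = \<Inter>\<^sub>n cl \<langle>2\<^sup>n y\<rangle>\<close>, while \<open>y \<in> L + cl \<langle>3 y\<rangle>\<close> by compactness
  because \<open>3 | 4\<^sup>n - 1\<close>.
\<close>

lemma compact_part_subset_tor:
  assumes mod: "topologically_modular G \<tau>"
    and U: "subgroup U G" "openin \<tau> U" "compactin \<tau> U"
    and x: "x \<in> carrier G" "x \<notin> compact_part G \<tau>"
  shows "compact_part G \<tau> \<subseteq> tor G"
proof
  fix y assume "y \<in> compact_part G \<tau>"
  then obtain K where K: "subgroup K G" "compactin \<tau> K" "y \<in> K" by (auto simp: compact_part_def)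
  have yc: "y \<in> carrier G" using subgroup.mem_carrier[OF K(1,3)] .
  \<comment> \<open>A compact open subgroup that contains y; x has infinite order modulo it.\<close>
  define M where "M = K <#> U"
  have sM: "subgroup M G" unfolding M_def by (rule mult_subgroups[OF K(1) U(1)])
  have kM: "compactin \<tau> M" unfolding M_def by (rule compactin_set_mult[OF K(2) U(3)])
  have UM: "U \<subseteq> M"
  proof
    fix u assume "u \<in> U"
    with set_mult_mem[OF subgroup.one_closed[OF K(1)] this] show "u \<in> M"
      using subgroup.mem_carrier[OF U(1)] by (simp add: M_def)
  qed
  have KM: "K \<subseteq> M"
  proof
    fix u assume "u \<in> K"
    with set_mult_mem[OF this subgroup.one_closed[OF U(1)]] show "u \<in> M"
      using subgroup.mem_carrier[OF K(1)] by (simp add: M_def)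
  qed
  have oM: "openin \<tau> M" by (rule openin_subgroupI[OF sM U(2) subgroup.one_closed[OF U(1)] UM])
  have xM: "n = 0" if "x [^] (n::int) \<in> M" for n
  proof (rule ccontr)
    assume "n \<noteq> 0"
    then show False using mem_compact_part_of_pow[OF sM kM x(1) _ that] x(2) by simp
  qed
  show "y \<in> tor G"
  proof (rule ccontr)
    assume "y \<notin> tor G"
    have yn: "n = 0" if "y [^] (n::int) = \<one>" for n
    proof (rule ccontr)
      assume "n \<noteq> 0"
      have "y [^] \<bar>n\<bar> = (y [^] n) [^] sgn n" using yc by (simp add: int_pow_pow abs_sgn)
      then have "y [^] int (nat \<bar>n\<bar>) = \<one>" using that by simp
      then have "y [^] nat \<bar>n\<bar> = \<one>" unfolding int_pow_int .
      then have "y \<in> tor G" using yc \<open>n \<noteq> 0\<close> by (intro torI[of _ "nat \<bar>n\<bar>"]) simp_all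
      then show False using \<open>y \<notin> tor G\<close> by blast
    qed
    define Z where "Z n = \<tau> closure_of generate G {y [^] (2 ^ n :: int)}" for n :: nat
    have cK: "closedin \<tau> K" by (rule compactin_closedin[OF K(2)])
    have ypc: "y [^] (k::int) \<in> carrier G" for k using yc by simp
    have ZK: "Z n \<subseteq> K" for n
      unfolding Z_def using K yc
      by (intro closure_of_minimal[OF _ cK] generate_subgroup_incl[OF _ K(1)])
        (simp add: subgroup_int_pow_closed)
    have Zs: "subgroup (Z n) G" for n
      unfolding Z_def by (rule subgroup_closure_of[OF generate_singleton_subgroup[OF ypc]])
    have genZ: "generate G {y [^] (2 ^ n :: int)} \<subseteq> Z n" for n
      unfolding Z_def
      using closure_of_subset[of "generate G {y [^] (2 ^ n :: int)}" \<tau>]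
        subgroup.subset[OF generate_singleton_subgroup[OF ypc]] by simp
    show False
    proof (cases "\<exists>a. y [^] (2 ^ a :: int) \<in> Z (Suc a)")
      case True
      then obtain a where a: "y [^] (2 ^ a :: int) \<in> Z (Suc a)" by blast
      \<comment> \<open>Here 2^a y takes the place of y, with \<open>L\<close> and l trivial and m =
        2, because it is a limit of multiples of its own double.\<close>
      have "\<not> topologically_modular G \<tau>"
      proof (rule not_modular_if_cyclic[OF sM oM x(1) xM, of "y [^] (2 ^ a :: int)" "{\<one>}" 2 \<one>])
        show "y [^] (2 ^ a :: int) \<in> M" using KM ZK a by blast
        show "n = 0" if "(y [^] (2 ^ a :: int)) [^] (n::int) \<in> {\<one>}" for n
          using yn[of "2 ^ a * n"] that yc by (simp add: int_pow_pow)
        show "subgroup {\<one>} G" by (rule triv_subgroup)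
        show "closedin \<tau> {\<one>}" by (intro closedin_finite) auto
        show "{\<one>} \<subseteq> M" using subgroup.one_closed[OF sM] by simp
        show "y [^] (2 ^ a :: int) \<otimes> inv \<one> \<in> \<tau> closure_of generate G {(y [^] (2 ^ a :: int)) [^] (2::int)}"
          using a yc by (simp add: Z_def int_pow_pow mult.commute)
      qed auto
      then show False using mod by blast
    next
      case False
      define L where "L = (\<Inter>n. Z n)"
      have Ls: "subgroup L G" unfolding L_def using Zs by (intro subgroups_Inter) auto
      have Lc: "closedin \<tau> L" unfolding L_def by (intro closedin_INT) (auto simp: Z_def)
      have LM: "L \<subseteq> M" unfolding L_def using ZK KM by blast
      \<comment> \<open>Write n = 2^a (2 c + 1). If n y lay in \<open>L\<close>, subtracting the
        multiple c of 2^(a+1) y inside \<open>Z (Suc a)\<close> would leave 2^a y there, which this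
        case excludes.\<close>
      have yL: "n = 0" if n: "y [^] (n::int) \<in> L" for n
      proof (rule ccontr)
        assume n0: "n \<noteq> 0"
        obtain b where ab: "n = 2 ^ multiplicity 2 n * b" "odd b"
          using multiplicity_decompose'[OF n0, of 2] by force
        define a where "a = multiplicity 2 n"
        note ab = ab[folded a_def]
        then obtain c where c: "b = 2 * c + 1" by (auto elim: oddE)
        have "y [^] (2 ^ a :: int) = y [^] n \<otimes> inv ((y [^] (2 ^ Suc a :: int)) [^] c)"
          using yc by (simp add: ab c int_pow_pow algebra_simps flip: int_pow_diff)
        moreover have "y [^] n \<in> Z (Suc a)" using n by (auto simp: L_def)
        moreover have "(y [^] (2 ^ Suc a :: int)) [^] c \<in> Z (Suc a)"
          using genZ[of "Suc a"] mem_generate_singleton[OF ypc] by blast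
        ultimately have "y [^] (2 ^ a :: int) \<in> Z (Suc a)"
          using subgroup.m_closed[OF Zs] subgroup.m_inv_closed[OF Zs] by simp
        then show False using False by blast
      qed
      define E where "E = \<tau> closure_of generate G {y [^] (3::int)}"
      define S where "S n = {l \<in> Z n. y \<otimes> inv l \<in> E}" for n
      have "\<Inter> (range S) \<noteq> {}"
      proof (rule compact_space_imp_nest[of "subtopology \<tau> K"])
        show "compact_space (subtopology \<tau> K)" using K(2) by (simp add: compact_space_subtopology)
        show "closedin (subtopology \<tau> K) (S n)" for n
        proof -
          have "continuous_map \<tau> \<tau> (\<lambda>l. y \<otimes> inv l)"
            using yc by (intro continuous_map_mult continuous_inv) auto
          then have "closedin \<tau> {l \<in> topspace \<tau>. y \<otimes> inv l \<in> E}"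
            by (rule closedin_continuous_map_preimage) (simp add: E_def)
          then have "closedin \<tau> (Z n \<inter> {l \<in> topspace \<tau>. y \<otimes> inv l \<in> E})"
            by (intro closedin_Int) (simp add: Z_def)
          moreover have "Z n \<inter> {l \<in> topspace \<tau>. y \<otimes> inv l \<in> E} = S n"
            using subgroup.subset[OF Zs[of n]] by (auto simp: S_def)
          moreover have "S n \<subseteq> K" using ZK by (auto simp: S_def)
          ultimately show ?thesis using closedin_subset_topspace by metis
        qed
        \<comment> \<open>The witness is 4^n y. It is a multiple of 2^n y, and 4^n, unlike 2^n, is 1
          modulo 3 for every n, so that y - 4^n y is a multiple of 3 y.\<close>
        show "S n \<noteq> {}" for n
        proof -
          have "(4::int) ^ n = 2 ^ n * 2 ^ n" by (simp flip: power_mult_distrib)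
          then have "y [^] (4 ^ n :: int) = (y [^] (2 ^ n :: int)) [^] (2 ^ n :: int)"
            using yc by (simp add: int_pow_pow)
          then have 1: "y [^] (4 ^ n :: int) \<in> Z n"
            using genZ[of n] mem_generate_singleton[OF ypc] by blast
          have "(3::int) dvd 1 - 4 ^ n"
          proof (induction n)
            case (Suc n)
            have "1 - 4 ^ Suc n = 4 * (1 - 4 ^ n) - (3::int)" by simp
            then show ?case using Suc by (metis dvd_diff dvd_mult dvd_refl)
          qed simp
          then obtain j :: int where j: "1 - 4 ^ n = 3 * j" by blast
          have "y \<otimes> inv (y [^] (4 ^ n :: int)) = y [^] (1 - 4 ^ n :: int)"
            using yc by (simp add: int_pow_diff)
          also have "\<dots> = (y [^] (3::int)) [^] j" unfolding j using yc by (simp add: int_pow_pow)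
          also have "\<dots> \<in> generate G {y [^] (3::int)}" using mem_generate_singleton[OF ypc] by blast
          also have "\<dots> \<subseteq> E"
            unfolding E_def
            using closure_of_subset[of "generate G {y [^] (3 :: int)}" \<tau>]
              subgroup.subset[OF generate_singleton_subgroup[OF ypc]] by simp
          finally show ?thesis using 1 by (auto simp: S_def)
        qed
        have "Z (Suc n) \<subseteq> Z n" for n
          unfolding Z_def
        proof (rule closure_of_mono, rule generate_subgroup_incl[OF _ generate_singleton_subgroup[OF ypc]])
          have "y [^] (2 ^ Suc n :: int) = (y [^] (2 ^ n :: int)) [^] (2::int)"
            using yc by (simp add: int_pow_pow mult.commute)
          then show "{y [^] (2 ^ Suc n :: int)} \<subseteq> generate G {y [^] (2 ^ n :: int)}"
            using mem_generate_singleton[OF ypc] by blast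
        qed
        then show "antimono_on UNIV S" by (intro decseq_SucI) (auto simp: S_def)
      qed
      then obtain l where l: "\<And>n. l \<in> S n" by blast
      have "\<not> topologically_modular G \<tau>"
      proof (rule not_modular_if_cyclic[OF sM oM x(1) xM, of y L 3 l])
        show "y \<in> M" using K KM by blast
        show "n = 0" if "y [^] (n::int) \<in> L" for n by (rule yL[OF that])
        show "l \<in> L" using l by (simp add: L_def S_def)
        show "y \<otimes> inv l \<in> \<tau> closure_of generate G {y [^] (3::int)}"
          using l by (simp add: S_def E_def)
      qed (use Ls Lc LM in auto)
      then show False using mod by blast
    qed
  qed
qed

end

section \<open>Countable subgroups, graphs of homomorphisms and infinite rank\<close>

lemma (in group) countable_generate:
  assumes "countable S" "S \<subseteq> carrier G"
  shows "countable (generate G S)"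
proof -
  let ?A = "S \<union> (\<lambda>x. inv x) ` S"
  let ?p = "\<lambda>l. foldr (\<otimes>) l \<one>"
  have A: "?A \<subseteq> carrier G" using assms(2) by auto
  have cl: "?p l \<in> carrier G" if "l \<in> lists ?A" for l
    using that A by induction auto
  have app: "?p (k @ l) = ?p k \<otimes> ?p l" if "k \<in> lists ?A" "l \<in> lists ?A" for k l
    using that(1)
  proof induction
    case Nil
    then show ?case using cl[OF that(2)] by simp
  next
    case (Cons a k)
    then have "a \<in> carrier G" using A by blast
    then show ?case using Cons.IH cl[OF Cons.hyps(2)] cl[OF that(2)] by (simp add: m_assoc)
  qed
  have "x \<in> ?p ` lists ?A" if "x \<in> generate G S" for x
    using that
  proof induction
    case one
    then show ?case by (intro image_eqI[of _ _ "[]"]) auto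
  next
    case (incl h)
    then show ?case using assms(2) by (intro image_eqI[of _ _ "[h]"]) auto
  next
    case (inv h)
    then show ?case using assms(2) by (intro image_eqI[of _ _ "[inv h]"]) auto
  next
    case (eng x y)
    then obtain k l where "k \<in> lists ?A" "l \<in> lists ?A" "x = ?p k" "y = ?p l" by blast
    then show ?case using app by (intro image_eqI[of _ _ "k @ l"]) auto
  qed
  then have "generate G S \<subseteq> ?p ` lists ?A" by (rule subsetI)
  moreover have "countable (?p ` lists ?A)" using assms(1) by simp
  ultimately show ?thesis by (rule countable_subset)
qed

context comm_group
begin

lemma independent_sequence_int_pow:
  assumes "independent_sequence G f" "f k [^] (n::int) \<in> generate G (f ` {..<k})"
  shows "n = 0"
proof (rule ccontr)
  assume n: "n \<noteq> 0"
  have f: "f i \<in> carrier G" for i using assms(1) by (auto simp: independent_sequence_def)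
  have sub: "subgroup (generate G (f ` {..<k})) G" using f by (intro generate_is_subgroup) auto
  have "f k [^] \<bar>n\<bar> = (f k [^] n) [^] sgn n" using f by (simp add: int_pow_pow abs_sgn)
  then have "f k [^] int (nat \<bar>n\<bar>) = (f k [^] n) [^] sgn n" by simp
  then have "f k [^] nat \<bar>n\<bar> = (f k [^] n) [^] sgn n" unfolding int_pow_int .
  also have "\<dots> \<in> generate G (f ` {..<k})" by (rule subgroup_int_pow_closed[OF sub assms(2)])
  finally have "f k [^] nat \<bar>n\<bar> \<in> generate G (f ` {..<k})" .
  moreover have "nat \<bar>n\<bar> > 0" using n by simp
  ultimately show False using assms(1) unfolding independent_sequence_def by blast
qed

lemma generate_range_nat:
  assumes "x \<in> generate G (range f)"
  shows "\<exists>k::nat. x \<in> generate G (f ` {..<k})"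
  using assms
proof induction
  case one
  then show ?case using generate.one by metis
next
  case (incl h)
  then obtain i where "h = f i" by blast
  then have "h \<in> f ` {..<Suc i}" by simp
  then show ?case using generate.incl by metis
next
  case (inv h)
  then obtain i where "h = f i" by blast
  then have "h \<in> f ` {..<Suc i}" by simp
  then show ?case using generate.inv by metis
next
  case (eng x y)
  obtain k where k: "x \<in> generate G (f ` {..<k})" using eng.IH(1) by (rule exE)
  obtain l where l: "y \<in> generate G (f ` {..<l})" using eng.IH(2) by (rule exE)
  have mono: "generate G (f ` {..<i}) \<subseteq> generate G (f ` {..<max k l})" if "i \<le> max k l" for i
    by (rule mono_generate, rule image_mono) (use that in simp)
  have "x \<in> generate G (f ` {..<max k l})" using mono[of k] k by (simp add: subsetD)
  moreover have "y \<in> generate G (f ` {..<max k l})" using mono[of l] l by (simp add: subsetD)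
  ultimately have "x \<otimes> y \<in> generate G (f ` {..<max k l})" by (rule generate.eng)
  then show ?case by (rule exI)
qed

lemma finite_generate_torsion:
  assumes "x \<in> tor G"
  shows "finite (generate G {x})"
proof -
  obtain n :: nat where x: "x \<in> carrier G" "n > 0" "x [^] n = \<one>" using assms by (auto simp: tor_def)
  have "x [^] (k::int) \<in> (\<lambda>i. x [^] i) ` {0..<int n}" for k
  proof -
    have "k = int n * (k div int n) + k mod int n" by simp
    then have "x [^] k = (x [^] int n) [^] (k div int n) \<otimes> x [^] (k mod int n)"
      using x by (metis int_pow_mult int_pow_pow)
    then have "x [^] k = x [^] (k mod int n)" using x by (simp add: int_pow_int)
    then show ?thesis using x(2) by (intro image_eqI[of _ _ "k mod int n"]) auto
  qed
  then have "generate G {x} \<subseteq> (\<lambda>i. x [^] i) ` {0..<int n}"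
    using generate_pow[OF x(1)] by auto
  then show ?thesis by (rule finite_subset) simp
qed

lemma comm_group_square: "comm_group (G \<times>\<times> G)"
  by (rule group.group_comm_groupI[OF DirProd_group[OF is_group is_group]]) (auto simp: m_comm)

lemma group_hom_fst: "group_hom (G \<times>\<times> G) G fst"
  using comm_group_square is_group
  by (intro group_hom.intro group_hom_axioms.intro) (auto simp: hom_def comm_group_def)

lemma group_hom_snd: "group_hom (G \<times>\<times> G) G snd"
  using comm_group_square is_group
  by (intro group_hom.intro group_hom_axioms.intro) (auto simp: hom_def comm_group_def)

text \<open>The pairs (f_i, d_i) span the graph of the homomorphism that sends f_i to d_i; as a
  subgroup of the square of \<open>G\<close> it is available without constructing this map. If b = z
  + n f_k is killed by N, then n N f_k lies in the span of the earlier terms, so n = 0. In this way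
  all coefficients vanish, from the last to the first.\<close>

lemma independent_graph:
  assumes f: "independent_sequence G f" and d: "range d \<subseteq> carrier G"
    and bu: "(b, u) \<in> generate (G \<times>\<times> G) (range (\<lambda>i. (f i, d i)))" and b: "b \<in> tor G"
  shows "b = \<one> \<and> u = \<one>"
proof -
  interpret square: comm_group "G \<times>\<times> G" by (rule comm_group_square)
  interpret square_fst: group_hom "G \<times>\<times> G" G fst by (rule group_hom_fst)
  define h where "h = (\<lambda>i. (f i, d i))"
  have fc: "f i \<in> carrier G" for i using f by (auto simp: independent_sequence_def)
  have hc: "h i \<in> carrier (G \<times>\<times> G)" for i using d fc by (auto simp: h_def)
  have "b = \<one> \<and> u = \<one>" if "(b, u) \<in> generate (G \<times>\<times> G) (h ` {..<k})" "b \<in> tor G" for b u k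
    using that
  proof (induction k arbitrary: b u)
    case 0
    then show ?case by (simp add: square.generate_empty)
  next
    case (Suc k)
    have hk: "h ` {..<k} \<subseteq> carrier (G \<times>\<times> G)" using hc by blast
    have "(b, u) \<in> {z \<otimes>\<^bsub>G \<times>\<times> G\<^esub> h k [^]\<^bsub>G \<times>\<times> G\<^esub> (n::int) | z n. z \<in> generate (G \<times>\<times> G) (h ` {..<k})}"
      using Suc.prems(1) square.generate_insert[OF hc hk] by (simp add: lessThan_Suc)
    then obtain z and n :: int where zn: "(b, u) = z \<otimes>\<^bsub>G \<times>\<times> G\<^esub> h k [^]\<^bsub>G \<times>\<times> G\<^esub> n"
      "z \<in> generate (G \<times>\<times> G) (h ` {..<k})" by blast
    have zc: "z \<in> carrier (G \<times>\<times> G)" by (rule square.generate_in_carrier[OF hk zn(2)])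
    then have zc': "fst z \<in> carrier G" by auto
    have "fst z \<in> fst ` generate (G \<times>\<times> G) (h ` {..<k})" using zn(2) by (rule imageI)
    also have "\<dots> = generate G (fst ` h ` {..<k})" by (rule square_fst.generate_img[symmetric, OF hk])
    also have "fst ` h ` {..<k} = f ` {..<k}" by (auto simp: h_def image_image)
    finally have fz: "fst z \<in> generate G (f ` {..<k})" .
    have sub: "subgroup (generate G (f ` {..<k})) G" using fc by (intro generate_is_subgroup) auto
    have "fst (h k [^]\<^bsub>G \<times>\<times> G\<^esub> n) = f k [^] n"
      using square_fst.hom_int_pow[OF hc, of k n] by (simp add: h_def)
    then have bz: "b = fst z \<otimes> f k [^] n" using zn(1) by (metis fst_conv mult_DirProd')
    obtain N :: nat where N: "N > 0" "b [^] N = \<one>" using Suc.prems(2) by (auto simp: tor_def)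
    have "(f k [^] n) [^] N \<otimes> fst z [^] N = \<one>"
      using zc' fc N(2) by (simp add: bz nat_pow_distrib m_comm)
    then have "inv (fst z [^] N) = (f k [^] n) [^] N"
      using zc' fc by (intro inv_equality) simp_all
    then have "(f k [^] n) [^] N = inv (fst z [^] N)" by (rule sym)
    moreover have "(f k [^] n) [^] N = f k [^] (n * int N)"
      using fc by (simp add: int_pow_pow flip: int_pow_int)
    moreover have "inv (fst z [^] N) \<in> generate G (f ` {..<k})"
      by (rule subgroup.m_inv_closed[OF sub nat_pow_mem[OF sub fz]])
    ultimately have "f k [^] (n * int N) \<in> generate G (f ` {..<k})" by simp
    then have "n * int N = 0" by (rule independent_sequence_int_pow[OF f])
    then have "n = 0" using N(1) by simp
    then have "z = (b, u)" using zn(1) square.r_one[OF zc] by (simp add: int_pow_def2)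
    then show ?case using Suc.IH[of b u] zn(2) Suc.prems(2) by blast
  qed
  moreover obtain k where "(b, u) \<in> generate (G \<times>\<times> G) (h ` {..<k})"
    using square.generate_range_nat bu unfolding h_def by blast
  ultimately show ?thesis using b by blast
qed

end

context topological_comm_group
begin

text \<open>
  Let \<open>\<Gamma>\<close> be the graph of a homomorphism from \<open>B = fst ` \<Gamma>\<close> to \<open>T\<close>, where \<open>B \<inter> T = 0\<close>, and let \<open>y\<close> be in the closure
  of its image but not in the image. Then \<open>A = {b + u | (b, u) \<in> \<Gamma>}\<close>, \<open>B\<close> and \<open>C = A + \<langle>y\<rangle>\<close> violate the
  modular law.
\<close>

lemma not_modular_if_graph:
  assumes T: "subgroup T G" "openin \<tau> T"
    and \<Gamma>: "subgroup \<Gamma> (G \<times>\<times> G)" "\<Gamma> \<subseteq> carrier G \<times> T"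
    and triv: "\<And>b u. (b, u) \<in> \<Gamma> \<Longrightarrow> b \<in> T \<Longrightarrow> b = \<one> \<and> u = \<one>"
    and y: "y \<in> T" "y \<in> \<tau> closure_of (snd ` \<Gamma>)" "y \<notin> snd ` \<Gamma>" and fin: "finite (generate G {y})"
  shows "\<not> topologically_modular G \<tau>"
proof
  assume mod: "topologically_modular G \<tau>"
  interpret square: comm_group "G \<times>\<times> G" by (rule comm_group_square)
  interpret square_fst: group_hom "G \<times>\<times> G" G fst by (rule group_hom_fst)
  interpret square_snd: group_hom "G \<times>\<times> G" G snd by (rule group_hom_snd)
  interpret T: subgroup T G by (rule T)
  define A where "A = (\<lambda>(b, u). b \<otimes> u) ` \<Gamma>"
  define B where "B = fst ` \<Gamma>"
  define D where "D = snd ` \<Gamma>"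
  define Y where "Y = generate G {y}"
  define C where "C = A <#> Y"
  \<comment> \<open>A closed upper bound for the left side of the modular law: an element of
    \<open>B\<close> that lies in \<open>C\<close> can use only those elements of <y> that are
    values of the homomorphism, and y is none of them.\<close>
  define E where "E = A <#> (D \<inter> Y)"
  have yc: "y \<in> carrier G" using y(1) by simp
  have \<Gamma>c: "b \<in> carrier G" "u \<in> carrier G" "u \<in> T" if "(b, u) \<in> \<Gamma>" for b u
    using that \<Gamma>(2) T.mem_carrier by auto
  have \<Gamma>m: "(b \<otimes> b', u \<otimes> u') \<in> \<Gamma>" if "(b, u) \<in> \<Gamma>" "(b', u') \<in> \<Gamma>" for b u b' u'
    using subgroup.m_closed[OF \<Gamma>(1) that] by simp
  have \<Gamma>i: "(inv b, inv u) \<in> \<Gamma>" if "(b, u) \<in> \<Gamma>" for b u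
    using subgroup.m_inv_closed[OF \<Gamma>(1) that] \<Gamma>c[OF that] is_group by simp
  have AI: "b \<otimes> u \<in> A" if "(b, u) \<in> \<Gamma>" for b u
    using that unfolding A_def by force
  have AE: "\<exists>b u. (b, u) \<in> \<Gamma> \<and> a = b \<otimes> u" if "a \<in> A" for a
    using that unfolding A_def by force
  have "(\<lambda>(b, u). b \<otimes> u) \<in> hom (G \<times>\<times> G) G" by (auto simp: hom_def m_ac)
  then interpret add: group_hom "G \<times>\<times> G" G "\<lambda>(b, u). b \<otimes> u" by unfold_locales
  have sA: "subgroup A G" unfolding A_def by (rule add.subgroup_img_is_subgroup[OF \<Gamma>(1)])
  have sB: "subgroup B G" unfolding B_def by (rule square_fst.subgroup_img_is_subgroup[OF \<Gamma>(1)])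
  have sD: "subgroup D G" unfolding D_def by (rule square_snd.subgroup_img_is_subgroup[OF \<Gamma>(1)])
  have sY: "subgroup Y G" unfolding Y_def by (rule generate_singleton_subgroup[OF yc])
  have sDY: "subgroup (D \<inter> Y) G" by (rule subgroups_Inter_pair[OF sD sY])
  have sC: "subgroup C G" unfolding C_def by (rule mult_subgroups[OF sA sY])
  have sE: "subgroup E G" unfolding E_def by (rule mult_subgroups[OF sA sDY])
  have YT: "Y \<subseteq> T" unfolding Y_def using y(1) by (intro generate_subgroup_incl[OF _ T(1)]) simp
  have AT: "a = \<one>" if aA: "a \<in> A" and aT: "a \<in> T" for a
  proof -
    obtain b u where bu: "(b, u) \<in> \<Gamma>" "a = b \<otimes> u" using AE[OF aA] by blast
    have "b = a \<otimes> inv u" using bu \<Gamma>c[OF bu(1)] by (simp add: m_assoc)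
    then have "b \<in> T" using aT \<Gamma>c[OF bu(1)] by simp
    then have "b = \<one> \<and> u = \<one>" by (rule triv[OF bu(1)])
    then show ?thesis using bu(2) by simp
  qed
  have BT: "b = \<one>" if "b \<in> B" "b \<in> T" for b
    using that triv unfolding B_def by auto
  \<comment> \<open>As \<open>A\<close> meets \<open>T\<close> trivially, adding a subgroup of the
    finite group \<open>Y\<close> to \<open>A\<close> leaves a finite trace on \<open>T\<close>;
    this makes \<open>C\<close> and \<open>E\<close> closed.\<close>
  have AYT: "x \<in> Z" if xA: "x \<in> A <#> Z" and xT: "x \<in> T" and ZY: "Z \<subseteq> Y" for x Z
  proof -
    obtain a z where az: "a \<in> A" "z \<in> Z" "x = a \<otimes> z" using xA by (auto simp: set_mult_def)
    have z: "z \<in> T" using az ZY YT by blast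
    have ac: "a \<in> carrier G" by (rule subgroup.mem_carrier[OF sA az(1)])
    have "a = x \<otimes> inv z" using az(3) ac T.mem_carrier[OF z] by (simp add: m_assoc)
    then have "a \<in> T" using xT z by simp
    then have "a = \<one>" by (rule AT[OF az(1)])
    then show ?thesis using az T.mem_carrier[OF z] by simp
  qed
  have finT: "closedin \<tau> H" if H: "subgroup H G" "H \<inter> T \<subseteq> Y" for H
  proof (rule closedin_subgroupI[OF T H(1)])
    have "finite (H \<inter> T)" using H(2) fin unfolding Y_def by (rule finite_subset)
    then show "closedin \<tau> (H \<inter> T)" by (rule closedin_finite) (use T.subset in blast)
  qed
  have oneY: "\<one> \<in> Y" by (rule subgroup.one_closed[OF sY])
  have cA: "closedin \<tau> A" by (rule finT[OF sA]) (use AT oneY in auto)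
  have cB: "closedin \<tau> B" by (rule finT[OF sB]) (use BT oneY in auto)
  have cC: "closedin \<tau> C" by (rule finT[OF sC]) (use AYT in \<open>auto simp: C_def\<close>)
  have cE: "closedin \<tau> E" by (rule finT[OF sE]) (use AYT in \<open>auto simp: E_def\<close>)
  have AC: "A \<subseteq> C"
  proof
    fix a assume "a \<in> A"
    then show "a \<in> C" using set_mult_mem[OF _ oneY] subgroup.mem_carrier[OF sA] unfolding C_def by force
  qed
  have eq: "closed_join G \<tau> A (B \<inter> C) = closed_join G \<tau> A B \<inter> C"
    using mod sA sB sC cA cB cC AC by (simp add: topologically_modular_def closed_subgroup_def)
  have "A <#> (B \<inter> C) \<subseteq> E"
  proof
    fix x assume "x \<in> A <#> (B \<inter> C)"
    then obtain a b' where x: "a \<in> A" "b' \<in> B" "b' \<in> C" "x = a \<otimes> b'" by (auto simp: set_mult_def)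
    obtain u' where u': "(b', u') \<in> \<Gamma>" using x(2) by (auto simp: B_def)
    obtain a' v where v: "a' \<in> A" "v \<in> Y" "b' = a' \<otimes> v" using x(3) by (auto simp: C_def set_mult_def)
    obtain b u where bu: "(b, u) \<in> \<Gamma>" "a' = b \<otimes> u" using AE[OF v(1)] by blast
    note c = \<Gamma>c[OF u'] \<Gamma>c[OF bu(1)]
    have vT: "v \<in> T" using v YT by blast
    have vc: "v \<in> carrier G" using vT by simp
    have ac: "a \<in> carrier G" by (rule subgroup.mem_carrier[OF sA x(1)])
    have uv: "u \<otimes> v \<in> carrier G" using c vc by simp
    have "b' \<otimes> inv b = b \<otimes> (u \<otimes> v) \<otimes> inv b" using c vc by (simp add: v(3) bu(2) m_assoc)
    also have "\<dots> = b \<otimes> (u \<otimes> v \<otimes> inv b)" using c uv by (intro m_assoc) auto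
    also have "\<dots> = u \<otimes> v" using c uv by (intro m_conj_cancel)
    finally have "b' \<otimes> inv b = u \<otimes> v" .
    \<comment> \<open>The difference of the two pairs in the graph has its first entry b' - b = u +
      v in \<open>T\<close>, so it is trivial, and v = - u is a value of the homomorphism.\<close>
    then have "b' \<otimes> inv b \<in> T" using c vT by simp
    then have "b' \<otimes> inv b = \<one> \<and> u' \<otimes> inv u = \<one>" by (rule triv[OF \<Gamma>m[OF u' \<Gamma>i[OF bu(1)]]])
    then have "u \<otimes> v = \<one>" using \<open>b' \<otimes> inv b = u \<otimes> v\<close> by simp
    then have "u = inv v" using c vc by (intro inv_equality[symmetric])
    then have "v = inv u" using vc by simp
    moreover have "inv u \<in> D"
      using subgroup.m_inv_closed[OF sD] bu(1) unfolding D_def by (metis imageI snd_conv)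
    ultimately have "v \<in> D \<inter> Y" using v(2) by simp
    moreover have "a \<otimes> a' \<in> A" by (rule subgroup.m_closed[OF sA x(1) v(1)])
    moreover have "x = a \<otimes> a' \<otimes> v"
      using x(4) v(3) ac vc subgroup.mem_carrier[OF sA v(1)] by (simp add: m_assoc)
    ultimately show "x \<in> E" unfolding E_def using set_mult_mem by simp
  qed
  then have 1: "closed_join G \<tau> A (B \<inter> C) \<subseteq> E"
    unfolding closed_join_def by (rule closure_of_minimal[OF _ cE])
  have "D \<subseteq> A <#> B"
  proof
    fix u assume "u \<in> D"
    then obtain b where bu: "(b, u) \<in> \<Gamma>" by (auto simp: D_def)
    have "inv b \<in> B" using subgroup.m_inv_closed[OF sB] bu unfolding B_def by (metis imageI fst_conv)
    then have "b \<otimes> u \<otimes> inv b \<in> A <#> B" by (rule set_mult_mem[OF AI[OF bu]])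
    moreover have "b \<otimes> u \<otimes> inv b = u" using \<Gamma>c[OF bu] by (simp add: m_assoc m_conj_cancel)
    ultimately show "u \<in> A <#> B" by simp
  qed
  then have "y \<in> closed_join G \<tau> A B"
    using y(2) closure_of_mono unfolding closed_join_def D_def by blast
  moreover have yY: "y \<in> Y" unfolding Y_def by (rule generate.incl) simp
  moreover have "y \<in> C"
    using set_mult_mem[OF subgroup.one_closed[OF sA] yY] yc by (simp add: C_def)
  ultimately have "y \<in> E" using eq 1 by blast
  then have "y \<in> D \<inter> Y" unfolding E_def using AYT y(1) by blast
  then show False using y(3) by (simp add: D_def)
qed

text \<open>A closed \<open>D\<close> would be compact. One isolated point would, by translation,
  make all points isolated, and a compact discrete set is finite. So \<open>D\<close> would be a
  nonempty perfect compact Hausdorff space, which has at least as many points as the real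
  line.\<close>

lemma countable_subgroup_not_closed:
  assumes D: "subgroup D G" "countable D" "infinite D" and U: "compactin \<tau> U" "D \<subseteq> U"
  shows "\<not> closedin \<tau> D"
proof
  assume cD: "closedin \<tau> D"
  interpret D: subgroup D G by (rule D)
  have kD: "compactin \<tau> D" by (rule closed_compactin[OF U cD])
  have "d \<in> \<tau> derived_set_of D" if d: "d \<in> D" for d
    unfolding in_derived_set_of
  proof (intro conjI allI impI)
    show "d \<in> topspace \<tau>" using d by simp
    fix V assume V: "d \<in> V \<and> openin \<tau> V"
    show "\<exists>e. e \<noteq> d \<and> e \<in> D \<and> e \<in> V"
    proof (rule ccontr)
      assume no: "\<nexists>e. e \<noteq> d \<and> e \<in> D \<and> e \<in> V"
      define W where "W e = {x \<in> carrier G. (d \<otimes> inv e) \<otimes> x \<in> V}" for e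
      have oW: "openin \<tau> (W e)" if "e \<in> D" for e
        unfolding W_def using that d V by (intro openin_translation) auto
      have We: "e \<in> W e" if "e \<in> D" for e
        using that d V by (simp add: W_def m_assoc)
      have Wu: "x = e" if "x \<in> D" "e \<in> D" "x \<in> W e" for x e
      proof -
        have "d \<otimes> inv e \<otimes> x \<in> D" using that d by simp
        then have "d \<otimes> inv e \<otimes> x = d" using no that(3) by (auto simp: W_def)
        then have "inv e \<otimes> x = \<one>" using that d by (simp add: m_assoc)
        then show ?thesis using that by (metis D.mem_carrier inv_equality inv_inv inv_closed inv_unique' m_comm)
      qed
      have "\<exists>\<F>. finite \<F> \<and> \<F> \<subseteq> W ` D \<and> D \<subseteq> \<Union> \<F>"
        by (rule compactinD[OF kD]) (use oW We in auto)
      then obtain \<F> where \<F>: "finite \<F>" "\<F> \<subseteq> W ` D" "D \<subseteq> \<Union> \<F>" by blast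
      obtain D0 where D0: "D0 \<subseteq> D" "finite D0" "\<F> = W ` D0" using finite_subset_image[OF \<F>(1,2)] by blast
      have "D \<subseteq> D0" using \<F>(3) D0 Wu by blast
      then show False using D(3) D0(2) finite_subset by blast
    qed
  qed
  moreover have "\<tau> derived_set_of D \<subseteq> D" using cD by (simp add: closedin_contains_derived_set)
  ultimately have "\<tau> derived_set_of D = D" by blast
  moreover have "D \<noteq> {}" using D.one_closed by blast
  ultimately have "(UNIV :: real set) \<lesssim> topspace (subtopology \<tau> D)"
    using lepoll_perfect_set_aux[of "subtopology \<tau> D"] kD Hausdorff
    by (simp add: Hausdorff_space_subtopology compact_space_subtopology compact_imp_locally_compact_space
        derived_set_of_subtopology D.subset inf_absorb2)
  then have "(UNIV :: real set) \<lesssim> D" by (simp add: D.subset inf_absorb2)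
  then show False using countable_lepoll[OF D(2)] uncountable_UNIV_real by blast
qed

text \<open>On an independent sequence the values of a homomorphism can be prescribed freely.
  Prescribing an enumeration of a countable infinite subgroup \<open>D\<close> of \<open>U\<close>
  makes \<open>D\<close> the image. A limit y of \<open>D\<close> outside \<open>D\<close> stays in
  \<open>U\<close>, hence has finite order as \<open>not_modular_if_graph\<close> requires.\<close>

lemma no_independent_sequence_if_modular:
  assumes mod: "topologically_modular G \<tau>"
    and U: "subgroup U G" "openin \<tau> U" "compactin \<tau> U" "infinite U"
    and T: "openin \<tau> (tor G)" "U \<subseteq> tor G"
  shows "\<not> (\<exists>f. independent_sequence G f)"
proof
  assume "\<exists>f. independent_sequence G f"
  then obtain f where f: "independent_sequence G f" by blast
  interpret square: comm_group "G \<times>\<times> G" by (rule comm_group_square)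
  interpret square_snd: group_hom "G \<times>\<times> G" G snd by (rule group_hom_snd)
  obtain S where S: "S \<subseteq> U" "countable S" "infinite S" using infinite_countable_subset'[OF U(4)] by blast
  have Sc: "S \<subseteq> carrier G" using S(1) subgroup.subset[OF U(1)] by blast
  define D where "D = generate G S"
  have sD: "subgroup D G" unfolding D_def by (rule generate_is_subgroup[OF Sc])
  have cD: "countable D" unfolding D_def by (rule countable_generate[OF S(2) Sc])
  have iD: "infinite D"
    using S(3) generate.incl[of _ S G] infinite_super[of S D] unfolding D_def by blast
  have DU: "D \<subseteq> U" unfolding D_def by (rule generate_subgroup_incl[OF S(1) U(1)])
  have Dc: "D \<subseteq> carrier G" by (rule subgroup.subset[OF sD])
  have "\<not> \<tau> closure_of D \<subseteq> D"
    using countable_subgroup_not_closed[OF sD cD iD U(3) DU] Dc closure_of_subset_eq[of D \<tau>] by simp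
  then obtain y where y: "y \<in> \<tau> closure_of D" "y \<notin> D" by blast
  have "\<tau> closure_of D \<subseteq> U" by (rule closure_of_minimal[OF DU compactin_closedin[OF U(3)]])
  then have yT: "y \<in> tor G" using y T(2) by blast
  define d where "d = from_nat_into D"
  have dD: "range d = D"
    unfolding d_def using cD subgroup.one_closed[OF sD] by (intro range_from_nat_into) auto
  define h where "h = (\<lambda>i. (f i, d i))"
  define \<Gamma> where "\<Gamma> = generate (G \<times>\<times> G) (range h)"
  have fc: "range f \<subseteq> carrier G" using f by (simp add: independent_sequence_def)
  have hc: "range h \<subseteq> carrier G \<times> tor G"
    using fc dD DU T(2) by (auto simp: h_def)
  have hc': "range h \<subseteq> carrier (G \<times>\<times> G)" using hc subgroup.subset[OF subgroup_tor] by auto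
  have snd\<Gamma>: "snd ` \<Gamma> = D"
  proof -
    have "snd ` \<Gamma> = generate G (snd ` range h)"
      unfolding \<Gamma>_def by (rule square_snd.generate_img[symmetric, OF hc'])
    also have "snd ` range h = D" using dD by (simp add: h_def image_image)
    also have "generate G D = D"
      using generate_subgroup_incl[OF subset_refl sD] generate.incl[of _ D G] by blast
    finally show ?thesis .
  qed
  have "\<not> topologically_modular G \<tau>"
  proof (rule not_modular_if_graph[OF subgroup_tor T(1), of \<Gamma> y])
    show "subgroup \<Gamma> (G \<times>\<times> G)" unfolding \<Gamma>_def by (rule square.generate_is_subgroup[OF hc'])
    have "subgroup (carrier G \<times> tor G) (G \<times>\<times> G)"
      by (rule DirProd_subgroups[OF is_group subgroup_self is_group subgroup_tor])
    then show "\<Gamma> \<subseteq> carrier G \<times> tor G"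
      unfolding \<Gamma>_def by (rule square.generate_subgroup_incl[OF hc])
    show "b = \<one> \<and> u = \<one>" if "(b, u) \<in> \<Gamma>" "b \<in> tor G" for b u
      using independent_graph[OF f _ _ that(2), of d u] that(1) dD Dc unfolding \<Gamma>_def h_def by simp
    show "finite (generate G {y})" by (rule finite_generate_torsion[OF yT])
  qed (use y yT snd\<Gamma> in simp_all)
  then show False using mod by blast
qed

end

section \<open>Sums of closed subgroups\<close>

context comm_group
begin

lemma set_mult_subset_subgroup:
  assumes "subgroup H G" "A \<subseteq> H" "B \<subseteq> H"
  shows "A <#> B \<subseteq> H"
proof
  fix x assume "x \<in> A <#> B"
  then obtain a b where "a \<in> A" "b \<in> B" "x = a \<otimes> b" by (auto simp: set_mult_def)
  then show "x \<in> H" using assms(2,3) by (auto intro: subgroup.m_closed[OF assms(1)])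
qed

lemma subset_set_mult_left:
  assumes "A \<subseteq> carrier G" "subgroup B G"
  shows "A \<subseteq> A <#> B"
proof
  fix a assume "a \<in> A"
  with set_mult_mem[OF this subgroup.one_closed[OF assms(2)]] assms(1) show "a \<in> A <#> B" by auto
qed

lemma subset_set_mult_right:
  assumes "subgroup A G" "B \<subseteq> carrier G"
  shows "B \<subseteq> A <#> B"
proof
  fix b assume "b \<in> B"
  with set_mult_mem[OF subgroup.one_closed[OF assms(1)] this] assms(2) show "b \<in> A <#> B" by auto
qed

end

context topological_comm_group
begin

lemma closed_subgroup_subgroup_iff:
  assumes T: "subgroup T G" "closedin \<tau> T"
  shows "closed_subgroup X (G\<lparr>carrier := T\<rparr>) (subtopology \<tau> T) \<longleftrightarrow> closed_subgroup X G \<tau> \<and> X \<subseteq> T"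
proof -
  have "subgroup X (G\<lparr>carrier := T\<rparr>) \<longleftrightarrow> subgroup X G \<and> X \<subseteq> T"
    using incl_subgroup[OF T(1)] subgroup_incl[OF _ T(1)] subgroup.subset[of X "G\<lparr>carrier := T\<rparr>"]
    by auto
  moreover have "closedin (subtopology \<tau> T) X \<longleftrightarrow> closedin \<tau> X \<and> X \<subseteq> T"
    by (rule closedin_closed_subtopology[OF T(2)])
  ultimately show ?thesis unfolding closed_subgroup_def by blast
qed

lemma quasihamiltonian_subgroup_iff:
  assumes T: "subgroup T G" "closedin \<tau> T"
  shows "strongly_topologically_quasihamiltonian (G\<lparr>carrier := T\<rparr>) (subtopology \<tau> T) \<longleftrightarrow>
    (\<forall>X Y. closed_subgroup X G \<tau> \<and> X \<subseteq> T \<longrightarrow> closed_subgroup Y G \<tau> \<and> Y \<subseteq> T \<longrightarrow> closedin \<tau> (X <#> Y))"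
proof -
  have eq: "X <#>\<^bsub>G\<lparr>carrier := T\<rparr>\<^esub> Y = X <#> Y" for X Y by (simp add: set_mult_def)
  have sub: "X <#> Y \<subseteq> T" if "X \<subseteq> T" "Y \<subseteq> T" for X Y
    by (rule set_mult_subset_subgroup[OF T(1) that])
  show ?thesis
    unfolding strongly_topologically_quasihamiltonian_def closed_subgroup_subgroup_iff[OF T]
      closedin_closed_subtopology[OF T(2)] eq
    using sub by blast
qed

text \<open>Once sums are closed, joins are plain sums, and for these the modular law is Dedekind's:
  if a + b lies in \<open>C\<close> and a lies in \<open>A \<subseteq> C\<close>, then b lies in
  \<open>C\<close>.\<close>

lemma modular_if_quasihamiltonian:
  assumes "strongly_topologically_quasihamiltonian G \<tau>"
  shows "topologically_modular G \<tau>"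
  unfolding topologically_modular_def
proof (intro allI impI)
  fix A B C assume A: "closed_subgroup A G \<tau>" and B: "closed_subgroup B G \<tau>"
    and C: "closed_subgroup C G \<tau>" and AC: "A \<subseteq> C"
  have sub: "subgroup A G" "subgroup B G" "subgroup C G"
    using A B C by (simp_all add: closed_subgroup_def)
  have BC: "closed_subgroup (B \<inter> C) G \<tau>"
    using B C by (simp add: closed_subgroup_def subgroups_Inter_pair closedin_Int)
  have join: "closed_join G \<tau> A D = A <#> D" if "closed_subgroup D G \<tau>" for D
    using assms A that unfolding strongly_topologically_quasihamiltonian_def closed_join_def
    by (simp add: closure_of_closedin)
  have "A <#> (B \<inter> C) = (A <#> B) \<inter> C"
  proof
    show "A <#> (B \<inter> C) \<subseteq> (A <#> B) \<inter> C"
      using set_mult_subset_subgroup[OF sub(3) AC, of "B \<inter> C"] mono_set_mult[of A A "B \<inter> C" B] by auto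
    show "(A <#> B) \<inter> C \<subseteq> A <#> (B \<inter> C)"
    proof
      fix x assume x: "x \<in> (A <#> B) \<inter> C"
      then obtain a b where ab: "a \<in> A" "b \<in> B" "x = a \<otimes> b" by (auto simp: set_mult_def)
      have c: "a \<in> carrier G" "b \<in> carrier G" using ab sub subgroup.mem_carrier by metis+
      have "b = inv a \<otimes> x" using ab c by (simp add: m_assoc[symmetric])
      moreover have "inv a \<otimes> x \<in> C"
        using x ab AC by (intro subgroup.m_closed[OF sub(3)] subgroup.m_inv_closed[OF sub(3)]) auto
      ultimately have "b \<in> B \<inter> C" using ab(2) by simp
      then show "x \<in> A <#> (B \<inter> C)" unfolding ab(3) by (rule set_mult_mem[OF ab(1)])
    qed
  qed
  then show "closed_join G \<tau> A (B \<inter> C) = closed_join G \<tau> A B \<inter> C"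
    using join[OF B] join[OF BC] by simp
qed

text \<open>
  For \<open>z\<close> in the closure of \<open>X + Y\<close>, a torsion element, apply the modular law to \<open>X\<close>, \<open>Y\<close> and \<open>X + \<langle>z\<rangle>\<close>: a
  subgroup between \<open>X\<close> and its finite extension \<open>X + \<langle>z\<rangle>\<close> is closed.
\<close>

lemma set_mult_closed_if_modular:
  assumes mod: "topologically_modular G \<tau>" and T: "closedin \<tau> (tor G)"
    and X: "closed_subgroup X G \<tau>" "X \<subseteq> tor G" and Y: "closed_subgroup Y G \<tau>" "Y \<subseteq> tor G"
  shows "closedin \<tau> (X <#> Y)"
proof -
  have sX: "subgroup X G" and cX: "closedin \<tau> X" and sY: "subgroup Y G" and cY: "closedin \<tau> Y"
    using X Y by (simp_all add: closed_subgroup_def)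
  have Xc: "X \<subseteq> carrier G" and Yc: "Y \<subseteq> carrier G"
    using sX sY by (simp_all add: subgroup.subset)
  have "z \<in> X <#> Y" if z: "z \<in> \<tau> closure_of (X <#> Y)" for z
  proof -
    have "X <#> Y \<subseteq> tor G" by (rule set_mult_subset_subgroup[OF subgroup_tor X(2) Y(2)])
    then have "\<tau> closure_of (X <#> Y) \<subseteq> tor G" using T by (rule closure_of_minimal)
    then have zT: "z \<in> tor G" using z by blast
    then have zc: "z \<in> carrier G" by (simp add: tor_def)
    define Z where "Z = generate G {z}"
    have sZ: "subgroup Z G" unfolding Z_def by (rule generate_singleton_subgroup[OF zc])
    have Zc: "Z \<subseteq> carrier G" by (rule subgroup.subset[OF sZ])
    have fZ: "finite Z" unfolding Z_def by (rule finite_generate_torsion[OF zT])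
    define C where "C = X <#> Z"
    have sC: "subgroup C G" unfolding C_def by (rule mult_subgroups[OF sX sZ])
    \<comment> \<open>Such a \<open>J\<close> is the sum of \<open>X\<close> and the finite set
      \<open>Z \<inter> J\<close>, hence a finite union of translates of a closed set.\<close>
    have between: "closedin \<tau> J" if J: "subgroup J G" "X \<subseteq> J" "J \<subseteq> C" for J
    proof -
      have "J = (Z \<inter> J) <#> X"
      proof
        show "(Z \<inter> J) <#> X \<subseteq> J" by (rule set_mult_subset_subgroup[OF J(1) _ J(2)]) simp
        show "J \<subseteq> (Z \<inter> J) <#> X"
        proof
          fix j assume j: "j \<in> J"
          then obtain x u where xu: "x \<in> X" "u \<in> Z" "j = x \<otimes> u" using J(3) by (auto simp: C_def set_mult_def)
          have c: "x \<in> carrier G" "u \<in> carrier G" using xu Xc Zc by auto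
          have "u = inv x \<otimes> j" using c xu(3) by (simp add: m_assoc[symmetric])
          moreover have "inv x \<otimes> j \<in> J"
            using xu(1) J(2) j by (intro subgroup.m_closed[OF J(1)] subgroup.m_inv_closed[OF J(1)]) auto
          ultimately have "u \<in> Z \<inter> J" using xu(2) by simp
          from set_mult_mem[OF this xu(1)] show "j \<in> (Z \<inter> J) <#> X" using xu(3) c by (simp add: m_comm)
        qed
      qed
      moreover have "closedin \<tau> ((Z \<inter> J) <#> X)"
        using fZ Zc cX by (intro closedin_finite_set_mult) auto
      ultimately show ?thesis by simp
    qed
    have XC: "X \<subseteq> C" unfolding C_def by (rule subset_set_mult_left[OF Xc sZ])
    have cC: "closedin \<tau> C" by (rule between[OF sC XC subset_refl])
    \<comment> \<open>This lies between \<open>X\<close> and \<open>C\<close>, so it is closed and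
      equals the left side of the modular law. The right side contains z.\<close>
    define J where "J = X <#> (Y \<inter> C)"
    have sYC: "subgroup (Y \<inter> C) G" by (rule subgroups_Inter_pair[OF sY sC])
    have sJ: "subgroup J G" unfolding J_def by (rule mult_subgroups[OF sX sYC])
    have "closedin \<tau> J"
    proof (rule between[OF sJ])
      show "X \<subseteq> J" unfolding J_def by (rule subset_set_mult_left[OF Xc sYC])
      show "J \<subseteq> C" unfolding J_def by (rule set_mult_subset_subgroup[OF sC XC]) simp
    qed
    then have "J = closed_join G \<tau> X (Y \<inter> C)"
      by (simp add: closed_join_def J_def closure_of_closedin)
    also have "\<dots> = closed_join G \<tau> X Y \<inter> C"
      using mod X(1) Y(1) sC cC XC unfolding topologically_modular_def closed_subgroup_def by blast
    finally have "J = closed_join G \<tau> X Y \<inter> C" .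
    moreover have "z \<in> C"
    proof -
      have "Z \<subseteq> C" unfolding C_def by (rule subset_set_mult_right[OF sX Zc])
      moreover have "z \<in> Z" unfolding Z_def by (rule generate.incl) simp
      ultimately show ?thesis by blast
    qed
    ultimately have "z \<in> J" using z by (simp add: closed_join_def)
    moreover have "J \<subseteq> X <#> Y" unfolding J_def by (rule mono_set_mult) auto
    ultimately show ?thesis by blast
  qed
  then have "\<tau> closure_of (X <#> Y) \<subseteq> X <#> Y" by (rule subsetI)
  moreover have "X <#> Y \<subseteq> carrier G"
    by (rule set_mult_subset_subgroup[OF subgroup_self Xc Yc])
  ultimately show ?thesis using closure_of_subset_eq[of "X <#> Y" \<tau>] by simp
qed

subsection \<open>Closed sums from finite rank\<close>

text \<open>Baire's theorem, applied to the closed sets \<open>{x \<in> U. n x = 0}\<close> that cover the compact group \<open>U\<close>.\<close>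

lemma open_subgroup_bounded_exponent:
  assumes U: "subgroup U G" "openin \<tau> U" "compactin \<tau> U" "U \<subseteq> tor G"
  obtains m :: nat and W where "m > 0" "subgroup W G" "openin \<tau> W" "\<And>w. w \<in> W \<Longrightarrow> w [^] m = \<one>"
proof -
  define X where "X = subtopology \<tau> U"
  have Uc: "U \<subseteq> carrier G" by (rule subgroup.subset[OF U(1)])
  have topX: "topspace X = U" using Uc by (simp add: X_def inf_absorb2)
  have kX: "compact_space X" using U(3) by (simp add: X_def compact_space_subtopology)
  have hX: "Hausdorff_space X" using Hausdorff by (simp add: X_def Hausdorff_space_subtopology)
  define P where "P n = {x \<in> U. x [^] n = \<one>}" for n :: nat
  have cP: "closedin X (P n)" for n
  proof -
    have "closedin \<tau> {x \<in> topspace \<tau>. x [^] n \<in> {\<one>}}"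
      by (rule closedin_continuous_map_preimage[OF continuous_map_nat_pow]) (simp add: closedin_finite)
    then have "closedin X (U \<inter> {x \<in> topspace \<tau>. x [^] n \<in> {\<one>}})"
      unfolding X_def by (rule closedin_subtopology_Int_closed)
    moreover have "U \<inter> {x \<in> topspace \<tau>. x [^] n \<in> {\<one>}} = P n"
      using Uc by (auto simp: P_def)
    ultimately show ?thesis by simp
  qed
  have "\<exists>n>0. X interior_of P n \<noteq> {}"
  proof (rule ccontr)
    assume "\<not> (\<exists>n>0. X interior_of P n \<noteq> {})"
    then have "X interior_of P n = {}" if "n > 0" for n using that by blast
    then have "X interior_of \<Union>(P ` {0<..}) = {}"
      using cP compact_imp_locally_compact_space[OF kX] compact_Hausdorff_imp_regular_space[OF kX hX]
      by (intro Baire_category_alt) auto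
    moreover have "\<Union>(P ` {0<..}) = U"
      using U(4) by (auto simp: P_def tor_def subset_iff)
    ultimately have "U = {}" using topX by (metis interior_of_topspace)
    then show False using subgroup.one_closed[OF U(1)] by simp
  qed
  then obtain m where m: "m > 0" "X interior_of P m \<noteq> {}" by blast
  then obtain v where v: "v \<in> X interior_of P m" by blast
  then obtain V where "openin X V" "v \<in> V" "V \<subseteq> P m" unfolding interior_of_def by blast
  then have V: "openin \<tau> V" "v \<in> V" "V \<subseteq> P m"
    using U(2) by (simp_all add: X_def openin_open_subtopology)
  have vm: "v \<in> carrier G" "v [^] m = \<one>" using V(2,3) Uc by (auto simp: P_def)
  define W where "W = {x \<in> carrier G. x [^] m = \<one>}"
  have sW: "subgroup W G"
    by (rule subgroupI) (auto simp: W_def nat_pow_distrib nat_pow_inv intro!: exI[of _ \<one>])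
  have "openin \<tau> W"
  proof (rule openin_subgroupI[OF sW])
    \<comment> \<open>The set \<open>V\<close> may miss the identity. Its translate by - v contains
      it and stays in \<open>W\<close>, because m kills v too.\<close>
    show "openin \<tau> {x \<in> carrier G. v \<otimes> x \<in> V}" by (rule openin_translation[OF vm(1) V(1)])
    show "\<one> \<in> {x \<in> carrier G. v \<otimes> x \<in> V}" using V(2) vm(1) by simp
    show "{x \<in> carrier G. v \<otimes> x \<in> V} \<subseteq> W"
    proof
      fix x assume x: "x \<in> {x \<in> carrier G. v \<otimes> x \<in> V}"
      then have "(v \<otimes> x) [^] m = \<one>" using V(3) by (auto simp: P_def)
      then show "x \<in> W" using x vm by (simp add: W_def nat_pow_distrib)
    qed
  qed
  then show ?thesis by (rule that[OF m(1) sW]) (simp add: W_def)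
qed

text \<open>The predicate \<open>S\<close> attaches labels from a finite set to the elements of
  \<open>J\<close>, not necessarily uniquely. Elements sharing a label lie in the same coset of
  \<open>P\<close>, so one representative for each occurring label covers \<open>J\<close> by
  finitely many closed cosets.\<close>

lemma closedin_if_finite_index:
  assumes P: "closedin \<tau> P" "subgroup P G" and J: "subgroup J G" "P \<subseteq> J"
    and F: "finite F" "\<And>d. d \<in> J \<Longrightarrow> \<exists>f\<in>F. S f d"
    and S: "\<And>d e f. \<lbrakk>d \<in> J; e \<in> J; f \<in> F; S f d; S f e\<rbrakk> \<Longrightarrow> d \<otimes> inv e \<in> P"
  shows "closedin \<tau> J"
proof -
  define r where "r f = (SOME e. e \<in> J \<and> S f e)" for f
  define F' where "F' = r ` {f \<in> F. \<exists>e\<in>J. S f e}"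
  have r: "r f \<in> J \<and> S f (r f)" if "e \<in> J" "S f e" for f e
    unfolding r_def by (rule someI[of _ e]) (simp add: that)
  have F'J: "F' \<subseteq> J" using r by (auto simp: F'_def)
  have "J = F' <#> P"
  proof
    show "F' <#> P \<subseteq> J" by (rule set_mult_subset_subgroup[OF J(1) F'J J(2)])
    show "J \<subseteq> F' <#> P"
    proof
      fix d assume d: "d \<in> J"
      then obtain f where f: "f \<in> F" "S f d" using F(2) by blast
      have rf: "r f \<in> J" "S f (r f)" using r[OF d f(2)] by auto
      have "d \<otimes> inv (r f) \<in> P" by (rule S[OF d rf(1) f(1) f(2) rf(2)])
      moreover have "r f \<in> F'" using f d by (auto simp: F'_def)
      ultimately have "r f \<otimes> (d \<otimes> inv (r f)) \<in> F' <#> P" by (intro set_mult_mem)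
      moreover have "r f \<otimes> (d \<otimes> inv (r f)) = d"
        using subgroup.mem_carrier[OF J(1)] d rf(1) by (intro m_conj_cancel)
      ultimately show "d \<in> F' <#> P" by simp
    qed
  qed
  moreover have "closedin \<tau> (F' <#> P)"
    using F(1) F'J subgroup.subset[OF J(1)] P(1) by (intro closedin_finite_set_mult) (auto simp: F'_def)
  ultimately show ?thesis by simp
qed

text \<open>
  \<open>P = (X \<inter> T) + (Y \<inter> T)\<close> has finite index in \<open>(X + Y) \<inter> (W + P)\<close>, where \<open>W\<close> is an open subgroup of
  exponent \<open>m\<close>: for \<open>x + y\<close> in the latter, \<open>m x\<close> and \<open>- m y\<close> agree modulo torsion with an element
  of \<open>X \<inter> Y\<close>, whose class modulo \<open>m (X \<inter> Y)\<close> and torsion determines \<open>x + y\<close> modulo \<open>P\<close>.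
\<close>

lemma quasihamiltonian_if_torsion_quasihamiltonian:
  assumes U: "subgroup U G" "openin \<tau> U" "compactin \<tau> U" "U \<subseteq> tor G"
    and T: "openin \<tau> (tor G)"
    and qh: "\<And>X Y. \<lbrakk>closed_subgroup X G \<tau>; X \<subseteq> tor G; closed_subgroup Y G \<tau>; Y \<subseteq> tor G\<rbrakk> \<Longrightarrow> closedin \<tau> (X <#> Y)"
    and no: "\<not> (\<exists>f. independent_sequence G f)"
  shows "strongly_topologically_quasihamiltonian G \<tau>"
  unfolding strongly_topologically_quasihamiltonian_def
proof (intro allI impI)
  fix X Y assume X: "closed_subgroup X G \<tau>" and Y: "closed_subgroup Y G \<tau>"
  have sX: "subgroup X G" and sY: "subgroup Y G" using X Y by (simp_all add: closed_subgroup_def)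
  interpret T: subgroup "tor G" G by (rule subgroup_tor)
  interpret X: subgroup X G by (rule sX)
  interpret Y: subgroup Y G by (rule sY)
  have cT: "closedin \<tau> (tor G)" by (rule closedin_open_subgroup[OF subgroup_tor T])
  define XT YT where "XT = X \<inter> tor G" and "YT = Y \<inter> tor G"
  have sXT: "subgroup XT G" and sYT: "subgroup YT G"
    unfolding XT_def YT_def by (rule subgroups_Inter_pair[OF sX subgroup_tor] subgroups_Inter_pair[OF sY subgroup_tor])+
  define P where "P = XT <#> YT"
  have sP: "subgroup P G" unfolding P_def by (rule mult_subgroups[OF sXT sYT])
  have cP: "closedin \<tau> P"
    unfolding P_def
  proof (rule qh)
    show "closed_subgroup XT G \<tau>" "closed_subgroup YT G \<tau>"
      using X Y sXT sYT cT by (simp_all add: closed_subgroup_def XT_def YT_def closedin_Int)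
  qed (simp_all add: XT_def YT_def)
  obtain m :: nat and W where m: "m > 0" and W: "subgroup W G" "openin \<tau> W"
    and Wm: "\<And>w. w \<in> W \<Longrightarrow> w [^] m = \<one>"
    using open_subgroup_bounded_exponent[OF U] by blast
  define R where "R = X \<inter> Y"
  have sR: "subgroup R G" unfolding R_def by (rule subgroups_Inter_pair[OF sX sY])
  obtain F where F: "finite F" "F \<subseteq> R"
    "\<And>r. r \<in> R \<Longrightarrow> \<exists>f\<in>F. \<exists>s\<in>R. \<exists>t\<in>tor G. r = f \<otimes> s [^] m \<otimes> t"
    using finite_mod_pow[OF no sR m] by auto
  define H where "H = X <#> Y"
  have sH: "subgroup H G" unfolding H_def by (rule mult_subgroups[OF sX sY])
  \<comment> \<open>The open subgroup on which closedness is tested. Adding \<open>P\<close> ensures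
    that the trace \<open>J\<close> contains \<open>P\<close>, and multiplication by m still maps
    \<open>M\<close> into \<open>P\<close> because it kills \<open>W\<close>.\<close>
  define M where "M = W <#> P"
  have sM: "subgroup M G" unfolding M_def by (rule mult_subgroups[OF W(1) sP])
  have WM: "W \<subseteq> M" unfolding M_def by (rule subset_set_mult_left[OF subgroup.subset[OF W(1)] sP])
  have oM: "openin \<tau> M" by (rule openin_subgroupI[OF sM W(2) subgroup.one_closed[OF W(1)] WM])
  define J where "J = H \<inter> M"
  have sJ: "subgroup J G" unfolding J_def by (rule subgroups_Inter_pair[OF sH sM])
  have PJ: "P \<subseteq> J"
  proof -
    have "P \<subseteq> H" unfolding P_def H_def XT_def YT_def by (rule mono_set_mult) auto
    moreover have "P \<subseteq> M" unfolding M_def by (rule subset_set_mult_right[OF W(1) subgroup.subset[OF sP]])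
    ultimately show ?thesis by (simp add: J_def)
  qed
  \<comment> \<open>The label f of d = a + b records m a = f and m b = - f up to torsion. Labels
    range over the representatives \<open>F\<close> of \<open>X \<inter> Y\<close> modulo its
    multiples by m and torsion.\<close>
  define S where "S f d \<longleftrightarrow> (\<exists>a\<in>X. \<exists>b\<in>Y. \<exists>s\<in>tor G. \<exists>t\<in>tor G.
      d = a \<otimes> b \<and> a [^] m = f \<otimes> s \<and> b [^] m = inv f \<otimes> t)" for f d
  have "closedin \<tau> J"
  proof (rule closedin_if_finite_index[OF cP sP sJ PJ F(1), of S])
    fix d assume d: "d \<in> J"
    obtain x y where xy: "x \<in> X" "y \<in> Y" "d = x \<otimes> y" using d by (auto simp: J_def H_def set_mult_def)
    obtain w p where wp: "w \<in> W" "p \<in> P" "d = w \<otimes> p" using d by (auto simp: J_def M_def set_mult_def)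
    note c = X.mem_carrier[OF xy(1)] Y.mem_carrier[OF xy(2)]
      subgroup.mem_carrier[OF W(1) wp(1)] subgroup.mem_carrier[OF sP wp(2)]
    have "d [^] m = p [^] m" using c Wm[OF wp(1)] by (simp add: wp(3) nat_pow_distrib)
    then have "x [^] m \<otimes> y [^] m \<in> P"
      using nat_pow_mem[OF sP wp(2), of m] c by (simp add: xy(3) nat_pow_distrib)
    then obtain s t where st: "s \<in> XT" "t \<in> YT" "x [^] m \<otimes> y [^] m = s \<otimes> t"
      by (auto simp: P_def set_mult_def)
    have stX: "s \<in> X" "s \<in> tor G" "t \<in> Y" "t \<in> tor G" using st by (auto simp: XT_def YT_def)
    note c' = X.mem_carrier[OF stX(1)] Y.mem_carrier[OF stX(3)]
    \<comment> \<open>From m x + m y = s + t one gets m x - s = t - m y, where the left side lies in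
      \<open>X\<close> and the right side in \<open>Y\<close>.\<close>
    define r where "r = x [^] m \<otimes> inv s"
    have r2: "r = t \<otimes> inv (y [^] m)"
    proof -
      have "r = (x [^] m \<otimes> y [^] m) \<otimes> inv (y [^] m) \<otimes> inv s"
        unfolding r_def using c c' by (simp add: m_assoc)
      also have "\<dots> = (s \<otimes> t) \<otimes> inv (y [^] m) \<otimes> inv s" by (simp only: st(3))
      also have "\<dots> = s \<otimes> ((t \<otimes> inv (y [^] m)) \<otimes> inv s)" using c c' by (simp add: m_assoc)
      also have "\<dots> = t \<otimes> inv (y [^] m)" using c c' by (intro m_conj_cancel) auto
      finally show ?thesis .
    qed
    have rX: "r \<in> X" unfolding r_def using nat_pow_mem[OF sX xy(1)] stX by simp
    have rY: "r \<in> Y" unfolding r2 using nat_pow_mem[OF sY xy(2)] stX by simp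
    obtain f u v where f: "f \<in> F" "u \<in> R" "v \<in> tor G" "r = f \<otimes> u [^] m \<otimes> v"
      using F(3)[of r] rX rY by (auto simp: R_def)
    have uX: "u \<in> X" "u \<in> Y" "f \<in> X" using f F(2) by (auto simp: R_def)
    note c'' = X.mem_carrier[OF uX(1)] X.mem_carrier[OF uX(3)] T.mem_carrier[OF f(3)]
    \<comment> \<open>Moving u from x to y does not change d and removes m u from r = f + m u + v,
      so the summands x - u and y + u carry the label f.\<close>
    have "x [^] m = r \<otimes> s" unfolding r_def using c c' by (simp add: m_assoc)
    then have "(x \<otimes> inv u) [^] m = f \<otimes> u [^] m \<otimes> v \<otimes> s \<otimes> inv (u [^] m)"
      using c c' c'' by (simp add: nat_pow_distrib nat_pow_inv f(4))
    also have "\<dots> = u [^] m \<otimes> ((f \<otimes> (v \<otimes> s)) \<otimes> inv (u [^] m))"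
      using c' c'' by (simp add: m_ac)
    also have "\<dots> = f \<otimes> (v \<otimes> s)" using c' c'' by (intro m_conj_cancel) auto
    finally have 1: "(x \<otimes> inv u) [^] m = f \<otimes> (v \<otimes> s)" .
    have "y [^] m = inv r \<otimes> t"
      unfolding r2 using c c' by (simp add: inv_mult m_ac) (simp add: m_assoc[symmetric])
    then have "(y \<otimes> u) [^] m = inv (f \<otimes> u [^] m \<otimes> v) \<otimes> t \<otimes> u [^] m"
      using c c' c'' by (simp add: nat_pow_distrib f(4))
    also have "\<dots> = u [^] m \<otimes> ((inv f \<otimes> (inv v \<otimes> t)) \<otimes> inv (u [^] m))"
      using c' c'' by (simp add: inv_mult m_ac)
    also have "\<dots> = inv f \<otimes> (inv v \<otimes> t)" using c' c'' by (intro m_conj_cancel) auto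
    finally have 2: "(y \<otimes> u) [^] m = inv f \<otimes> (inv v \<otimes> t)" .
    have "d = (x \<otimes> inv u) \<otimes> (y \<otimes> u)"
    proof -
      have "(x \<otimes> inv u) \<otimes> (y \<otimes> u) = u \<otimes> ((x \<otimes> y) \<otimes> inv u)" using c c'' by (simp add: m_ac)
      also have "\<dots> = x \<otimes> y" using c c'' by (intro m_conj_cancel) auto
      finally show ?thesis using xy(3) by simp
    qed
    moreover have "x \<otimes> inv u \<in> X" "y \<otimes> u \<in> Y" using xy uX by simp_all
    moreover have "v \<otimes> s \<in> tor G" "inv v \<otimes> t \<in> tor G" using f(3) stX by simp_all
    ultimately have "S f d" unfolding S_def using 1 2 by blast
    then show "\<exists>f\<in>F. S f d" using f(1) by (rule bexI)
  next
    fix d e f assume "S f d" "S f e" "f \<in> F"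
    obtain a b s t where d: "a \<in> X" "b \<in> Y" "s \<in> tor G" "t \<in> tor G" "d = a \<otimes> b"
      "a [^] m = f \<otimes> s" "b [^] m = inv f \<otimes> t" using \<open>S f d\<close> unfolding S_def by blast
    obtain a' b' s' t' where e: "a' \<in> X" "b' \<in> Y" "s' \<in> tor G" "t' \<in> tor G" "e = a' \<otimes> b'"
      "a' [^] m = f \<otimes> s'" "b' [^] m = inv f \<otimes> t'" using \<open>S f e\<close> unfolding S_def by blast
    have fc: "f \<in> carrier G" using \<open>f \<in> F\<close> F(2) subgroup.mem_carrier[OF sR] by blast
    note c = X.mem_carrier[OF d(1)] Y.mem_carrier[OF d(2)] T.mem_carrier[OF d(3)] T.mem_carrier[OF d(4)]
      X.mem_carrier[OF e(1)] Y.mem_carrier[OF e(2)] T.mem_carrier[OF e(3)] T.mem_carrier[OF e(4)]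
    have cancel: "g \<otimes> s \<otimes> inv (g \<otimes> s') = s \<otimes> inv s'"
      if "g \<in> carrier G" "s \<in> carrier G" "s' \<in> carrier G" for g s s'
    proof -
      have "g \<otimes> s \<otimes> inv (g \<otimes> s') = g \<otimes> ((s \<otimes> inv s') \<otimes> inv g)"
        using that by (simp add: inv_mult m_ac)
      also have "\<dots> = s \<otimes> inv s'" using that by (intro m_conj_cancel) auto
      finally show ?thesis .
    qed
    \<comment> \<open>The common label cancels, so m (a - a') and m (b - b') are torsion, and
      therefore so are a - a' and b - b'.\<close>
    have "(a \<otimes> inv a') [^] m = s \<otimes> inv s'"
      using c fc by (simp add: nat_pow_distrib nat_pow_inv d(6) e(6) cancel)
    then have pt: "(a \<otimes> inv a') [^] m \<in> tor G" using d e by simp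
    have "a \<otimes> inv a' \<in> tor G" by (rule tor_of_pow_mem_tor[OF _ m pt]) (use c in simp)
    then have 1: "a \<otimes> inv a' \<in> XT" using d e by (simp add: XT_def)
    have "(b \<otimes> inv b') [^] m = t \<otimes> inv t'"
      using c fc by (simp add: nat_pow_distrib nat_pow_inv d(7) e(7) cancel)
    then have pt: "(b \<otimes> inv b') [^] m \<in> tor G" using d e by simp
    have "b \<otimes> inv b' \<in> tor G" by (rule tor_of_pow_mem_tor[OF _ m pt]) (use c in simp)
    then have 2: "b \<otimes> inv b' \<in> YT" using d e by (simp add: YT_def)
    have "d \<otimes> inv e = (a \<otimes> inv a') \<otimes> (b \<otimes> inv b')"
      using c by (simp add: d(5) e(5) inv_mult m_ac)
    then show "d \<otimes> inv e \<in> P" using set_mult_mem[OF 1 2] by (simp add: P_def)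
  qed
  then show "closedin \<tau> (X <#> Y)"
    using closedin_subgroupI[OF sM oM sH] by (simp add: J_def H_def)
qed

end

section \<open>Quotients and the main theorem\<close>

lemma topspace_quotient_group_topology:
  assumes "topspace \<tau> = carrier G"
  shows "topspace (quotient_group_topology G \<tau> N) = carrier (G Mod N)"
proof -
  have "carrier (G Mod N) = (\<lambda>x. N #>\<^bsub>G\<^esub> x) ` carrier G" by (auto simp: FactGroup_def RCOSETS_def)
  then show ?thesis
    using quotient_imp_surjective_map[OF quotient_map_quotient_group_topology[OF assms, of N]] assms by simp
qed

lemma closedin_quotient_group_topology:
  assumes "topspace \<tau> = carrier G" "S \<subseteq> carrier (G Mod N)"
  shows "closedin (quotient_group_topology G \<tau> N) S \<longleftrightarrow> closedin \<tau> {x \<in> carrier G. N #>\<^bsub>G\<^esub> x \<in> S}"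
  using quotient_map_quotient_group_topology[OF assms(1), of N] assms
  by (simp add: quotient_map_closedin topspace_quotient_group_topology)

text \<open>Formulated with open cosets in place of a topological group, so that it also applies to
  \<open>G Mod N\<close> with its quotient topology, for which exactly this is verified in
  \<open>conditions_Mod\<close>. The same holds for \<open>compact_part_eq_tor\<close>.\<close>

lemma (in comm_group) discrete_quotient:
  assumes top: "topspace \<tau> = carrier G" and S: "subgroup S G"
    and cosets: "\<And>x. x \<in> carrier G \<Longrightarrow> openin \<tau> {z \<in> carrier G. z \<otimes> inv x \<in> S}"
  shows "discrete_space (quotient_group_topology G \<tau> S)"
proof -
  let ?q = "quotient_group_topology G \<tau> S"
  have tq: "topspace ?q = carrier (G Mod S)" by (rule topspace_quotient_group_topology[OF top])
  have "openin ?q {X}" if X: "X \<in> carrier (G Mod S)" for X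
  proof -
    obtain x where x: "x \<in> carrier G" "X = S #> x" using X by (auto simp: FactGroup_def RCOSETS_def)
    have "{z \<in> topspace \<tau>. S #> z \<in> {X}} = {z \<in> carrier G. z \<otimes> inv x \<in> S}"
      using r_coset_eq_iff[OF S _ x(1)] top x(2) by auto
    then show ?thesis using cosets[OF x(1)] X by (simp add: openin_quotient_group_topology)
  qed
  then have "discrete_topology (topspace ?q) = ?q" unfolding discrete_topology_unique tq by simp
  then show ?thesis unfolding discrete_space_def by (rule sym)
qed

text \<open>A compact subgroup meets only finitely many of the open cosets of \<open>tor G\<close>.
  So for x in it two multiples i x and j x with i < j lie in the same coset, and (j - i) x is
  torsion.\<close>

lemma (in comm_group) compact_part_eq_tor:
  assumes top: "topspace \<tau> = carrier G"
    and cosets: "\<And>x. x \<in> carrier G \<Longrightarrow> openin \<tau> {z \<in> carrier G. z \<otimes> inv x \<in> tor G}"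
  shows "compact_part G \<tau> = tor G"
proof
  interpret T: subgroup "tor G" G by (rule subgroup_tor)
  show "compact_part G \<tau> \<subseteq> tor G"
  proof
    fix x assume "x \<in> compact_part G \<tau>"
    then obtain K where K: "subgroup K G" "compactin \<tau> K" "x \<in> K" by (auto simp: compact_part_def)
    have Kc: "y \<in> carrier G" if "y \<in> K" for y by (rule subgroup.mem_carrier[OF K(1) that])
    have xc: "x \<in> carrier G" by (rule Kc[OF K(3)])
    define W where "W y = {z \<in> carrier G. z \<otimes> inv y \<in> tor G}" for y
    have oW: "openin \<tau> (W y)" if "y \<in> K" for y unfolding W_def by (rule cosets[OF Kc[OF that]])
    have Wy: "y \<in> W y" if "y \<in> K" for y using Kc[OF that] by (simp add: W_def)
    have "\<exists>\<F>. finite \<F> \<and> \<F> \<subseteq> W ` K \<and> K \<subseteq> \<Union> \<F>"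
      by (rule compactinD[OF K(2)]) (use oW Wy in auto)
    then obtain \<F> where \<F>: "finite \<F>" "\<F> \<subseteq> W ` K" "K \<subseteq> \<Union> \<F>" by blast
    obtain K0 where K0: "K0 \<subseteq> K" "finite K0" "\<F> = W ` K0" using finite_subset_image[OF \<F>(1,2)] by blast
    have "\<exists>y\<in>K0. x [^] (i::nat) \<in> W y" for i
    proof -
      have "x [^] i \<in> \<Union> (W ` K0)"
        using subsetD[OF \<F>(3) nat_pow_mem[OF K(1,3), of i]] by (simp only: K0(3))
      then show ?thesis by simp
    qed
    then obtain c where c: "\<And>i::nat. c i \<in> K0" "\<And>i. x [^] i \<in> W (c i)" by metis
    have "\<not> inj c"
    proof
      assume "inj c"
      moreover have "finite (range c)" by (rule finite_subset[OF image_subsetI K0(2)]) (rule c(1))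
      ultimately show False using finite_imageD[of c UNIV] by simp
    qed
    then obtain i j where "i \<noteq> j" "c i = c j" unfolding inj_def by blast
    then obtain i j where ij: "i < j" "c i = c j" by (metis nat_neq_iff)
    have cc: "c i \<in> carrier G" using c(1) K0(1) Kc by blast
    have 1: "x [^] i \<otimes> inv (c i) \<in> tor G" "x [^] j \<otimes> inv (c i) \<in> tor G"
      using c(2)[of i] c(2)[of j] ij(2) by (auto simp: W_def)
    have "x [^] (j - i) \<otimes> x [^] i = x [^] j" using ij(1) xc by (simp add: nat_pow_mult)
    then have "(x [^] (j - i) \<otimes> x [^] i) \<otimes> inv (c i) \<in> tor G" using 1(2) by simp
    then have "x [^] (j - i) \<otimes> (x [^] i \<otimes> inv (c i)) \<otimes> inv (x [^] i \<otimes> inv (c i)) \<in> tor G"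
      using 1(1) xc cc by (simp only: m_assoc nat_pow_closed inv_closed T.m_closed T.m_inv_closed)
    then have pt: "x [^] (j - i) \<in> tor G" using xc cc by (simp add: m_assoc)
    show "x \<in> tor G" by (rule tor_of_pow_mem_tor[OF xc _ pt]) (use ij(1) in simp)
  qed
  show "tor G \<subseteq> compact_part G \<tau>"
  proof
    fix x assume x: "x \<in> tor G"
    then have xc: "x \<in> carrier G" by simp
    have "subgroup (generate G {x}) G" using xc by (intro generate_is_subgroup) simp
    moreover have "compactin \<tau> (generate G {x})"
      by (rule finite_imp_compactin[OF _ finite_generate_torsion[OF x]])
        (use generate_incl[of "{x}"] xc top in simp)
    moreover have "x \<in> generate G {x}" by (rule generate.incl) simp
    ultimately show "x \<in> compact_part G \<tau>" by (auto simp: compact_part_def)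
  qed
qed

context topological_comm_group
begin

lemma openin_coset:
  assumes "openin \<tau> S" "x \<in> carrier G"
  shows "openin \<tau> {z \<in> carrier G. z \<otimes> inv x \<in> S}"
proof -
  have "{z \<in> carrier G. z \<otimes> inv x \<in> S} = {z \<in> carrier G. inv x \<otimes> z \<in> S}"
    using assms(2) by (auto simp: m_comm)
  then show ?thesis using openin_translation[OF _ assms(1), of "inv x"] assms(2) by simp
qed

lemma torsion_quotientI: "\<lbrakk>subgroup N G; N \<subseteq> tor G\<rbrakk> \<Longrightarrow> torsion_quotient G N"
  by (intro torsion_quotient.intro torsion_quotient_axioms.intro comm_group_axioms subgroup_imp_normal)

text \<open>The quotient by the torsion subgroup is always torsion-free, and it is discrete once
  that subgroup is open; the rank condition descends to independent sequences of \<open>G\<close>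
  itself.\<close>

lemma cond_b1_iff:
  "cond_b1 G \<tau> (tor G) \<longleftrightarrow>
    tor G = compact_part G \<tau> \<and> openin \<tau> (tor G) \<and> \<not> (\<exists>f. independent_sequence G f)"
proof -
  interpret torsion_quotient G "tor G" by (rule torsion_quotientI[OF subgroup_tor subset_refl])
  show ?thesis
    unfolding cond_b1_def
    using torsion_free_Mod_tor finite_Z_rank_Mod_iff
      discrete_quotient[OF topspace_eq subgroup_tor openin_coset] by blast
qed

lemma cond_b2_iff:
  assumes "openin \<tau> (tor G)"
  shows "cond_b2 G \<tau> (tor G) \<longleftrightarrow>
    (\<forall>X Y. closed_subgroup X G \<tau> \<and> X \<subseteq> tor G \<longrightarrow> closed_subgroup Y G \<tau> \<and> Y \<subseteq> tor G \<longrightarrow> closedin \<tau> (X <#> Y))"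
  unfolding cond_b2_def
  using quasihamiltonian_subgroup_iff[OF subgroup_tor closedin_open_subgroup[OF subgroup_tor assms]] by simp

text \<open>Everything is pulled back along the projection. As \<open>N\<close> is torsion, the
  preimage of \<open>tor (G Mod N)\<close> is \<open>tor G\<close>; preimages of sums are sums of
  preimages; and closedness in the quotient is closedness of the preimage.\<close>

lemma conditions_Mod:
  assumes N: "closed_subgroup N G \<tau>" "N \<subseteq> tor G"
    and b1: "cond_b1 G \<tau> (tor G)" and b2: "cond_b2 G \<tau> (tor G)"
  defines "T' \<equiv> carrier (G\<lparr>carrier := tor G\<rparr> Mod N)"
  shows "tor (G Mod N) = T'"
    and "cond_b1 (G Mod N) (quotient_group_topology G \<tau> N) T'"
    and "cond_b2 (G Mod N) (quotient_group_topology G \<tau> N) T'"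
proof -
  have sN: "subgroup N G" using N(1) by (simp add: closed_subgroup_def)
  interpret torsion_quotient G N by (rule torsion_quotientI[OF sN N(2)])
  interpret T: subgroup "tor G" G by (rule subgroup_tor)
  note mult_FactGroup [simp del]
  define q where "q = quotient_group_topology G \<tau> N"
  have oT: "openin \<tau> (tor G)" and no: "\<not> (\<exists>f. independent_sequence G f)"
    using b1[unfolded cond_b1_iff] by blast+
  have cT: "closedin \<tau> (tor G)" by (rule closedin_open_subgroup[OF subgroup_tor oT])
  have "T' = (\<lambda>x. N #> x) ` tor G"
    by (auto simp: T'_def FactGroup_def RCOSETS_def r_coset_def)
  then show T': "tor (G Mod N) = T'" by (simp add: tor_Mod)
  have top: "topspace q = carrier (G Mod N)"
    unfolding q_def by (rule topspace_quotient_group_topology[OF topspace_eq])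
  have mem: "N #> w \<in> tor (G Mod N) \<longleftrightarrow> w \<in> tor G" if w: "w \<in> carrier G" for w
  proof
    assume "N #> w \<in> tor (G Mod N)"
    then obtain t where t: "t \<in> tor G" "N #> w = N #> t" unfolding tor_Mod by blast
    have tc: "t \<in> carrier G" using t(1) by simp
    have "w \<otimes> inv t \<in> tor G" using r_coset_eq_iff[OF sN w tc] t(2) N(2) by blast
    then have "w \<otimes> inv t \<otimes> t \<in> tor G" using t(1) by simp
    then show "w \<in> tor G" using w tc by (simp add: m_assoc)
  qed (use tor_Mod in blast)
  have preT: "{x \<in> carrier G. N #> x \<in> tor (G Mod N)} = tor G" using mem by auto
  \<comment> \<open>The preimage of a coset of \<open>tor (G Mod N)\<close> is a coset of the open
    subgroup \<open>tor G\<close>.\<close>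
  have key: "openin q {Z \<in> carrier (G Mod N). Z \<otimes>\<^bsub>G Mod N\<^esub> inv\<^bsub>G Mod N\<^esub> X \<in> tor (G Mod N)}"
    if X: "X \<in> carrier (G Mod N)" for X
  proof -
    obtain x where x: "x \<in> carrier G" "X = N #> x" using X by (auto simp: carrier_Mod)
    have eq: "N #> (z \<otimes> inv x) = (N #> z) \<otimes>\<^bsub>G Mod N\<^esub> inv\<^bsub>G Mod N\<^esub> X" if "z \<in> carrier G" for z
      using proj.hom_mult[OF that inv_closed[OF x(1)]] proj.hom_inv[OF x(1)] by (simp only: x(2))
    have "(N #> z) \<otimes>\<^bsub>G Mod N\<^esub> inv\<^bsub>G Mod N\<^esub> X \<in> tor (G Mod N) \<longleftrightarrow> z \<otimes> inv x \<in> tor G"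
      if "z \<in> carrier G" for z
      unfolding eq[OF that, symmetric] by (rule mem) (use that x(1) in simp)
    then have "{z \<in> topspace \<tau>. N #> z \<in> {Z \<in> carrier (G Mod N).
        Z \<otimes>\<^bsub>G Mod N\<^esub> inv\<^bsub>G Mod N\<^esub> X \<in> tor (G Mod N)}} = {z \<in> carrier G. z \<otimes> inv x \<in> tor G}"
      by (auto simp: carrier_Mod)
    then show ?thesis
      using openin_coset[OF oT x(1)] unfolding q_def openin_quotient_group_topology by auto
  qed
  have oT': "openin q (tor (G Mod N))"
    using preT oT subgroup.subset[OF Q.subgroup_tor] unfolding q_def openin_quotient_group_topology by simp
  have cT': "closedin q (tor (G Mod N))"
    using closedin_quotient_group_topology[OF topspace_eq subgroup.subset[OF Q.subgroup_tor]] preT cT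
    unfolding q_def by simp
  interpret QQ: torsion_quotient "G Mod N" "tor (G Mod N)"
    by (intro torsion_quotient.intro torsion_quotient_axioms.intro Q.comm_group_axioms
        Q.subgroup_imp_normal Q.subgroup_tor subset_refl)
  show "cond_b1 (G Mod N) (quotient_group_topology G \<tau> N) T'"
    unfolding cond_b1_def T'[symmetric] q_def[symmetric]
  proof (intro conjI)
    show "tor (G Mod N) = compact_part (G Mod N) q" by (rule Q.compact_part_eq_tor[OF top key, symmetric])
    show "discrete_space (quotient_group_topology (G Mod N) q (tor (G Mod N)))"
      by (rule Q.discrete_quotient[OF top Q.subgroup_tor key])
    show "torsion_free ((G Mod N) Mod tor (G Mod N))" by (rule Q.torsion_free_Mod_tor)
    show "finite_Z_rank ((G Mod N) Mod tor (G Mod N))"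
      unfolding QQ.finite_Z_rank_Mod_iff independent_sequence_Mod_iff by (rule no)
  qed (use oT' in simp_all)
  show "cond_b2 (G Mod N) (quotient_group_topology G \<tau> N) T'"
    unfolding cond_b2_def T'[symmetric] q_def[symmetric] strongly_topologically_quasihamiltonian_def
  proof (intro conjI allI impI refl)
    let ?T = "tor (G Mod N)" and ?Q = "G Mod N"
    fix X Y assume X: "closed_subgroup X (?Q\<lparr>carrier := ?T\<rparr>) (subtopology q ?T)"
      and Y: "closed_subgroup Y (?Q\<lparr>carrier := ?T\<rparr>) (subtopology q ?T)"
    define pre where "pre S = {x \<in> carrier G. N #> x \<in> S}" for S
    have pre: "closed_subgroup (pre S) G \<tau>" "pre S \<subseteq> tor G" "subgroup S ?Q" "S \<subseteq> ?T"
      if S: "closed_subgroup S (?Q\<lparr>carrier := ?T\<rparr>) (subtopology q ?T)" for S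
    proof -
      show sub: "subgroup S ?Q"
        using S Q.incl_subgroup[OF Q.subgroup_tor] by (simp add: closed_subgroup_def)
      have cl: "closedin q S" and ST: "S \<subseteq> ?T"
        using S closedin_closed_subtopology[OF cT'] by (simp_all add: closed_subgroup_def)
      show "S \<subseteq> ?T" by (rule ST)
      show "pre S \<subseteq> tor G" using ST mem by (auto simp: pre_def)
      have "closedin \<tau> (pre S)"
        using cl closedin_quotient_group_topology[OF topspace_eq subgroup.subset[OF sub]]
        by (simp add: pre_def q_def)
      moreover have "subgroup (pre S) G"
      proof (rule subgroupI)
        show "pre S \<subseteq> carrier G" by (auto simp: pre_def)
        have "\<one> \<in> pre S" using proj.hom_one subgroup.one_closed[OF sub] by (simp add: pre_def)
        then show "pre S \<noteq> {}" by blast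
        show "inv a \<in> pre S" if "a \<in> pre S" for a
          using that proj.hom_inv[of a] subgroup.m_inv_closed[OF sub, of "N #> a"] by (simp add: pre_def)
        show "a \<otimes> b \<in> pre S" if "a \<in> pre S" "b \<in> pre S" for a b
          using that proj.hom_mult[of a b] subgroup.m_closed[OF sub, of "N #> a" "N #> b"] by (simp add: pre_def)
      qed
      ultimately show "closed_subgroup (pre S) G \<tau>" by (simp add: closed_subgroup_def)
    qed
    have "closedin \<tau> (pre X <#> pre Y)"
      using b2 pre[OF X] pre[OF Y] by (simp add: cond_b2_iff[OF oT])
    moreover have "pre X <#> pre Y = pre (X <#>\<^bsub>?Q\<^esub> Y)"
    proof
      show "pre X <#> pre Y \<subseteq> pre (X <#>\<^bsub>?Q\<^esub> Y)"
      proof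
        fix z assume "z \<in> pre X <#> pre Y"
        then obtain x y where xy: "x \<in> pre X" "y \<in> pre Y" "z = x \<otimes> y" by (auto simp: set_mult_def)
        then have "N #> z = (N #> x) \<otimes>\<^bsub>?Q\<^esub> (N #> y)" using proj.hom_mult by (simp add: pre_def)
        then show "z \<in> pre (X <#>\<^bsub>?Q\<^esub> Y)"
          using xy Q.set_mult_mem[of "N #> x" X "N #> y" Y] by (simp add: pre_def)
      qed
      \<comment> \<open>Only \<open>B\<close> is lifted, to y; then z - y lies over
        \<open>A\<close>, and z = (z - y) + y holds exactly.\<close>
      show "pre (X <#>\<^bsub>?Q\<^esub> Y) \<subseteq> pre X <#> pre Y"
      proof
        fix z assume z: "z \<in> pre (X <#>\<^bsub>?Q\<^esub> Y)"
        then have zc: "z \<in> carrier G" by (simp add: pre_def)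
        obtain A B where AB: "A \<in> X" "B \<in> Y" "N #> z = A \<otimes>\<^bsub>?Q\<^esub> B"
          using z by (auto simp: pre_def set_mult_def)
        have Bc: "B \<in> carrier ?Q" by (rule subgroup.mem_carrier[OF pre(3)[OF Y] AB(2)])
        then obtain y where y: "y \<in> carrier G" "B = N #> y" by (auto simp: carrier_Mod)
        have Ac: "A \<in> carrier ?Q" by (rule subgroup.mem_carrier[OF pre(3)[OF X] AB(1)])
        have "N #> (z \<otimes> inv y) = (N #> z) \<otimes>\<^bsub>?Q\<^esub> inv\<^bsub>?Q\<^esub> B"
          using proj.hom_mult[OF zc inv_closed[OF y(1)]] proj.hom_inv[OF y(1)] y(2) by simp
        also have "\<dots> = A"
          by (simp only: AB(3) Q.m_assoc[OF Ac Bc Q.inv_closed[OF Bc]] Q.r_inv[OF Bc] Q.r_one[OF Ac])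
        finally have "z \<otimes> inv y \<in> pre X" using AB(1) zc y(1) by (simp add: pre_def)
        moreover have "y \<in> pre Y" using y AB(2) by (simp add: pre_def)
        ultimately have "z \<otimes> inv y \<otimes> y \<in> pre X <#> pre Y" by (rule set_mult_mem)
        then show "z \<in> pre X <#> pre Y" using zc y(1) by (simp add: m_assoc)
      qed
    qed
    moreover have XYT: "X <#>\<^bsub>?Q\<^esub> Y \<subseteq> ?T"
      by (rule Q.set_mult_subset_subgroup[OF Q.subgroup_tor pre(4)[OF X] pre(4)[OF Y]])
    ultimately have "closedin q (X <#>\<^bsub>?Q\<^esub> Y)"
      using closedin_quotient_group_topology[OF topspace_eq, of "X <#>\<^bsub>?Q\<^esub> Y" N]
        subgroup.subset[OF Q.subgroup_tor] by (simp add: pre_def q_def)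
    moreover have "X <#>\<^bsub>?Q\<lparr>carrier := ?T\<rparr>\<^esub> Y = X <#>\<^bsub>?Q\<^esub> Y" by (simp add: set_mult_def)
    ultimately show "closedin (subtopology q ?T) (X <#>\<^bsub>?Q\<lparr>carrier := ?T\<rparr>\<^esub> Y)"
      using XYT closedin_closed_subtopology[OF cT'] by simp
  qed
qed

text \<open>In a Hausdorff space the finite set \<open>U - {\<one>}\<close> is closed, so a finite
  open \<open>U\<close> would make the identity, and by translation every point, isolated.\<close>

lemma infinite_open_subgroup:
  assumes U: "subgroup U G" "openin \<tau> U" and nd: "\<not> discrete_space \<tau>"
  shows "infinite U"
proof
  assume fin: "finite U"
  interpret U: subgroup U G by (rule U)
  have "closedin \<tau> (U - {\<one>})" using fin U.subset by (intro closedin_finite) auto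
  then have "openin \<tau> (U - (U - {\<one>}))" using U(2) by (rule openin_diff[rotated])
  moreover have "U - (U - {\<one>}) = {\<one>}" using U.one_closed by blast
  ultimately have o1: "openin \<tau> {\<one>}" by simp
  have "openin \<tau> {x}" if x: "x \<in> carrier G" for x
  proof -
    have "{z \<in> carrier G. z \<otimes> inv x \<in> {\<one>}} = {x}"
    proof -
      have "z = x" if z: "z \<in> carrier G" "z \<otimes> inv x = \<one>" for z
      proof -
        have "z = z \<otimes> inv x \<otimes> x" using z(1) x by (simp add: m_assoc)
        then show ?thesis using z(2) x by simp
      qed
      then show ?thesis using x by auto
    qed
    then show ?thesis using openin_coset[OF o1 x] by simp
  qed
  then have "discrete_topology (topspace \<tau>) = \<tau>" unfolding discrete_topology_unique by simp
  then show False using nd unfolding discrete_space_def by simp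
qed

end

theorem theorem1p4:
  fixes G :: "('a, 'm) monoid_scheme" and \<tau> :: "'a topology"
  assumes "lca_group G \<tau>"
    and "totally_disconnected_space \<tau>"
    and "\<not> discrete_space \<tau>"
    and "\<not> periodic G \<tau>"
  shows "(topologically_modular G \<tau> \<longleftrightarrow> cond_b1 G \<tau> (tor G) \<and> cond_b2 G \<tau> (tor G)) \<and>
    (cond_b1 G \<tau> (tor G) \<and> cond_b2 G \<tau> (tor G) \<longleftrightarrow>
      strongly_topologically_quasihamiltonian G \<tau>) \<and>
    (cond_b1 G \<tau> (tor G) \<and> cond_b2 G \<tau> (tor G) \<longrightarrow>
      (\<forall>N. closed_subgroup N G \<tau> \<and> N \<subseteq> tor G \<longrightarrow>
        tor (G Mod N) = carrier (G\<lparr>carrier := tor G\<rparr> Mod N) \<and>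
        cond_b1 (G Mod N) (quotient_group_topology G \<tau> N) (carrier (G\<lparr>carrier := tor G\<rparr> Mod N)) \<and>
        cond_b2 (G Mod N) (quotient_group_topology G \<tau> N) (carrier (G\<lparr>carrier := tor G\<rparr> Mod N))))"
proof -
  interpret topological_comm_group G \<tau>
    using assms(1) by (intro topological_comm_groupI) (simp add: lca_group_def)
  have "locally_compact_space \<tau>" using assms(1) by (simp add: lca_group_def)
  then obtain U where U: "subgroup U G" "openin \<tau> U" "compactin \<tau> U"
    using assms(2) by (rule compact_open_subgroup_exists)
  have Uc: "U \<subseteq> compact_part G \<tau>" using U by (auto simp: compact_part_def)
  have ab: "cond_b1 G \<tau> (tor G) \<and> cond_b2 G \<tau> (tor G)" if mod: "topologically_modular G \<tau>"
  proof -
    have "compact_part G \<tau> \<subseteq> carrier G"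
      by (auto simp: compact_part_def dest: subgroup.mem_carrier)
    moreover have "compact_part G \<tau> \<noteq> carrier G" using assms(2,4) by (simp add: periodic_def)
    ultimately obtain x where x: "x \<in> carrier G" "x \<notin> compact_part G \<tau>" by blast
    have eq: "tor G = compact_part G \<tau>"
      using tor_subset_compact_part compact_part_subset_tor[OF mod U x] by (rule subset_antisym)
    have UT: "U \<subseteq> tor G" using Uc eq by simp
    have oT: "openin \<tau> (tor G)"
      by (rule openin_subgroupI[OF subgroup_tor U(2) subgroup.one_closed[OF U(1)] UT])
    have inf: "infinite U" by (rule infinite_open_subgroup[OF U(1,2) assms(3)])
    have "\<not> (\<exists>f. independent_sequence G f)"
      by (rule no_independent_sequence_if_modular[OF mod U inf oT UT])
    moreover have "closedin \<tau> (tor G)" by (rule closedin_open_subgroup[OF subgroup_tor oT])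
    ultimately show ?thesis
      unfolding cond_b1_iff cond_b2_iff[OF oT]
      by (intro conjI allI impI eq oT set_mult_closed_if_modular[OF mod]) simp_all
  qed
  have bc: "strongly_topologically_quasihamiltonian G \<tau>"
    if b: "cond_b1 G \<tau> (tor G)" "cond_b2 G \<tau> (tor G)"
  proof -
    have b1: "tor G = compact_part G \<tau>" "openin \<tau> (tor G)" "\<not> (\<exists>f. independent_sequence G f)"
      using b(1)[unfolded cond_b1_iff] by blast+
    show ?thesis
    proof (rule quasihamiltonian_if_torsion_quasihamiltonian[OF U _ b1(2) _ b1(3)])
      show "U \<subseteq> tor G" using Uc b1(1) by simp
      show "closedin \<tau> (X <#>\<^bsub>G\<^esub> Y)"
        if "closed_subgroup X G \<tau>" "X \<subseteq> tor G" "closed_subgroup Y G \<tau>" "Y \<subseteq> tor G" for X Y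
        using b(2) that by (simp add: cond_b2_iff[OF b1(2)])
    qed
  qed
  show ?thesis
    using ab bc modular_if_quasihamiltonian conditions_Mod by blast
qed

end
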